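(* Let $k\ge2$, $\alpha,\beta>0$, and let $p$ be a polynomial on $\mathbb{R}^2\cong\mathbb{C}$ invariant under $I_{2k}$. For $b\ge0$ and $\xi\in[-1,1]$ let $q=\arccos\xi$, $\lambda=\alpha+\beta$, and $$g(b,\xi)=\tfrac12\Big[\Phi_2^{(k)}\big(\lambda,\dots,\lambda;k\lambda;\big(b\cos\tfrac{q-2j\pi}{k}\big)_{j=0}^{k-1}\big)+\Phi_2^{(k)}\big(\lambda,\dots,\lambda;k\lambda;\big(b\cos\tfrac{\pi-q-2j\pi}{k}\big)_{j=0}^{k-1}\big)\Big].$$ For $z=|z|e^{i\phi_1}$ and $u,v\in[-1,1]$, the function $w=|w|e^{i\phi_2}\mapsto J_{u,v}(z,w):=g\big(|zw|,\xi_{u,v}(k\phi_1,k\phi_2)\big)$ is given by an everywhere convergent power series in the coordinates of $w$. Put $p_{u,v}(z):=[p(w),J_{u,v}(z,w)]_0=\big(p(\partial_w)J_{u,v}(z,w)\big)\big|_{w=0}$. Then $$V_\kappa(p)(z)=\int_{-1}^1\int_{-1}^1p_{u,v}(z)\,d\nu^\alpha(u)\,d\nu^\beta(v),$$ and moreover $p_{u,v}(z)=\frac1{2\pi}\int_{\mathbb{R}^2}\mathcal F\big(e^{-|\cdot|^2/2}J_{u,v}(z,\cdot)\big)(y)\,\mathcal F\big(e^{-|\cdot|^2/2}p\big)(y)\,e^{|y|^2/2}dy$.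
   Context: Identify $\mathbb{R}^2$ with $\mathbb{C}$, $\langle z,w\rangle=\mathrm{Re}(z\bar w)$. The dihedral group $I_{2k}$ (order $4k$) contains the reflections $z\mapsto\bar ze^{ij\pi/k}$, $j=0,\dots,2k-1$, forming two conjugacy classes ($j$ even, containing $z\mapsto\bar z$; $j$ odd); $\kappa=(\alpha,\beta)$ is $\alpha$ on the class with $j$ even and $\beta$ on the class with $j$ odd. $V_\kappa$ is the Dunkl intertwining operator (unique degree-preserving linear isomorphism of polynomials with $V_\kappa1=1$, $T_jV_\kappa=V_\kappa\partial_j$ for the Dunkl operators $T_j$). $p(\partial_w)$ is obtained from $p$ by replacing the coordinates of $w$ by the corresponding partial derivatives. $d\nu^\alpha(u)=\frac{\Gamma(\alpha+1/2)}{\sqrt\pi\Gamma(\alpha)}(1-u^2)^{\alpha-1}du$ on $[-1,1]$. $\xi_{u,v}(\theta_1,\theta_2)=v\cos\theta_1\cos\theta_2+u\sin\theta_1\sin\theta_2$. Humbert function $\Phi_2^{(m)}(\beta_1,\dots,\beta_m;\gamma;x_1,\dots,x_m)=\sum_{j_i\ge0}\frac{(\beta_1)_{j_1}\cdots(\beta_m)_{j_m}}{(\gamma)_{j_1+\cdots+j_m}}\prod_i\frac{x_i^{j_i}}{j_i!}$. Fourier transform $\mathcal Ff(y)=\frac1{2\pi}\int_{\mathbb{R}^2}e^{-i\langle x,y\rangle}f(x)dx$. *)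

theory Defs
  imports "HOL-Analysis.Analysis"
begin

definition poly_rep :: "(nat \<times> nat \<Rightarrow> real) \<Rightarrow> (complex \<Rightarrow> real) \<Rightarrow> bool" where
  "poly_rep c f \<longleftrightarrow> finite {ij. c ij \<noteq> 0} \<and>
     (\<forall>x. f x = (\<Sum>(i,j)\<in>{ij. c ij \<noteq> 0}. c (i,j) * Re x ^ i * Im x ^ j))"

definition polyfun :: "(complex \<Rightarrow> real) \<Rightarrow> bool" where
  "polyfun f \<longleftrightarrow> (\<exists>c. poly_rep c f)"

definition homog_polyfun :: "nat \<Rightarrow> (complex \<Rightarrow> real) \<Rightarrow> bool" where
  "homog_polyfun n f \<longleftrightarrow> (\<exists>c. poly_rep c f \<and> (\<forall>i j. c (i,j) \<noteq> 0 \<longrightarrow> i + j = n))"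

definition poly_coeffs :: "(complex \<Rightarrow> real) \<Rightarrow> (nat \<times> nat \<Rightarrow> real)" where
  "poly_coeffs f = (SOME c. poly_rep c f)"

definition pderiv_dir :: "complex \<Rightarrow> (complex \<Rightarrow> real) \<Rightarrow> complex \<Rightarrow> real" where
  "pderiv_dir e f x = deriv (\<lambda>t. f (x + of_real t * e)) 0"

definition poly_diff_op :: "(complex \<Rightarrow> real) \<Rightarrow> (complex \<Rightarrow> real) \<Rightarrow> complex \<Rightarrow> real" where
  "poly_diff_op p g w =
     (let c = poly_coeffs p in
      \<Sum>(i,j)\<in>{ij. c ij \<noteq> 0}. c (i,j) * ((pderiv_dir 1 ^^ i) ((pderiv_dir \<i> ^^ j) g)) w)"

definition dih_refl :: "nat \<Rightarrow> nat \<Rightarrow> complex \<Rightarrow> complex" where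
  "dih_refl k j z = cnj z * cis (real j * pi / real k)"

text \<open>A root (unit normal of the mirror) of reflection j.\<close>
definition dih_root :: "nat \<Rightarrow> nat \<Rightarrow> complex" where
  "dih_root k j = cis (real j * pi / (2 * real k) + pi / 2)"

definition dih_kappa :: "real \<Rightarrow> real \<Rightarrow> nat \<Rightarrow> real" where
  "dih_kappa a b j = (if even j then a else b)"

definition dunkl :: "nat \<Rightarrow> real \<Rightarrow> real \<Rightarrow> complex \<Rightarrow> (complex \<Rightarrow> real) \<Rightarrow> complex \<Rightarrow> real" where
  "dunkl k a b e f x = pderiv_dir e f x +
     (\<Sum>j<2*k. dih_kappa a b j * (dih_root k j \<bullet> e) *
        (f x - f (dih_refl k j x)) / (dih_root k j \<bullet> x))"

text \<open>V is a Dunkl intertwining operator: a degree-preserving linear isomorphism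
  of the polynomials with V 1 = 1 and T_e V = V d_e (the identity is required off the
  mirrors, where the difference quotients are defined).\<close>
definition is_intertwiner :: "nat \<Rightarrow> real \<Rightarrow> real \<Rightarrow> ((complex \<Rightarrow> real) \<Rightarrow> (complex \<Rightarrow> real)) \<Rightarrow> bool" where
  "is_intertwiner k a b V \<longleftrightarrow>
     bij_betw V {f. polyfun f} {f. polyfun f} \<and>
     (\<forall>f g s t. polyfun f \<longrightarrow> polyfun g \<longrightarrow>
        V (\<lambda>x. s * f x + t * g x) = (\<lambda>x. s * V f x + t * V g x)) \<and>
     (\<forall>n f. homog_polyfun n f \<longrightarrow> homog_polyfun n (V f)) \<and>
     V (\<lambda>_. 1) = (\<lambda>_. 1) \<and>
     (\<forall>e\<in>Basis. \<forall>f. polyfun f \<longrightarrow> (\<forall>x. (\<forall>j<2*k. dih_root k j \<bullet> x \<noteq> 0) \<longrightarrow>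
        dunkl k a b e (V f) x = V (pderiv_dir e f) x))"

definition humbert_Phi2 :: "nat \<Rightarrow> (nat \<Rightarrow> real) \<Rightarrow> real \<Rightarrow> (nat \<Rightarrow> real) \<Rightarrow> real" where
  "humbert_Phi2 m bet gam x =
     infsum (\<lambda>js. (\<Prod>i<m. pochhammer (bet i) (js i) * x i ^ js i / fact (js i))
                  / pochhammer gam (\<Sum>i<m. js i))
            (PiE {..<m} (\<lambda>_. UNIV))"

definition g_fun :: "nat \<Rightarrow> real \<Rightarrow> real \<Rightarrow> real \<Rightarrow> real \<Rightarrow> real" where
  "g_fun k a b r \<xi> =
     (let q = arccos \<xi>; l = a + b in
      (humbert_Phi2 k (\<lambda>_. l) (real k * l)
          (\<lambda>j. r * cos ((q - 2 * real j * pi) / real k))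
     + humbert_Phi2 k (\<lambda>_. l) (real k * l)
          (\<lambda>j. r * cos ((pi - q - 2 * real j * pi) / real k))) / 2)"

definition xi_uv :: "real \<Rightarrow> real \<Rightarrow> real \<Rightarrow> real \<Rightarrow> real" where
  "xi_uv u v t1 t2 = v * cos t1 * cos t2 + u * sin t1 * sin t2"

definition J_uv :: "nat \<Rightarrow> real \<Rightarrow> real \<Rightarrow> real \<Rightarrow> real \<Rightarrow> complex \<Rightarrow> complex \<Rightarrow> real" where
  "J_uv k a b u v z w = g_fun k a b (cmod (z * w)) (xi_uv u v (real k * Arg z) (real k * Arg w))"

definition p_uv :: "nat \<Rightarrow> real \<Rightarrow> real \<Rightarrow> (complex \<Rightarrow> real) \<Rightarrow> real \<Rightarrow> real \<Rightarrow> complex \<Rightarrow> real" where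
  "p_uv k a b p u v z = poly_diff_op p (J_uv k a b u v z) 0"

definition nu_const :: "real \<Rightarrow> real" where
  "nu_const a = Gamma (a + 1/2) / (sqrt pi * Gamma a)"

definition fourier2 :: "(complex \<Rightarrow> real) \<Rightarrow> complex \<Rightarrow> complex" where
  "fourier2 f y = (1 / (2 * pi)) * integral\<^sup>L lborel (\<lambda>x. exp (- \<i> * of_real (x \<bullet> y)) * of_real (f x))"

end

theory Submission
  imports Defs "HOL-Probability.Characteristic_Functions"
begin

text \<open>
  Write \<open>\<lambda> = a + b\<close>. As the numbers \<open>cos ((q - 2 j \<pi>) / k)\<close> are the roots of \<open>T\<^sub>k - cos q\<close>, with \<open>T\<^sub>k\<close>
  the Chebyshev polynomial, the generating product \<open>\<Prod>\<^sub>j (1 - s r cos ((q - 2 j \<pi>) / k))\<close> of the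
  Humbert function is \<open>A(s) - 2 (r s / 2) ^ k cos q\<close> with an even polynomial \<open>A\<close> independent of \<open>q\<close>.
  Expanding its power \<open>- \<lambda>\<close> shows that \<open>J_uv\<close> is an entire series in \<open>w\<close>, with coefficients
  polynomial in \<open>u\<close> and \<open>v\<close>.

  The operator \<open>V\<close> is pinned down by Euler's identity: for \<open>F\<^sub>n(z) = V((x \<bullet> w) ^ n)(z)\<close> one has
  \<open>n F\<^sub>n(z) + \<Sum>\<^sub>j \<kappa>\<^sub>j (F\<^sub>n(z) - F\<^sub>n(\<sigma>\<^sub>j z)) = n (z \<bullet> w) F\<^sub>n\<^sub>-\<^sub>1(z)\<close>, and a maximum argument on the
  orbit of \<open>z\<close> shows that this recursion has only one solution. An explicit solution is obtained
  from the intertwining operator of the group \<open>Z\<^sub>2 \<times> Z\<^sub>2\<close> acting on \<open>z ^ k\<close>. Averaging it over the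
  dihedral group gives the integral of \<open>J_uv\<close> against the two measures, degree by degree.

  For the Fourier formula, the transform of \<open>x ^ n exp (- x\<^sup>2 / 2)\<close> is a Hermite polynomial times the
  Gaussian, and orthogonality of the Hermite polynomials turns the integral into the pairing
  \<open>p(\<partial>) J_uv\<close> at 0.
\<close>

unbundle no vec_syntax
unbundle fps_syntax

section \<open>Powers of formal power series\<close>

definition fps_powr :: "'a :: field_char_0 fps \<Rightarrow> 'a \<Rightarrow> 'a fps" where
  "fps_powr f c = fps_binomial c oo (f - 1)"

lemma fps_powr_nth_0 [simp]: "fps_powr f c $ 0 = 1"
  by (simp add: fps_powr_def)

lemma fps_powr_zero [simp]: "fps_powr f 0 = 1"
  by (simp add: fps_powr_def)

lemma fps_powr_one_eq_one [simp]: "fps_powr 1 c = 1"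
  by (simp add: fps_powr_def)

lemma fps_powr_one:
  assumes "f $ 0 = 1"
  shows "fps_powr f 1 = f"
  using assms
  by (simp add: fps_powr_def fps_binomial_1 fps_compose_add_distrib fps_X_fps_compose_startby0)

lemma fps_powr_add:
  assumes "f $ 0 = 1"
  shows "fps_powr f (c + d) = fps_powr f c * fps_powr f d"
  using assms by (simp add: fps_powr_def fps_binomial_add_mult fps_compose_mult_distrib)

lemma fps_powr_mult_self:
  assumes "f $ 0 = 1"
  shows "f * fps_powr f c = fps_powr f (c + 1)"
  using fps_powr_add[OF assms, of c 1] fps_powr_one[OF assms] by (simp add: mult.commute)

lemma fps_powr_power:
  assumes "f $ 0 = 1"
  shows "fps_powr f c ^ n = fps_powr f (of_nat n * c)"
  by (induction n) (simp_all add: algebra_simps fps_powr_add[OF assms])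

lemma inverse_eq_fps_powr:
  assumes "f $ 0 = 1"
  shows "inverse f = fps_powr f (- 1)"
  using fps_powr_mult_self[OF assms, of "- 1"] by (simp add: fps_inverse_unique)

lemma fps_powr_compose:
  assumes "f $ 0 = 1" and "t $ 0 = 0"
  shows "fps_powr f c oo t = fps_powr (f oo t) c"
  using assms by (simp add: fps_powr_def fps_compose_assoc[symmetric] fps_compose_sub_distrib)

lemma fps_powr_linear_nth:
  "fps_powr (1 - fps_const x * fps_X) (- c) $ n = pochhammer c n * x ^ n / fact n"
proof -
  have "fps_powr (1 - fps_const x * fps_X) (- c) = fps_binomial (- c) oo (fps_const (- x) * fps_X)"
    by (simp add: fps_powr_def del: fps_const_neg add: fps_const_neg[symmetric])
  also have "\<dots> $ n = ((- x) * (- 1)) ^ n * pochhammer c n / fact n"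
    unfolding power_mult_distrib by (simp add: fps_compose_linear gbinomial_pochhammer)
  finally show ?thesis by simp
qed

lemma fps_deriv_powr:
  assumes "f $ 0 = 1"
  shows "f * fps_deriv (fps_powr f c) = fps_const c * fps_deriv f * fps_powr f c"
proof -
  have f0: "(f - 1) $ 0 = 0" using assms by simp
  have "(1 + fps_X) * fps_deriv (fps_binomial c) = fps_const c * fps_binomial c"
    unfolding fps_binomial_deriv
    by (simp add: fps_divide_unit mult.left_commute[of "1 + fps_X"] inverse_mult_eq_1')
  hence "((1 + fps_X) * fps_deriv (fps_binomial c)) oo (f - 1) =
      (fps_const c * fps_binomial c) oo (f - 1)"
    by simp
  hence "f * (fps_deriv (fps_binomial c) oo (f - 1)) = fps_const c * fps_powr f c"
    using f0 by (simp add: fps_compose_mult_distrib fps_compose_add_distrib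
        fps_X_fps_compose_startby0 fps_powr_def)
  moreover have "fps_deriv (fps_powr f c) = (fps_deriv (fps_binomial c) oo (f - 1)) * fps_deriv f"
    unfolding fps_powr_def by (subst fps_compose_deriv[OF f0]) simp
  ultimately show ?thesis by (simp add: mult_ac)
qed

lemma subdegree_fps_deriv:
  fixes f :: "'a :: field_char_0 fps"
  assumes "f $ 0 = 0" and "f \<noteq> 0"
  shows "fps_deriv f \<noteq> 0" and "subdegree f = Suc (subdegree (fps_deriv f))"
proof -
  have "subdegree f \<noteq> 0" using assms by (metis nth_subdegree_nonzero)
  then obtain m where m: "subdegree f = Suc m" by (cases "subdegree f") auto
  hence "f $ Suc m \<noteq> 0" using assms(2) by (metis nth_subdegree_nonzero)
  hence nz: "fps_deriv f $ m \<noteq> 0" by (simp del: of_nat_Suc)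
  thus "fps_deriv f \<noteq> 0" by (metis fps_zero_nth)
  have "subdegree (fps_deriv f) = m"
    using nz by (rule subdegreeI) (simp add: m nth_less_subdegree_zero)
  thus "subdegree f = Suc (subdegree (fps_deriv f))" by (simp add: m)
qed

lemma fps_linear_ODE_unique:
  fixes f g h F :: "'a :: field_char_0 fps"
  assumes "f $ 0 \<noteq> 0" and "f * fps_deriv F = h * F" and "f * fps_deriv G = h * G" and "F $ 0 = G $ 0"
  shows "F = G"
proof (rule ccontr)
  assume "F \<noteq> G"
  define D where "D = F - G"
  have D: "D \<noteq> 0" "D $ 0 = 0" "f * fps_deriv D = h * D"
    using assms \<open>F \<noteq> G\<close> by (simp_all add: D_def right_diff_distrib)
  have D': "fps_deriv D \<noteq> 0" "subdegree D = Suc (subdegree (fps_deriv D))"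
    using subdegree_fps_deriv D by auto
  have f: "f \<noteq> 0" "subdegree f = 0" using assms(1) by auto
  have "h \<noteq> 0" using D(3) D'(1) f(1) by auto
  moreover have "subdegree (f * fps_deriv D) = subdegree (fps_deriv D)" using f D'(1) by simp
  ultimately have "subdegree (fps_deriv D) = subdegree h + subdegree D" using D by simp
  thus False using D' by simp
qed

lemma fps_powr_mult:
  assumes "f $ 0 = 1" and "g $ 0 = 1"
  shows "fps_powr (f * g) c = fps_powr f c * fps_powr g c"
proof (rule fps_linear_ODE_unique[where f = "f * g" and h = "fps_const c * fps_deriv (f * g)"])
  show "f * g * fps_deriv (fps_powr (f * g) c) = fps_const c * fps_deriv (f * g) * fps_powr (f * g) c"
    using assms by (intro fps_deriv_powr) simp
  have "f * g * fps_deriv (fps_powr f c * fps_powr g c) =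
      (f * fps_deriv (fps_powr f c)) * (g * fps_powr g c)
      + (f * fps_powr f c) * (g * fps_deriv (fps_powr g c))"
    by (simp add: algebra_simps)
  also have "\<dots> = fps_const c * fps_deriv (f * g) * (fps_powr f c * fps_powr g c)"
    unfolding fps_deriv_powr[OF assms(1)] fps_deriv_powr[OF assms(2)] by (simp add: algebra_simps)
  finally show "f * g * fps_deriv (fps_powr f c * fps_powr g c) =
      fps_const c * fps_deriv (f * g) * (fps_powr f c * fps_powr g c)" .
qed (use assms in auto)

lemma fps_prod_nth_0: "(\<Prod>i\<in>I. f i) $ 0 = (\<Prod>i\<in>I. f i $ 0 :: 'a :: comm_semiring_1)"
  by (induction I rule: infinite_finite_induct) auto

lemma fps_powr_prod:
  assumes "\<And>i. i \<in> I \<Longrightarrow> f i $ 0 = 1"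
  shows "fps_powr (\<Prod>i\<in>I. f i) c = (\<Prod>i\<in>I. fps_powr (f i) c)"
  using assms
  by (induction I rule: infinite_finite_induct) (auto simp: fps_powr_mult fps_prod_nth_0)

definition fps_euler :: "'a :: comm_ring_1 \<Rightarrow> 'a fps \<Rightarrow> 'a fps" where
  "fps_euler c f = fps_X * fps_deriv f + fps_const c * f"

lemma fps_euler_nth [simp]: "fps_euler c f $ n = (of_nat n + c) * f $ n"
  by (cases n) (simp_all add: fps_euler_def algebra_simps)

definition fps_powr_subst :: "nat \<Rightarrow> 'a :: field_char_0 \<Rightarrow> 'a fps \<Rightarrow> 'a fps \<Rightarrow> 'a fps" where
  "fps_powr_subst k l A d = fps_powr A (- l) * (d oo (fps_X ^ k * inverse A))"

lemma fps_mult_X_power_mult_inverse: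
  fixes A :: "'a :: field fps"
  assumes "A $ 0 = 1"
  shows "A * (fps_X ^ k * inverse A) = fps_X ^ k"
  using assms by (simp add: mult.left_commute inverse_mult_eq_1')

lemma fps_diff_X_power_factor:
  fixes A :: "'a :: field fps"
  assumes "A $ 0 = 1"
  shows "A - fps_const y * fps_X ^ k = A * (1 - fps_const y * (fps_X ^ k * inverse A))"
  by (metis fps_mult_X_power_mult_inverse[OF assms] right_diff_distrib mult.left_commute mult_1_right)

lemma fps_linear_compose:
  assumes "t $ 0 = 0"
  shows "(1 - fps_const y * fps_X) oo t = 1 - fps_const y * (t :: 'a :: idom fps)"
  using assms
  by (simp add: fps_compose_sub_distrib fps_compose_mult_distrib fps_X_fps_compose_startby0)

lemma fps_powr_subst_add:
  "fps_powr_subst k l A (d + e) =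
    fps_powr_subst k l A d + fps_powr_subst k l A e"
  by (simp add: fps_powr_subst_def fps_compose_add_distrib distrib_left)

lemma fps_powr_subst_const_mult:
  assumes "k > 0"
  shows "fps_powr_subst k l A (fps_const c * d) = fps_const c * fps_powr_subst k l A d"
  using assms by (simp add: fps_powr_subst_def fps_compose_mult_distrib mult_ac)

lemma fps_powr_subst_linear_mult:
  assumes A: "A $ 0 = 1" and k: "k > 0"
  shows "fps_powr_subst k l A ((1 - fps_const y * fps_X) * d) =
    (A - fps_const y * fps_X ^ k) * fps_powr_subst k (l + 1) A d"
proof -
  have t0: "(fps_X ^ k * inverse A) $ 0 = 0" using k by simp
  have "fps_powr A (- l) = A * fps_powr A (- (l + 1))"
    by (simp add: fps_powr_mult_self[OF A])
  thus ?thesis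
    unfolding fps_powr_subst_def fps_diff_X_power_factor[OF A] fps_compose_mult_distrib[OF t0]
      fps_linear_compose[OF t0] by (simp only: mult_ac)
qed

lemma fps_powr_diff_X_power:
  assumes A: "A $ 0 = 1" and k: "k > 0"
  shows "fps_powr (A - fps_const y * fps_X ^ k) (- l) =
    fps_powr_subst k l A (fps_powr (1 - fps_const y * fps_X) (- l))"
  unfolding fps_diff_X_power_factor[OF A] fps_powr_subst_def
  using k by (simp add: fps_powr_mult A fps_powr_compose fps_linear_compose)

lemma fps_X_mult_deriv_X_power:
  "fps_X * fps_deriv (fps_X ^ k) = fps_const (of_nat k) * (fps_X ^ k :: 'a :: comm_ring_1 fps)"
  by (rule fps_ext) (auto simp: fps_X_power_nth fps_X_mult_nth)

lemma fps_euler_powr_subst: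
  fixes A d :: "'a :: field_char_0 fps"
  assumes A: "A $ 0 = 1" and k: "k > 0"
  shows "fps_euler (of_nat k * l) (fps_powr_subst k l A d) =
    (fps_const (of_nat k) * A - fps_X * fps_deriv A) * fps_powr_subst k (l + 1) A (fps_euler l d)"
proof -
  define t where "t = fps_X ^ k * inverse A"
  define R where "R = fps_powr A (- (l + 1))"
  have t0: "t $ 0 = 0" using k by (simp add: t_def)
  have AR: "fps_powr A (- l) = A * R" by (simp add: R_def fps_powr_mult_self[OF A])
  have deriv_powr: "fps_deriv (fps_powr A (- l)) = - fps_const l * fps_deriv A * R"
  proof -
    have "A * fps_deriv (fps_powr A (- l)) = A * (- fps_const l * fps_deriv A * R)"
      using fps_deriv_powr[OF A, of "- l"] unfolding AR by (simp add: mult_ac)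
    moreover have "A \<noteq> 0" using A by auto
    ultimately show ?thesis by (metis mult_left_cancel)
  qed
  have deriv_t: "A * (fps_X * fps_deriv t) = t * (fps_const (of_nat k) * A - fps_X * fps_deriv A)"
  proof -
    have "A * t = fps_X ^ k" unfolding t_def by (rule fps_mult_X_power_mult_inverse[OF A])
    hence "fps_X * fps_deriv (A * t) = fps_const (of_nat k) * (A * t)"
      by (simp only: fps_X_mult_deriv_X_power)
    thus ?thesis by (simp add: algebra_simps)
  qed
  have "fps_euler (of_nat k * l) (fps_powr A (- l) * (d oo t)) =
      fps_X * (- fps_const l * fps_deriv A * R) * (d oo t)
      + R * (fps_deriv d oo t) * (A * (fps_X * fps_deriv t)) + fps_const (of_nat k * l) *
      (A * R * (d oo t))"
    unfolding fps_euler_def fps_deriv_mult deriv_powr fps_compose_deriv[OF t0]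
    by (simp add: AR algebra_simps)
  also have "\<dots> = (fps_const (of_nat k) * A - fps_X * fps_deriv A) *
      (R * (t * (fps_deriv d oo t) + fps_const l * (d oo t)))"
    unfolding deriv_t by (simp add: algebra_simps del: fps_const_neg flip: fps_const_mult)
  also have "t * (fps_deriv d oo t) + fps_const l * (d oo t) = fps_euler l d oo t"
    using t0 by (simp add: fps_euler_def fps_compose_add_distrib fps_compose_mult_distrib
        fps_X_fps_compose_startby0)
  finally show ?thesis by (simp add: fps_powr_subst_def t_def R_def)
qed

lemma fps_compose_nth_atMost:
  assumes "t $ 0 = 0" and "i \<le> n"
  shows "(d oo t) $ i = (\<Sum>m\<le>n. d $ m * (t ^ m) $ i :: 'a :: comm_ring_1)"
  unfolding fps_compose_nth atLeast0AtMost using assms startsby_zero_power_prefix[OF assms(1)]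
  by (intro sum.mono_neutral_left) auto

lemma fps_mult_compose_nth:
  assumes "t $ 0 = 0"
  shows "(f * (d oo t)) $ n = (\<Sum>m\<le>n. d $ m * (f * t ^ m) $ n :: 'a :: comm_ring_1)"
proof -
  have "(f * (d oo t)) $ n = (\<Sum>i=0..n. f $ i * (\<Sum>m\<le>n. d $ m * (t ^ m) $ (n - i)))"
    unfolding fps_mult_nth by (intro sum.cong) (auto simp: fps_compose_nth_atMost[OF assms, of _ n])
  also have "\<dots> = (\<Sum>m\<le>n. d $ m * (\<Sum>i=0..n. f $ i * (t ^ m) $ (n - i)))"
    by (simp only: sum_distrib_left sum.swap[of _ "{0..n}"]) (simp add: mult_ac)
  finally show ?thesis by (simp add: fps_mult_nth)
qed

lemma fps_powr_subst_nth:
  assumes A: "A $ 0 = 1" and k: "k > 0"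
  shows "fps_powr_subst k l A d $ n =
      (\<Sum>m\<le>n div k. d $ m * fps_powr A (- (l + of_nat m)) $ (n - k * m))"
proof -
  define t where "t = fps_X ^ k * inverse A"
  have t0: "t $ 0 = 0" using k by (simp add: t_def)
  have "fps_powr A (- l) * t ^ m = fps_X ^ (k * m) * fps_powr A (- (l + of_nat m))" for m
    using fps_powr_add[OF A, of "- l" "- of_nat m"]
    by (simp add: t_def power_mult_distrib power_mult inverse_eq_fps_powr[OF A]
        fps_powr_power[OF A] mult_ac)
  hence "fps_powr_subst k l A d $ n =
      (\<Sum>m\<le>n. if k * m \<le> n then d $ m * fps_powr A (- (l + of_nat m)) $ (n - k * m) else 0)"
    unfolding fps_powr_subst_def t_def[symmetric] fps_mult_compose_nth[OF t0]
    by (intro sum.cong refl) (simp add: fps_X_power_mult_nth)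
  also have "\<dots> = (\<Sum>m\<le>n div k. d $ m * fps_powr A (- (l + of_nat m)) $ (n - k * m))"
  proof -
    have "k * m \<le> n \<longleftrightarrow> m \<le> n div k" for m
      using k by (simp add: less_eq_div_iff_mult_less_eq mult.commute)
    moreover have "{..n div k} \<subseteq> {..n}" by (auto intro: order_trans[OF _ div_le_dividend])
    ultimately show ?thesis by (intro sum.mono_neutral_cong_right) auto
  qed
  finally show ?thesis .
qed

section \<open>The Chebyshev product and the Humbert function\<close>

lemma prod_one_minus_roots_unity:
  assumes "k > 0"
  shows "(\<Prod>j<k. 1 - x * cis (2 * pi * real j / real k)) = 1 - x ^ k"
proof (cases "x = 0")
  case False
  define \<omega> where "\<omega> j = cis (2 * pi * real j / real k)" for j :: nat
  let ?P = "\<Prod>j<k. [:- \<omega> j, 1:]"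
  have roots: "bij_betw \<omega> {..<k} {z. z ^ k = 1}"
    unfolding \<omega>_def by (rule Complex.bij_betw_roots_unity[OF assms])
  have deg: "degree ?P = k"
    by (subst degree_prod_eq_sum_degree) auto
  have "?P = monom 1 k - 1"
  proof (rule poly_eqI_degree_lead_coeff[where A = "{z. z ^ k = 1}" and n = k])
    show "card {z::complex. z ^ k = 1} \<ge> k"
      using card_roots_unity_eq[OF assms] by simp
    show "degree (monom 1 k - 1 :: complex poly) \<le> k"
      by (intro degree_diff_le) (auto simp: degree_monom_eq)
    show "poly ?P z = poly (monom 1 k - 1) z" if "z \<in> {z. z ^ k = 1}" for z
    proof -
      have "z \<in> \<omega> ` {..<k}" using that by (simp only: bij_betw_imp_surj_on[OF roots])
      then obtain j where "j < k" "z = \<omega> j" by blast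
      hence "poly ?P z = 0" by (auto simp: poly_prod)
      thus ?thesis using that by (simp add: poly_monom)
    qed
    have "lead_coeff ?P = 1" by (simp add: lead_coeff_prod)
    thus "coeff ?P k = coeff (monom 1 k - 1) k" using assms deg by (simp add: coeff_eq_0)
  qed (simp add: deg)
  have "(\<Prod>j<k. 1 - x * \<omega> j) = (\<Prod>j<k. x * (inverse x - \<omega> j))"
    using False by (intro prod.cong) (auto simp: algebra_simps)
  also have "\<dots> = x ^ k * poly ?P (inverse x)"
    by (simp add: poly_prod prod.distrib)
  also have "\<dots> = 1 - x ^ k"
    unfolding \<open>?P = monom 1 k - 1\<close> using False by (simp add: poly_monom algebra_simps power_inverse)
  finally show ?thesis unfolding \<omega>_def .
qed (use assms in auto)

lemma cmod_one_minus_cis_squared: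
  "(cmod (1 - of_real t * cis x))\<^sup>2 = 1 - 2 * t * cos x + t\<^sup>2"
proof -
  have "(cmod (1 - of_real t * cis x))\<^sup>2 = (1 - t * cos x)\<^sup>2 + (t * sin x)\<^sup>2"
    by (simp add: cmod_power2)
  also have "\<dots> = 1 - 2 * t * cos x + t\<^sup>2 * ((sin x)\<^sup>2 + (cos x)\<^sup>2)"
    by (simp only: power2_eq_square distrib_left distrib_right) (simp add: algebra_simps)
  finally show ?thesis by simp
qed

definition cheb_root :: "nat \<Rightarrow> real \<Rightarrow> nat \<Rightarrow> real" where
  "cheb_root k q j = cos ((q - 2 * real j * pi) / real k)"

lemma prod_quadratic_cheb_root:
  assumes "k > 0"
  shows "(\<Prod>j<k. 1 - 2 * t * cheb_root k q j + t\<^sup>2) = 1 - 2 * t ^ k * cos q + (t ^ k)\<^sup>2"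
proof -
  define x where "x = of_real t * cis (- q / real k)"
  have "1 - 2 * t * cheb_root k q j + t\<^sup>2 = (cmod (1 - x * cis (2 * pi * real j / real k)))\<^sup>2" for j
  proof -
    have "- q / real k + 2 * pi * real j / real k = - ((q - 2 * real j * pi) / real k)"
      by (simp add: diff_divide_distrib mult_ac)
    hence "x * cis (2 * pi * real j / real k) = of_real t * cis (- ((q - 2 * real j * pi) / real k))"
      by (simp only: x_def mult.assoc cis_mult)
    thus ?thesis by (simp only: cheb_root_def cmod_one_minus_cis_squared cos_minus)
  qed
  hence "(\<Prod>j<k. 1 - 2 * t * cheb_root k q j + t\<^sup>2) =
      (cmod (\<Prod>j<k. 1 - x * cis (2 * pi * real j / real k)))\<^sup>2"
    by (simp only: prod_norm[symmetric] prod_power_distrib)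
  also have "\<dots> = (cmod (1 - x ^ k))\<^sup>2"
    by (simp only: prod_one_minus_roots_unity[OF assms])
  also have "x ^ k = of_real (t ^ k) * cis (- q)"
    using assms by (simp add: x_def power_mult_distrib Complex.DeMoivre)
  finally show ?thesis by (simp only: cmod_one_minus_cis_squared cos_minus)
qed

lemma poly_prod_cheb_root:
  assumes "k > 0"
  shows "poly (\<Prod>j<k. [:1, - cheb_root k q j:]) (2 * t / (1 + t\<^sup>2)) =
    (1 - 2 * t ^ k * cos q + (t ^ k)\<^sup>2) / (1 + t\<^sup>2) ^ k"
proof -
  have "1 + t\<^sup>2 > 0" by (simp add: add_pos_nonneg)
  hence "poly (\<Prod>j<k. [:1, - cheb_root k q j:]) (2 * t / (1 + t\<^sup>2)) =
      (\<Prod>j<k. (1 - 2 * t * cheb_root k q j + t\<^sup>2) / (1 + t\<^sup>2))"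
    unfolding poly_prod by (intro prod.cong) (auto simp: field_simps)
  thus ?thesis by (simp add: prod_dividef prod_quadratic_cheb_root[OF assms])
qed

lemma infinite_range_half_angle: "infinite (range (\<lambda>t::real. 2 * t / (1 + t\<^sup>2)))"
proof -
  have "{0<..<1} \<subseteq> range (\<lambda>t::real. 2 * t / (1 + t\<^sup>2))"
  proof
    fix x :: real assume "x \<in> {0<..<1}"
    have "continuous_on {0..1} (\<lambda>t::real. 2 * t / (1 + t\<^sup>2))"
      by (intro continuous_intros) (smt (verit) zero_le_power2)
    then obtain t where "2 * t / (1 + t\<^sup>2) = x"
      using IVT'[of "\<lambda>t. 2 * t / (1 + t\<^sup>2)" 0 x 1] \<open>x \<in> {0<..<1}\<close> by auto
    thus "x \<in> range (\<lambda>t. 2 * t / (1 + t\<^sup>2))" by blast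
  qed
  thus ?thesis by (rule infinite_super) simp
qed

text \<open>Up to normalisation this is the reciprocal polynomial of \<open>T\<^sub>k - cos q\<close>, with \<open>T\<^sub>k\<close> the
  Chebyshev polynomial; hence \<open>q\<close> only enters through the coefficient of \<open>X\<^sup>k\<close>.\<close>

lemma prod_cheb_root_eq:
  assumes "k > 0"
  shows "(\<Prod>j<k. [:1, - cheb_root k q j:]) =
    (\<Prod>j<k. [:1, - cheb_root k (pi / 2) j:]) - monom (2 * (1 / 2) ^ k * cos q) k"
proof -
  define D where "D = (\<Prod>j<k. [:1, - cheb_root k q j:]) -
    (\<Prod>j<k. [:1, - cheb_root k (pi / 2) j:]) + monom (2 * (1 / 2) ^ k * cos q) k"
  have "poly D (2 * t / (1 + t\<^sup>2)) = 0" for t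
  proof -
    have "2 * (1 / 2) ^ k * cos q * (2 * t / (1 + t\<^sup>2)) ^ k = 2 * t ^ k * cos q / (1 + t\<^sup>2) ^ k"
      by (simp add: power_divide power_mult_distrib)
    thus ?thesis
      by (simp add: D_def poly_monom poly_prod_cheb_root[OF assms] diff_divide_distrib
          add_divide_distrib)
  qed
  hence "range (\<lambda>t. 2 * t / (1 + t\<^sup>2)) \<subseteq> {x. poly D x = 0}" by auto
  hence "infinite {x. poly D x = 0}" using infinite_range_half_angle infinite_super by blast
  hence "D = 0" using poly_roots_finite by blast
  thus ?thesis by (simp add: D_def algebra_simps)
qed

definition cheb_prod :: "nat \<Rightarrow> real \<Rightarrow> real \<Rightarrow> real fps" where
  "cheb_prod k r q = (\<Prod>j<k. 1 - fps_const (r * cheb_root k q j) * fps_X)"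

abbreviation cheb_base :: "nat \<Rightarrow> real \<Rightarrow> real fps" where
  "cheb_base k r \<equiv> cheb_prod k r (pi / 2)"

lemma cheb_prod_nth_0 [simp]: "cheb_prod k r q $ 0 = 1"
  by (simp add: cheb_prod_def fps_prod_nth_0)

lemma cheb_prod_scale: "cheb_prod k r q = cheb_prod k 1 q oo (fps_const r * fps_X)"
proof -
  have "(1 - fps_const c * fps_X) oo (fps_const r * fps_X) = 1 - fps_const (r * c) * fps_X" for c
    by (simp add: fps_linear_compose mult.assoc[symmetric] mult.commute[of c r])
  thus ?thesis unfolding cheb_prod_def
    by (subst fps_compose_prod_distrib) auto
qed

lemma cheb_prod_one_eq: "cheb_prod k 1 q = fps_of_poly (\<Prod>j<k. [:1, - cheb_root k q j:])"
  by (simp add: cheb_prod_def fps_of_poly_prod fps_of_poly_pCons mult.commute flip: fps_const_neg)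

lemma cheb_prod_eq:
  assumes "k > 0"
  shows "cheb_prod k r q = cheb_base k r - fps_const (2 * (r / 2) ^ k * cos q) * fps_X ^ k"
proof -
  have "cheb_prod k 1 q = cheb_base k 1 - fps_const (2 * (1 / 2) ^ k * cos q) * fps_X ^ k"
    unfolding cheb_prod_one_eq
    by (subst prod_cheb_root_eq[OF assms]) (simp add: fps_of_poly_diff fps_of_poly_monom)
  hence "cheb_prod k r q =
      (cheb_base k 1 - fps_const (2 * (1 / 2) ^ k * cos q) * fps_X ^ k) oo (fps_const r * fps_X)"
    by (simp add: cheb_prod_scale[of k r q])
  also have "\<dots> = cheb_base k r - fps_const (2 * (1 / 2) ^ k * cos q) * (fps_const r * fps_X) ^ k"
    by (simp add: fps_compose_sub_distrib fps_compose_mult_distrib fps_compose_power[symmetric]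
        fps_X_fps_compose_startby0 cheb_prod_scale[of k r "pi / 2"])
  also have "fps_const (2 * (1 / 2) ^ k * cos q) * (fps_const r * fps_X) ^ k =
      fps_const (2 * (r / 2) ^ k * cos q) * fps_X ^ k"
    by (simp only: power_mult_distrib fps_const_power mult.assoc[symmetric] fps_const_mult)
       (simp add: power_divide mult_ac)
  finally show ?thesis .
qed

lemma fps_powr_cheb_prod_nth_scale:
  "fps_powr (cheb_prod k r q) c $ n = r ^ n * fps_powr (cheb_prod k 1 q) c $ n"
  by (subst cheb_prod_scale, subst fps_powr_compose[symmetric]) (auto simp: fps_compose_linear)

lemma fps_powr_cheb_base_nth_odd:
  assumes "k > 0" and "odd n"
  shows "fps_powr (cheb_base k 1) c $ n = 0"
proof -
  have "- cheb_root k (pi / 2) j = cheb_root k (pi / 2 + real k * pi) j" for j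
  proof -
    have "(pi / 2 + real k * pi - 2 * real j * pi) / real k =
        (pi / 2 - 2 * real j * pi) / real k + pi"
      using assms by (simp add: field_simps)
    thus ?thesis by (simp add: cheb_root_def cos_add)
  qed
  hence "cheb_base k (- 1) = cheb_prod k 1 (pi / 2 + real k * pi)" by (simp add: cheb_prod_def)
  also have "\<dots> = cheb_base k 1"
    by (subst cheb_prod_eq[OF assms(1)]) (simp add: cos_add)
  finally have "fps_powr (cheb_base k 1) c $ n = (- 1) ^ n * fps_powr (cheb_base k 1) c $ n"
    using fps_powr_cheb_prod_nth_scale[of k "- 1" "pi / 2" c n] by simp
  thus ?thesis using assms(2) by simp
qed

lemma fps_powr_cheb_prod_nth:
  assumes "k > 0"
  shows "fps_powr (cheb_prod k r q) (- l) $ n =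
    (\<Sum>m\<le>n div k. pochhammer l m / fact m * (2 * (r / 2) ^ k * cos q) ^ m *
       fps_powr (cheb_base k r) (- (l + real m)) $ (n - k * m))"
  unfolding cheb_prod_eq[OF assms, of r q]
    fps_powr_diff_X_power[OF cheb_prod_nth_0 assms] fps_powr_subst_nth[OF cheb_prod_nth_0 assms]
  by (simp only: fps_powr_linear_nth) simp

lemma norm_pochhammer_le:
  fixes c :: "'a :: real_normed_field"
  shows "norm (pochhammer c n) \<le> (norm c + 1) ^ n * fact n"
proof (induction n)
  case (Suc n)
  have "norm (c + of_nat n) \<le> norm c + real n" using norm_triangle_ineq[of c "of_nat n"] by simp
  also have "\<dots> \<le> (norm c + 1) * (real n + 1)" by (simp add: algebra_simps)
  finally have "norm (pochhammer c n) * norm (c + of_nat n) \<le>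
      ((norm c + 1) ^ n * fact n) * ((norm c + 1) * (real n + 1))"
    using Suc by (intro mult_mono) auto
  thus ?case unfolding pochhammer_Suc norm_mult by (simp add: algebra_simps)
qed simp

lemma power_mult_fact_le_pochhammer:
  fixes c d :: real
  assumes "0 \<le> d" "d \<le> c" "d \<le> 1"
  shows "d ^ n * fact n \<le> pochhammer c n"
proof (induction n)
  case (Suc n)
  have "d * (real n + 1) = d * real n + d" by (simp add: algebra_simps)
  also have "\<dots> \<le> c + real n" using assms mult_right_mono[of d 1 "real n"] by simp
  finally have "(d ^ n * fact n) * (d * (real n + 1)) \<le> pochhammer c n * (c + real n)"
    using Suc assms by (intro mult_mono) (auto intro: order_trans[OF _ Suc])
  thus ?case by (simp add: pochhammer_Suc algebra_simps)
qed simp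

lemma prod_fact_le_fact_sum:
  "(\<Prod>i\<in>A. fact (js i) :: real) \<le> fact (\<Sum>i\<in>A. js i)"
proof (induction A rule: infinite_finite_induct)
  case (insert i A)
  have fact_mult_le: "fact m * fact n \<le> (fact (m + n) :: real)" for m n
    using dvd_imp_le[OF fact_fact_dvd_fact[of m n]]
    by (metis fact_gt_zero of_nat_fact of_nat_le_iff of_nat_mult)
  have "(\<Prod>i\<in>insert i A. fact (js i) :: real) \<le> fact (js i) * fact (\<Sum>i\<in>A. js i)"
    using insert by (simp add: mult_left_mono)
  also have "\<dots> \<le> fact (js i + (\<Sum>i\<in>A. js i))" by (rule fact_mult_le)
  finally show ?case using insert by simp
qed simp_all

lemma finite_PiE_sum_eq:
  assumes "finite A"
  shows "finite {js \<in> PiE A (\<lambda>_. UNIV). (\<Sum>i\<in>A. js i) = (n :: nat)}"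
proof (rule finite_subset)
  show "{js \<in> PiE A (\<lambda>_. UNIV). (\<Sum>i\<in>A. js i) = n} \<subseteq> PiE A (\<lambda>_. {..n})"
    using assms by (auto intro: member_le_sum)
qed (use assms in \<open>auto intro: finite_PiE\<close>)

lemma fps_prod_nth_PiE:
  fixes f :: "'i \<Rightarrow> 'a :: comm_semiring_1 fps"
  assumes "finite A"
  shows "(\<Prod>i\<in>A. f i) $ n =
    (\<Sum>js\<in>{js \<in> PiE A (\<lambda>_. UNIV). (\<Sum>i\<in>A. js i) = n}. \<Prod>i\<in>A. f i $ js i)"
  unfolding fps_prod_nth'[OF assms]
proof (rule sum.reindex_bij_witness[where j = "\<lambda>X. restrict (count X) A"
      and i = "\<lambda>js. \<Sum>i\<in>A. replicate_mset (js i) i"])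
  fix X assume X: "X \<in> multisets_of_size A n"
  show "(\<Sum>i\<in>A. replicate_mset (restrict (count X) A i) i) = X"
    using X assms by (auto simp: multisets_of_size_def multiset_eq_iff count_sum not_in_iff)
  have "(\<Sum>i\<in>A. count X i) = n"
    using X assms by (auto simp: multisets_of_size_def size_multiset_overloaded_eq not_in_iff
        intro!: sum.mono_neutral_right)
  thus "restrict (count X) A \<in> {js \<in> PiE A (\<lambda>_. UNIV). (\<Sum>i\<in>A. js i) = n}" by simp
next
  fix js :: "'i \<Rightarrow> nat" assume js: "js \<in> {js \<in> PiE A (\<lambda>_. UNIV). (\<Sum>i\<in>A. js i) = n}"
  show "restrict (count (\<Sum>i\<in>A. replicate_mset (js i) i)) A = js"
    using js assms by (auto simp: fun_eq_iff count_sum restrict_def PiE_iff extensional_def)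
  show "(\<Sum>i\<in>A. replicate_mset (js i) i) \<in> multisets_of_size A n"
    using js assms by (auto simp: multisets_of_size_def set_mset_sum split: if_splits)
qed simp

lemma exp_terms_has_sum: "((\<lambda>n. c ^ n / fact n :: real) has_sum exp c) UNIV"
proof (rule norm_summable_imp_has_sum)
  show "summable (\<lambda>n. norm (c ^ n / fact n))"
    using summable_norm_exp[of c] by (simp add: divide_inverse mult.commute)
  show "(\<lambda>n. c ^ n / fact n) sums exp c"
    using exp_converges[of c] by (simp add: divide_inverse mult.commute)
qed

lemmas exp_terms_summable_on = has_sum_imp_summable[OF exp_terms_has_sum]

definition humbert_term :: "nat \<Rightarrow> (nat \<Rightarrow> real) \<Rightarrow> real \<Rightarrow> (nat \<Rightarrow> real) \<Rightarrow> (nat \<Rightarrow> nat) \<Rightarrow> real" where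
  "humbert_term m bet gam x js =
    (\<Prod>i<m. pochhammer (bet i) (js i) * x i ^ js i / fact (js i)) / pochhammer gam (\<Sum>i<m. js i)"

lemma abs_humbert_term_le:
  assumes d: "0 < d" "d \<le> gam" "d \<le> 1"
  shows "\<bar>humbert_term m bet gam x js\<bar> \<le> (\<Prod>i<m. ((\<bar>bet i\<bar> + 1) * \<bar>x i\<bar> / d) ^ js i / fact (js i))"
proof -
  define N where "N = (\<Sum>i<m. js i)"
  have gam: "pochhammer gam N > 0" using d by (simp add: pochhammer_pos)
  have "\<bar>\<Prod>i<m. pochhammer (bet i) (js i) * x i ^ js i / fact (js i)\<bar> \<le>
      (\<Prod>i<m. ((\<bar>bet i\<bar> + 1) * \<bar>x i\<bar>) ^ js i)"
    unfolding abs_prod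
  proof (intro prod_mono conjI)
    fix i
    have "\<bar>pochhammer (bet i) (js i) * x i ^ js i / fact (js i)\<bar> =
        \<bar>pochhammer (bet i) (js i)\<bar> / fact (js i) * \<bar>x i\<bar> ^ js i"
      by (simp add: abs_mult power_abs)
    also have "\<dots> \<le> (\<bar>bet i\<bar> + 1) ^ js i * \<bar>x i\<bar> ^ js i"
      using norm_pochhammer_le[of "bet i" "js i"] by (intro mult_right_mono) (auto simp: divide_le_eq)
    finally show "\<bar>pochhammer (bet i) (js i) * x i ^ js i / fact (js i)\<bar> \<le>
        ((\<bar>bet i\<bar> + 1) * \<bar>x i\<bar>) ^ js i"
      by (simp add: power_mult_distrib)
  qed auto
  moreover have "1 / pochhammer gam N \<le> 1 / (d ^ N * (\<Prod>i<m. fact (js i)))"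
  proof -
    have "d ^ N * (\<Prod>i<m. fact (js i)) \<le> d ^ N * fact N"
      unfolding N_def using d by (intro mult_left_mono prod_fact_le_fact_sum) auto
    also have "\<dots> \<le> pochhammer gam N" using d by (intro power_mult_fact_le_pochhammer) auto
    finally show ?thesis using d gam by (intro divide_left_mono) (auto intro!: mult_pos_pos prod_pos)
  qed
  ultimately have "\<bar>humbert_term m bet gam x js\<bar> \<le>
      (\<Prod>i<m. ((\<bar>bet i\<bar> + 1) * \<bar>x i\<bar>) ^ js i) * (1 / (d ^ N * (\<Prod>i<m. fact (js i))))"
    using gam unfolding humbert_term_def N_def[symmetric] abs_divide
    by (subst divide_inverse, intro mult_mono) (auto simp: divide_inverse intro!: prod_nonneg)
  also have "\<dots> = (\<Prod>i<m. ((\<bar>bet i\<bar> + 1) * \<bar>x i\<bar> / d) ^ js i / fact (js i))"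
    by (simp add: N_def power_sum power_divide prod_dividef prod.distrib)
  finally show ?thesis .
qed

lemma humbert_term_summable_on:
  assumes "gam > 0"
  shows "humbert_term m bet gam x summable_on PiE {..<m} (\<lambda>_. UNIV)"
proof -
  define d where "d = min gam 1"
  have d: "0 < d" "d \<le> gam" "d \<le> 1" using assms by (auto simp: d_def)
  define M where "M i = (\<bar>bet i\<bar> + 1) * \<bar>x i\<bar> / d" for i
  have "Infinite_Set_Sum.abs_summable_on
      (\<lambda>js. \<Prod>i<m. M i ^ js i / fact (js i)) (PiE {..<m} (\<lambda>_. UNIV))"
    by (rule abs_summable_on_prod_PiE)
       (auto simp: power_abs exp_terms_summable_on simp flip: abs_summable_equivalent)
  hence "(\<lambda>js. \<Prod>i<m. M i ^ js i / fact (js i)) summable_on PiE {..<m} (\<lambda>_. UNIV)"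
    using abs_summable_equivalent abs_summable_summable by blast
  thus ?thesis
    by (rule abs_summable_summable[OF summable_on_comparison_test])
       (auto simp: M_def abs_humbert_term_le[OF d])
qed

lemma humbert_Phi2_has_sum:
  assumes "gam > 0"
  shows "((\<lambda>n. (\<Prod>i<m. fps_powr (1 - fps_const (x i) * fps_X) (- bet i)) $ n / pochhammer gam n)
     has_sum humbert_Phi2 m bet gam x) UNIV"
proof -
  define P where "P = PiE {..<m} (\<lambda>_. UNIV :: nat set)"
  define S where "S n = {js \<in> P. (\<Sum>i<m. js i) = n}" for n
  have "(humbert_term m bet gam x has_sum humbert_Phi2 m bet gam x) P"
    using humbert_term_summable_on[OF assms]
    by (simp add: humbert_Phi2_def humbert_term_def[abs_def] P_def)
  moreover have "((\<lambda>(n, js). humbert_term m bet gam x js) has_sum s) (Sigma UNIV S) \<longleftrightarrow>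
      (humbert_term m bet gam x has_sum s) P" for s
    by (rule has_sum_reindex_bij_witness[where i = "\<lambda>js. (\<Sum>i<m. js i, js)" and j = "\<lambda>(n, js). js"])
       (auto simp: S_def)
  ultimately have
      "((\<lambda>(n, js). humbert_term m bet gam x js) has_sum humbert_Phi2 m bet gam x) (Sigma UNIV S)"
    by simp
  moreover have "((\<lambda>js. case (n, js) of (n, js) \<Rightarrow> humbert_term m bet gam x js) has_sum
      (\<Prod>i<m. fps_powr (1 - fps_const (x i) * fps_X) (- bet i)) $ n / pochhammer gam n) (S n)" for n
    unfolding fps_prod_nth_PiE[OF finite_lessThan] fps_powr_linear_nth sum_divide_distrib
        prod.case S_def P_def
    by (rule has_sum_finiteI[OF finite_PiE_sum_eq]) (auto simp: humbert_term_def)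
  ultimately show ?thesis by (rule has_sum_SigmaD)
qed

section \<open>Binary forms\<close>

text \<open>The bound on the coefficients is chosen so as to be preserved by products (Vandermonde).\<close>

definition has_dominated_coeffs :: "nat \<Rightarrow> (complex \<Rightarrow> real) \<Rightarrow> (nat \<Rightarrow> real) \<Rightarrow> bool" where
  "has_dominated_coeffs n f c \<longleftrightarrow> (\<forall>i. \<bar>c i\<bar> \<le> real (n choose i)) \<and>
     (\<forall>w. f w = (\<Sum>i\<le>n. c i * Re w ^ i * Im w ^ (n - i)))"

definition dominated_form :: "nat \<Rightarrow> (complex \<Rightarrow> real) \<Rightarrow> bool" where
  "dominated_form n f \<longleftrightarrow> (\<exists>c. has_dominated_coeffs n f c)"

definition form_coeff :: "nat \<Rightarrow> (complex \<Rightarrow> real) \<Rightarrow> nat \<Rightarrow> real" where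
  "form_coeff n f = (SOME c. has_dominated_coeffs n f c)"

lemma dominated_form_coeff:
  assumes "dominated_form n f"
  shows "\<bar>form_coeff n f i\<bar> \<le> real (n choose i)"
    and "f w = (\<Sum>i\<le>n. form_coeff n f i * Re w ^ i * Im w ^ (n - i))"
proof -
  have "has_dominated_coeffs n f (form_coeff n f)"
    using assms unfolding dominated_form_def form_coeff_def by (rule someI_ex)
  thus "\<bar>form_coeff n f i\<bar> \<le> real (n choose i)"
    and "f w = (\<Sum>i\<le>n. form_coeff n f i * Re w ^ i * Im w ^ (n - i))"
    by (auto simp: has_dominated_coeffs_def)
qed

lemma binary_form_mult:
  fixes x y :: "'a :: comm_ring_1"
  assumes c: "\<And>i. i > m \<Longrightarrow> c i = 0" and d: "\<And>j. j > n \<Longrightarrow> d j = 0"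
  shows "(\<Sum>i\<le>m. c i * x ^ i * y ^ (m - i)) * (\<Sum>j\<le>n. d j * x ^ j * y ^ (n - j)) =
    (\<Sum>s\<le>m + n. (\<Sum>i\<le>s. c i * d (s - i)) * x ^ s * y ^ (m + n - s))"
proof -
  define G where "G i j = c i * d j * x ^ (i + j) * y ^ (m + n - (i + j))" for i j
  have summand:
      "(c i * x ^ i * y ^ (m - i)) * (d j * x ^ j * y ^ (n - j)) = G i j"
    if "i \<le> m" "j \<le> n" for i j
  proof -
    have "m + n - (i + j) = (m - i) + (n - j)" using that by simp
    thus ?thesis by (simp only: G_def power_add mult_ac)
  qed
  have "(\<Sum>i\<le>m. c i * x ^ i * y ^ (m - i)) * (\<Sum>j\<le>n. d j * x ^ j * y ^ (n - j)) =
      (\<Sum>(i, j)\<in>{..m} \<times> {..n}. G i j)"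
    by (auto simp: sum_product sum.cartesian_product summand intro!: sum.cong)
  also have "\<dots> = (\<Sum>(i, j)\<in>{(i, j). i + j \<le> m + n}. G i j)"
  proof (rule sum.mono_neutral_left)
    have "{(i, j). i + j \<le> m + n} \<subseteq> {..m + n} \<times> {..m + n}" by auto
    thus "finite {(i, j). i + j \<le> m + n}" using finite_subset by blast
    have "G i j = 0" if "\<not> (i \<le> m \<and> j \<le> n)" for i j
      using that c[of i] d[of j] by (auto simp: G_def not_le)
    thus "\<forall>p\<in>{(i, j). i + j \<le> m + n} - {..m} \<times> {..n}. (case p of (i, j) \<Rightarrow> G i j) = 0" by auto
  qed auto
  also have "\<dots> = (\<Sum>s\<le>m + n. \<Sum>i\<le>s. G i (s - i))" by (rule sum.triangle_reindex_eq)
  also have "\<dots> = (\<Sum>s\<le>m + n. (\<Sum>i\<le>s. c i * d (s - i)) * x ^ s * y ^ (m + n - s))"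
    by (simp add: G_def sum_distrib_right)
  finally show ?thesis .
qed

lemma dominated_form_mult:
  assumes "dominated_form m f" and "dominated_form n g"
  shows "dominated_form (m + n) (\<lambda>w. f w * g w)"
proof -
  obtain c d where c: "has_dominated_coeffs m f c" and d: "has_dominated_coeffs n g d"
    using assms by (auto simp: dominated_form_def)
  have bound_c: "\<bar>c i\<bar> \<le> real (m choose i)" and bound_d: "\<bar>d i\<bar> \<le> real (n choose i)" for i
    using c d by (auto simp: has_dominated_coeffs_def)
  have "\<bar>\<Sum>i\<le>s. c i * d (s - i)\<bar> \<le> real (m + n choose s)" for s
  proof -
    have "\<bar>\<Sum>i\<le>s. c i * d (s - i)\<bar> \<le> (\<Sum>i\<le>s. \<bar>c i\<bar> * \<bar>d (s - i)\<bar>)"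
      using sum_abs[of "\<lambda>i. c i * d (s - i)" "{..s}"] by (simp add: abs_mult)
    also have "\<dots> \<le> (\<Sum>i\<le>s. real (m choose i) * real (n choose (s - i)))"
      by (intro sum_mono mult_mono bound_c bound_d) auto
    finally show ?thesis by (simp flip: vandermonde)
  qed
  moreover have "f w * g w =
      (\<Sum>s\<le>m + n. (\<Sum>i\<le>s. c i * d (s - i)) * Re w ^ s * Im w ^ (m + n - s))" for w
  proof -
    have "c i = 0" if "i > m" for i using bound_c[of i] that by (simp add: binomial_eq_0)
    moreover have "d i = 0" if "i > n" for i using bound_d[of i] that by (simp add: binomial_eq_0)
    ultimately show ?thesis
      using c d by (simp add: has_dominated_coeffs_def binary_form_mult)
  qed
  ultimately have "has_dominated_coeffs (m + n) (\<lambda>w. f w * g w) (\<lambda>s. \<Sum>i\<le>s. c i * d (s - i))"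
    unfolding has_dominated_coeffs_def by blast
  thus ?thesis unfolding dominated_form_def by blast
qed

lemma dominated_form_power:
  assumes "dominated_form n f"
  shows "dominated_form (m * n) (\<lambda>w. f w ^ m)"
proof (induction m)
  case 0
  have "has_dominated_coeffs (0 * n) (\<lambda>w. f w ^ 0) (\<lambda>i. if i = 0 then 1 else 0)"
    by (simp add: has_dominated_coeffs_def)
  thus ?case unfolding dominated_form_def by blast
next
  case (Suc m)
  show ?case using dominated_form_mult[OF assms Suc] by simp
qed

lemma dominated_form_cmod_squared: "dominated_form 2 (\<lambda>w. (cmod w)\<^sup>2)"
proof -
  have "{..2::nat} = {0, 1, 2}" by auto
  hence "has_dominated_coeffs 2 (\<lambda>w. (cmod w)\<^sup>2) (\<lambda>i. if i = 0 \<or> i = 2 then 1 else 0)"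
    by (simp add: has_dominated_coeffs_def cmod_power2)
  thus ?thesis unfolding dominated_form_def by blast
qed

lemma power_complex_binomial:
  "w ^ k = (\<Sum>i\<le>k. of_real (real (k choose i) * Re w ^ i * Im w ^ (k - i)) * \<i> ^ (k - i))"
proof -
  have "w ^ k = (of_real (Re w) + \<i> * of_real (Im w)) ^ k" by (simp flip: complex_eq)
  also have "\<dots> = (\<Sum>i\<le>k. of_real (real (k choose i) * Re w ^ i * Im w ^ (k - i)) * \<i> ^ (k - i))"
    unfolding binomial_ring power_mult_distrib
    by (intro sum.cong refl) (simp only: of_real_mult of_real_power of_real_of_nat_eq mult_ac)
  finally show ?thesis .
qed

lemma dominated_form_Re_mult_power:
  assumes "cmod u \<le> 1"
  shows "dominated_form k (\<lambda>w. Re (u * w ^ k))"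
proof -
  have "\<bar>real (k choose i) * Re (u * \<i> ^ (k - i))\<bar> \<le> real (k choose i)" for i
  proof -
    have "\<bar>Re (u * \<i> ^ (k - i))\<bar> \<le> 1"
      using abs_Re_le_cmod[of "u * \<i> ^ (k - i)"] assms by (simp add: norm_mult norm_power)
    thus ?thesis by (simp add: abs_mult mult_left_le)
  qed
  moreover have "Re (u * w ^ k) =
      (\<Sum>i\<le>k. real (k choose i) * Re (u * \<i> ^ (k - i)) * Re w ^ i * Im w ^ (k - i))" for w
  proof -
    have Re_mult_of_real: "Re (u * (of_real r * z)) = r * Re (u * z)" for r z
      by (simp add: algebra_simps)
    show ?thesis
      unfolding power_complex_binomial[of w k] sum_distrib_left Re_sum Re_mult_of_real
      by (simp only: mult_ac)
  qed
  ultimately have "has_dominated_coeffs k (\<lambda>w. Re (u * w ^ k))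
      (\<lambda>i. real (k choose i) * Re (u * \<i> ^ (k - i)))"
    unfolding has_dominated_coeffs_def by blast
  thus ?thesis unfolding dominated_form_def by blast
qed

lemma dominated_form_Re_power: "dominated_form k (\<lambda>w. Re (w ^ k))"
  using dominated_form_Re_mult_power[of 1 k] by simp

lemma dominated_form_Im_power: "dominated_form k (\<lambda>w. Im (w ^ k))"
  using dominated_form_Re_mult_power[of "- \<i>" k] by simp

section \<open>Exponential double series\<close>

definition geom_bounded :: "(nat \<Rightarrow> nat \<Rightarrow> real) \<Rightarrow> bool" where
  "geom_bounded h \<longleftrightarrow> (\<exists>K C. K \<ge> 0 \<and> C \<ge> 0 \<and> (\<forall>i j. \<bar>h i j\<bar> \<le> K * C ^ (i + j)))"

lemma geom_boundedE:
  assumes "geom_bounded h"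
  obtains K C where "K \<ge> 0" "C \<ge> 0" "\<And>i j. \<bar>h i j\<bar> \<le> K * C ^ (i + j)"
  using assms unfolding geom_bounded_def by blast

definition exp_series :: "(nat \<Rightarrow> nat \<Rightarrow> real) \<Rightarrow> complex \<Rightarrow> real" where
  "exp_series h w = infsum (\<lambda>(i, j). h i j / (fact i * fact j) * Re w ^ i * Im w ^ j) UNIV"

lemma summable_on_times_nonneg:
  fixes s t :: "_ \<Rightarrow> real"
  assumes s: "s summable_on A" "\<And>i. s i \<ge> 0" and t: "t summable_on B" "\<And>i. t i \<ge> 0"
  shows "(\<lambda>(i, j). s i * t j) summable_on A \<times> B"
proof (rule summable_on_SigmaI)
  show "((\<lambda>j. case (i, j) of (i, j) \<Rightarrow> s i * t j) has_sum (s i * infsum t B)) B" for i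
    unfolding prod.case by (intro has_sum_cmult_right has_sum_infsum t)
  show "(\<lambda>i. s i * infsum t B) summable_on A"
    by (rule summable_on_cmult_left[OF s(1)])
qed (use s t in auto)

definition exp_summable :: "(nat \<Rightarrow> real) \<Rightarrow> bool" where
  "exp_summable s \<longleftrightarrow> (\<forall>C\<ge>0. (\<lambda>i. C ^ i / fact i * s i) summable_on UNIV)"

lemma exp_summable_power: "exp_summable (\<lambda>i. x ^ i)"
  unfolding exp_summable_def
  using exp_terms_summable_on[of "_ * x"] by (simp add: power_mult_distrib)

lemma geom_bounded_exp_summable:
  assumes h: "geom_bounded h"
    and s: "exp_summable s" "\<And>i. s i \<ge> 0" and t: "exp_summable t" "\<And>j. t j \<ge> 0"
  shows "(\<lambda>(i, j). \<bar>h i j\<bar> / (fact i * fact j) * (s i * t j)) summable_on UNIV"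
proof -
  obtain K C where KC: "K \<ge> 0" "C \<ge> 0" "\<And>i j. \<bar>h i j\<bar> \<le> K * C ^ (i + j)"
    using h by (rule geom_boundedE) blast
  define e where "e f i = C ^ i / fact i * f i" for f :: "nat \<Rightarrow> real" and i
  have majorant: "(\<lambda>p. K * (case p of (i, j) \<Rightarrow> e s i * e t j)) summable_on UNIV"
    unfolding UNIV_Times_UNIV[symmetric] using s t KC(2)
    by (intro summable_on_cmult_right summable_on_times_nonneg) (auto simp: exp_summable_def e_def)
  have "(case p of (i, j) \<Rightarrow> \<bar>h i j\<bar> / (fact i * fact j) * (s i * t j)) \<le>
      K * (case p of (i, j) \<Rightarrow> e s i * e t j)" for p
  proof (cases p)
    case (Pair i j)
    have "\<bar>h i j\<bar> / (fact i * fact j) * (s i * t j) \<le>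
        K * C ^ (i + j) / (fact i * fact j) * (s i * t j)"
      using s(2) t(2) by (intro mult_right_mono divide_right_mono KC) auto
    thus ?thesis by (simp add: Pair e_def power_add mult_ac)
  qed
  thus ?thesis
    by (rule summable_on_comparison_test[OF majorant]) (use s(2) t(2) in auto)
qed

lemma exp_series_has_sum:
  assumes "geom_bounded h"
  shows "((\<lambda>(i, j). h i j / (fact i * fact j) * Re w ^ i * Im w ^ j) has_sum exp_series h w) UNIV"
proof -
  have "(\<lambda>(i, j). \<bar>h i j\<bar> / (fact i * fact j) * (\<bar>Re w\<bar> ^ i * \<bar>Im w\<bar> ^ j)) summable_on UNIV"
    by (intro geom_bounded_exp_summable assms exp_summable_power) auto
  hence "(\<lambda>p. norm (case p of (i, j) \<Rightarrow>
      h i j / (fact i * fact j) * Re w ^ i * Im w ^ j)) summable_on UNIV"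
    by (simp add: case_prod_unfold abs_mult power_abs mult.assoc)
  thus ?thesis unfolding exp_series_def by (rule has_sum_infsum[OF abs_summable_summable])
qed

lemma exp_series_0: "exp_series h 0 = h 0 0"
proof -
  have "((\<lambda>(i, j). h i j / (fact i * fact j) * Re 0 ^ i * Im 0 ^ j) has_sum h 0 0) UNIV"
    by (rule has_sum_finite_neutralI[where B = "{(0, 0)}"]) (auto simp: power_0_left split: if_splits)
  thus ?thesis unfolding exp_series_def by (rule infsumI)
qed

lemma exp_series_swap: "exp_series h w = exp_series (\<lambda>i j. h j i) (Complex (Im w) (Re w))"
  unfolding exp_series_def
  by (rule infsum_reindex_bij_witness[where i = "\<lambda>(i, j). (j, i)" and j = "\<lambda>(i, j). (j, i)"])
     (auto simp: mult_ac)

lemma exp_series_eq_if_antidiagonal_has_sum: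
  assumes h: "geom_bounded h"
    and "((\<lambda>n. \<Sum>i\<le>n. h i (n - i) / (fact i * fact (n - i)) * Re w ^ i * Im w ^ (n - i))
        has_sum S) UNIV"
  shows "exp_series h w = S"
proof -
  define f where "f = (\<lambda>(i, j). h i j / (fact i * fact j) * Re w ^ i * Im w ^ j)"
  have "((\<lambda>(n, i). f (i, n - i)) has_sum s) (SIGMA n:UNIV. {..n}) \<longleftrightarrow> (f has_sum s) UNIV" for s
    by (rule has_sum_reindex_bij_witness[where i = "\<lambda>(i, j). (i + j, i)"
        and j = "\<lambda>(n, i). (i, n - i)"]) auto
  hence "((\<lambda>(n, i). f (i, n - i)) has_sum exp_series h w) (SIGMA n:UNIV. {..n})"
    using exp_series_has_sum[OF h, of w] by (simp add: f_def)
  moreover have "((\<lambda>i. case (n, i) of (n, i) \<Rightarrow> f (i, n - i)) has_sum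
      (\<Sum>i\<le>n. h i (n - i) / (fact i * fact (n - i)) * Re w ^ i * Im w ^ (n - i))) {..n}" for n
    by (rule has_sum_finiteI) (auto simp: f_def)
  ultimately have "((\<lambda>n. \<Sum>i\<le>n. h i (n - i) / (fact i * fact (n - i)) * Re w ^ i * Im w ^ (n - i))
      has_sum exp_series h w) UNIV"
    by (rule has_sum_SigmaD)
  thus ?thesis using assms(2) has_sum_unique by blast
qed

lemma geom_bounded_swap: "geom_bounded h \<Longrightarrow> geom_bounded (\<lambda>i j. h j i)"
  unfolding geom_bounded_def by (metis add.commute)

lemma geom_bounded_Suc_fst:
  assumes "geom_bounded h"
  shows "geom_bounded (\<lambda>i. h (Suc i))"
proof -
  obtain K C where KC: "K \<ge> 0" "C \<ge> 0" "\<And>i j. \<bar>h i j\<bar> \<le> K * C ^ (i + j)"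
    using assms by (rule geom_boundedE) blast
  have "\<bar>h (Suc i) j\<bar> \<le> (K * C) * C ^ (i + j)" for i j
    using KC(3)[of "Suc i" j] by (simp add: mult.assoc)
  thus ?thesis unfolding geom_bounded_def using KC(1,2) mult_nonneg_nonneg by metis
qed

lemma geom_bounded_Suc_snd:
  assumes "geom_bounded h"
  shows "geom_bounded (\<lambda>i j. h i (Suc j))"
  using geom_bounded_swap[OF geom_bounded_Suc_fst[OF geom_bounded_swap[OF assms]]] .

definition exp_section :: "(nat \<Rightarrow> nat \<Rightarrow> real) \<Rightarrow> real \<Rightarrow> nat \<Rightarrow> real" where
  "exp_section h y i = infsum (\<lambda>j. h i j / (fact i * fact j) * y ^ j) UNIV"

lemma exp_section_sums:
  assumes "geom_bounded h"
  shows "(\<lambda>i. exp_section h y i * x ^ i) sums exp_series h (Complex x y)"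
proof -
  have series:
      "((\<lambda>(i, j). h i j / (fact i * fact j) * x ^ i * y ^ j)
          has_sum exp_series h (Complex x y)) (UNIV \<times> UNIV)" for x
    using exp_series_has_sum[OF assms, of "Complex x y"] by simp
  have "(\<lambda>j. h i j / (fact i * fact j) * y ^ j) summable_on UNIV" for i
    using summable_on_SigmaD1[OF has_sum_imp_summable[OF series[of 1]], of i] by simp
  hence row: "((\<lambda>j. h i j / (fact i * fact j) * y ^ j) has_sum exp_section h y i) UNIV" for i
    unfolding exp_section_def by (rule has_sum_infsum)
  have "((\<lambda>j. case (i, j) of (i, j) \<Rightarrow> h i j / (fact i * fact j) * x ^ i * y ^ j) has_sum
      exp_section h y i * x ^ i) UNIV" for i
    using has_sum_cmult_left[OF row[of i], of "x ^ i"] by (simp add: mult_ac)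
  with series have "((\<lambda>i. exp_section h y i * x ^ i) has_sum exp_series h (Complex x y)) UNIV"
    by (rule has_sum_SigmaD)
  thus ?thesis by (rule has_sum_imp_sums)
qed

lemma diffs_exp_section: "diffs (exp_section h y) = exp_section (\<lambda>i. h (Suc i)) y"
proof
  fix i
  have "real (Suc i) * (h (Suc i) j / (fact (Suc i) * fact j) * y ^ j) =
      h (Suc i) j / (fact i * fact j) * y ^ j" for j
    by (simp only: fact_Suc) (simp del: of_nat_Suc)
  thus "diffs (exp_section h y) i = exp_section (\<lambda>i. h (Suc i)) y i"
    unfolding diffs_def exp_section_def by (simp only: infsum_cmult_right'[symmetric])
qed

lemma pderiv_dir_1_exp_series:
  assumes h: "geom_bounded h"
  shows "pderiv_dir 1 (exp_series h) = exp_series (\<lambda>i. h (Suc i))"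
proof
  fix w
  have sums: "(\<lambda>i. exp_section h (Im w) i * x ^ i) sums exp_series h (Complex x (Im w))" for x
    by (rule exp_section_sums[OF h])
  have "(\<lambda>i. diffs (exp_section h (Im w)) i * Re w ^ i) sums exp_series (\<lambda>i. h (Suc i)) w"
    using exp_section_sums[OF geom_bounded_Suc_fst[OF h], of "Im w" "Re w"]
    by (simp add: diffs_exp_section)
  moreover have "((\<lambda>x. \<Sum>i. exp_section h (Im w) i * x ^ i) has_field_derivative
      (\<Sum>i. diffs (exp_section h (Im w)) i * Re w ^ i)) (at (Re w))"
    by (rule termdiffs_strong_converges_everywhere) (use sums sums_summable in blast)
  ultimately have "((\<lambda>x. exp_series h (Complex x (Im w))) has_field_derivative
      exp_series (\<lambda>i. h (Suc i)) w) (at (Re w + 0))"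
    using sums_unique[OF sums] by (simp add: sums_iff)
  hence "((\<lambda>t. exp_series h (Complex (Re w + t) (Im w)))
      has_field_derivative exp_series (\<lambda>i. h (Suc i)) w) (at 0)"
    using DERIV_shift[of "\<lambda>x. exp_series h (Complex x (Im w))"
        "exp_series (\<lambda>i. h (Suc i)) w" 0 "Re w"]
    by (simp add: add.commute)
  moreover have "Complex (Re w + t) (Im w) = w + of_real t * 1" for t by (simp add: complex_eq_iff)
  ultimately show "pderiv_dir 1 (exp_series h) w = exp_series (\<lambda>i. h (Suc i)) w"
    unfolding pderiv_dir_def by (intro DERIV_imp_deriv) simp
qed

lemma pderiv_dir_ii_exp_series:
  assumes h: "geom_bounded h"
  shows "pderiv_dir \<i> (exp_series h) = exp_series (\<lambda>i j. h i (Suc j))"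
proof
  fix w
  let ?w = "Complex (Im w) (Re w)"
  have "exp_series h (w + of_real t * \<i>) = exp_series (\<lambda>i j. h j i) (?w + of_real t * 1)" for t
    by (subst exp_series_swap) (simp add: complex_eq_iff plus_complex.code)
  hence "pderiv_dir \<i> (exp_series h) w = pderiv_dir 1 (exp_series (\<lambda>i j. h j i)) ?w"
    by (simp add: pderiv_dir_def)
  also have "\<dots> = exp_series (\<lambda>i j. h j (Suc i)) ?w"
    by (simp add: pderiv_dir_1_exp_series geom_bounded_swap[OF h])
  also have "\<dots> = exp_series (\<lambda>i j. h i (Suc j)) w" by (subst (2) exp_series_swap) simp
  finally show "pderiv_dir \<i> (exp_series h) w = exp_series (\<lambda>i j. h i (Suc j)) w" .
qed

lemma funpow_pderiv_dir_1_exp_series: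
  assumes "geom_bounded h"
  shows "(pderiv_dir 1 ^^ m) (exp_series h) = exp_series (\<lambda>i. h (m + i))"
proof -
  have "geom_bounded (\<lambda>i. h (m + i)) \<and> (pderiv_dir 1 ^^ m) (exp_series h) =
      exp_series (\<lambda>i. h (m + i))"
  proof (induction m)
    case (Suc m)
    thus ?case
      using geom_bounded_Suc_fst[of "\<lambda>i. h (m + i)"] by (simp add: pderiv_dir_1_exp_series)
  qed (simp add: assms)
  thus ?thesis by blast
qed

lemma funpow_pderiv_dir_ii_exp_series:
  assumes "geom_bounded h"
  shows "geom_bounded (\<lambda>i j. h i (n + j))"
    and "(pderiv_dir \<i> ^^ n) (exp_series h) = exp_series (\<lambda>i j. h i (n + j))"
proof -
  have "geom_bounded (\<lambda>i j. h i (n + j)) \<and> (pderiv_dir \<i> ^^ n) (exp_series h) =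
      exp_series (\<lambda>i j. h i (n + j))"
  proof (induction n)
    case (Suc n)
    thus ?case
      using geom_bounded_Suc_snd[of "\<lambda>i j. h i (n + j)"] by (simp add: pderiv_dir_ii_exp_series)
  qed (simp add: assms)
  thus "geom_bounded (\<lambda>i j. h i (n + j))"
    and "(pderiv_dir \<i> ^^ n) (exp_series h) = exp_series (\<lambda>i j. h i (n + j))" by blast+
qed

definition poly_pairing :: "(complex \<Rightarrow> real) \<Rightarrow> (nat \<Rightarrow> nat \<Rightarrow> real) \<Rightarrow> real" where
  "poly_pairing p h = (\<Sum>(i, j)\<in>{ij. poly_coeffs p ij \<noteq> 0}. poly_coeffs p (i, j) * h i j)"

lemma poly_diff_op_exp_series_0:
  assumes "geom_bounded h"
  shows "poly_diff_op p (exp_series h) 0 = poly_pairing p h"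
  using assms
  by (simp add: poly_diff_op_def poly_pairing_def Let_def funpow_pderiv_dir_ii_exp_series
      funpow_pderiv_dir_1_exp_series exp_series_0)

section \<open>The kernel as an entire series\<close>

definition umbral_power :: "(nat \<Rightarrow> nat \<Rightarrow> real) \<Rightarrow> real \<Rightarrow> real \<Rightarrow> nat \<Rightarrow> real" where
  "umbral_power T X Y m = (\<Sum>i\<le>m. real (m choose i) * T i (m - i) * X ^ i * Y ^ (m - i))"

lemma umbral_power_powers: "umbral_power (\<lambda>i j. v ^ i * u ^ j) X Y m = (v * X + u * Y) ^ m"
  unfolding umbral_power_def binomial_ring power_mult_distrib
  by (intro sum.cong refl) (simp only: mult_ac)

definition cos_form :: "nat \<Rightarrow> complex \<Rightarrow> complex \<Rightarrow> real" where
  "cos_form k z w = 2 * (1 / 2) ^ k * (Re (z ^ k) * Re (w ^ k))"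

definition sin_form :: "nat \<Rightarrow> complex \<Rightarrow> complex \<Rightarrow> real" where
  "sin_form k z w = 2 * (1 / 2) ^ k * (Im (z ^ k) * Im (w ^ k))"

definition J_weight :: "nat \<Rightarrow> real \<Rightarrow> nat \<Rightarrow> nat \<Rightarrow> real" where
  "J_weight k l n m = (if even m then pochhammer l m / fact m *
     fps_powr (cheb_base k 1) (- (l + real m)) $ (n - k * m) / pochhammer (real k * l) n else 0)"

text \<open>\<open>T i j\<close> stands for \<open>v ^ i * u ^ j\<close> or for its integral against the two measures.\<close>

definition J_homog ::
  "nat \<Rightarrow> real \<Rightarrow> (nat \<Rightarrow> nat \<Rightarrow> real) \<Rightarrow> complex \<Rightarrow> complex \<Rightarrow> nat \<Rightarrow> real" where
  "J_homog k l T z w n = (\<Sum>m\<le>n div k. J_weight k l n m * cmod (z * w) ^ (n - k * m) *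
     umbral_power T (cos_form k z w) (sin_form k z w) m)"

definition mixed_monomial :: "nat \<Rightarrow> nat \<Rightarrow> nat \<Rightarrow> nat \<Rightarrow> complex \<Rightarrow> real" where
  "mixed_monomial k n m i w = cmod w ^ (n - k * m) * Re (w ^ k) ^ i * Im (w ^ k) ^ (m - i)"

definition J_coeff ::
  "nat \<Rightarrow> real \<Rightarrow> (nat \<Rightarrow> nat \<Rightarrow> real) \<Rightarrow> complex \<Rightarrow> nat \<Rightarrow> nat \<Rightarrow> real" where
  "J_coeff k l T z i j = fact i * fact j *
     (\<Sum>m\<le>(i + j) div k. \<Sum>s\<le>m. J_weight k l (i + j) m * (2 * (1 / 2) ^ k) ^ m *
        real (m choose s) * T s (m - s) * mixed_monomial k (i + j) m s z *
        form_coeff (i + j) (mixed_monomial k (i + j) m s) i)"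

lemma le_div_iff_mult_le: "k > 0 \<Longrightarrow> m \<le> n div k \<longleftrightarrow> k * m \<le> (n :: nat)"
  by (simp add: less_eq_div_iff_mult_less_eq mult.commute)

lemma dominated_form_mixed_monomial:
  assumes "k * m \<le> n" and "even (n - k * m)" and "i \<le> m"
  shows "dominated_form n (mixed_monomial k n m i)"
proof -
  obtain h where h: "n - k * m = h * 2" using assms(2) by (metis dvd_def mult.commute)
  have "i * k + (m - i) * k = k * m" using assms(3) by (simp flip: add_mult_distrib)
  hence degree: "h * 2 + i * k + (m - i) * k = n" using h assms(1) by simp
  have "dominated_form (h * 2 + i * k + (m - i) * k)
      (\<lambda>w. ((cmod w)\<^sup>2) ^ h * Re (w ^ k) ^ i * Im (w ^ k) ^ (m - i))"
    by (intro dominated_form_mult dominated_form_power dominated_form_cmod_squared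
        dominated_form_Re_power dominated_form_Im_power)
  moreover have "(\<lambda>w. ((cmod w)\<^sup>2) ^ h * Re (w ^ k) ^ i * Im (w ^ k) ^ (m - i)) =
      mixed_monomial k n m i"
    unfolding mixed_monomial_def h by (simp add: mult.commute[of h] power_mult)
  ultimately show ?thesis unfolding degree by simp
qed

lemma J_weight_eq_0:
  assumes "k > 0" and "odd (n - k * m)"
  shows "J_weight k l n m = 0"
  using assms by (simp add: J_weight_def fps_powr_cheb_base_nth_odd)

lemma J_homog_eq_sum_mixed_monomial:
  "J_homog k l T z w n = (\<Sum>m\<le>n div k. \<Sum>s\<le>m. J_weight k l n m * (2 * (1 / 2) ^ k) ^ m *
     real (m choose s) * T s (m - s) * mixed_monomial k n m s z * mixed_monomial k n m s w)"
proof -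
  have "(2 * (1 / 2 :: real) ^ k) ^ m = (2 * (1 / 2) ^ k) ^ s * (2 * (1 / 2) ^ k) ^ (m - s)"
    if "s \<le> m" for s m
    using that by (metis le_add_diff_inverse power_add)
  thus ?thesis
    unfolding J_homog_def umbral_power_def sum_distrib_left
    by (intro sum.cong refl)
       (simp add: cos_form_def sin_form_def mixed_monomial_def norm_mult power_mult_distrib mult_ac)
qed

lemma J_homog_eq_sum_J_coeff:
  assumes "k > 0"
  shows "J_homog k l T z w n =
    (\<Sum>i\<le>n. J_coeff k l T z i (n - i) / (fact i * fact (n - i)) * Re w ^ i * Im w ^ (n - i))"
proof -
  define q where "q m s = J_weight k l n m * (2 * (1 / 2) ^ k) ^ m * real (m choose s) *
    T s (m - s) * mixed_monomial k n m s z" for m s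
  define c where "c m s = form_coeff n (mixed_monomial k n m s)" for m s
  have "q m s * mixed_monomial k n m s w = (\<Sum>i\<le>n. q m s * c m s i * Re w ^ i * Im w ^ (n - i))"
    if m: "m \<le> n div k" and s: "s \<le> m" for m s
  proof (cases "even (n - k * m)")
    case True
    have "k * m \<le> n" using m assms by (simp add: le_div_iff_mult_le)
    hence "mixed_monomial k n m s w = (\<Sum>i\<le>n. c m s i * Re w ^ i * Im w ^ (n - i))"
      unfolding c_def using True s by (intro dominated_form_coeff dominated_form_mixed_monomial)
    thus ?thesis by (simp add: sum_distrib_left mult.assoc)
  qed (simp add: q_def J_weight_eq_0[OF assms])
  hence "J_homog k l T z w n =
      (\<Sum>m\<le>n div k. \<Sum>s\<le>m. \<Sum>i\<le>n. q m s * c m s i * Re w ^ i * Im w ^ (n - i))"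
    unfolding J_homog_eq_sum_mixed_monomial q_def by simp
  also have "\<dots> = (\<Sum>m\<le>n div k. \<Sum>i\<le>n. \<Sum>s\<le>m. q m s * c m s i * Re w ^ i * Im w ^ (n - i))"
    by (intro sum.cong refl sum.swap)
  also have "\<dots> = (\<Sum>i\<le>n. (\<Sum>m\<le>n div k. \<Sum>s\<le>m. q m s * c m s i) * Re w ^ i * Im w ^ (n - i))"
    by (simp only: sum_distrib_right sum.swap[of _ _ "{..n div k}"])
  also have "\<dots> = (\<Sum>i\<le>n.
      J_coeff k l T z i (n - i) / (fact i * fact (n - i)) * Re w ^ i * Im w ^ (n - i))"
    by (intro sum.cong refl) (simp add: J_coeff_def q_def c_def)
  finally show ?thesis .
qed

lemma fps_prod_nth_dominated:
  fixes f g :: "'i \<Rightarrow> real fps"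
  assumes "\<And>i n. i \<in> A \<Longrightarrow> \<bar>f i $ n\<bar> \<le> g i $ n"
  shows "\<bar>(\<Prod>i\<in>A. f i) $ n\<bar> \<le> (\<Prod>i\<in>A. g i) $ n"
  using assms
proof (induction A arbitrary: n rule: infinite_finite_induct)
  case (insert a A)
  have "\<bar>(\<Prod>i\<in>insert a A. f i) $ n\<bar> \<le> (\<Sum>i=0..n. \<bar>f a $ i\<bar> * \<bar>(\<Prod>i\<in>A. f i) $ (n - i)\<bar>)"
    using insert sum_abs[of "\<lambda>i. f a $ i * (\<Prod>i\<in>A. f i) $ (n - i)" "{0..n}"]
    by (simp add: fps_mult_nth abs_mult)
  also have "\<dots> \<le> (\<Sum>i=0..n. g a $ i * (\<Prod>i\<in>A. g i) $ (n - i))"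
    using insert by (intro sum_mono mult_mono) (auto intro: order_trans[OF abs_ge_zero])
  finally show ?case using insert by (simp add: fps_mult_nth)
qed simp_all

lemma pochhammer_div_fact_le_power2:
  fixes x :: real
  assumes "0 \<le> x" and "x \<le> real L"
  shows "pochhammer x i / fact i \<le> 2 ^ (L + i)"
proof -
  have "pochhammer x i \<le> pochhammer (real (Suc L)) i"
    unfolding pochhammer_prod using assms by (intro prod_mono) auto
  also have "\<dots> / fact i = real (L + i choose i)"
    by (simp add: binomial_gbinomial gbinomial_pochhammer' add.commute)
  also have "\<dots> \<le> real (2 ^ (L + i))" using binomial_le_pow2[of "L + i" i] of_nat_le_iff by blast
  finally show ?thesis by (simp add: divide_right_mono)
qed

lemma abs_fps_powr_cheb_prod_nth_le:
  assumes "0 \<le> c" and "real k * c \<le> real L"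
  shows "\<bar>fps_powr (cheb_prod k 1 q) (- c) $ n\<bar> \<le> 2 ^ (L + n)"
proof -
  have "\<bar>fps_powr (cheb_prod k 1 q) (- c) $ n\<bar> =
      \<bar>(\<Prod>j<k. fps_powr (1 - fps_const (cheb_root k q j) * fps_X) (- c)) $ n\<bar>"
    unfolding cheb_prod_def by (subst fps_powr_prod) simp_all
  also have "\<dots> \<le> (\<Prod>j<k. fps_powr (1 - fps_const 1 * fps_X) (- c)) $ n"
  proof (rule fps_prod_nth_dominated)
    fix j n
    have "\<bar>cheb_root k q j\<bar> ^ n \<le> 1" by (simp add: cheb_root_def power_le_one)
    moreover have "pochhammer c n \<ge> 0"
      using assms(1) unfolding pochhammer_prod by (intro prod_nonneg) auto
    ultimately show "\<bar>fps_powr (1 - fps_const (cheb_root k q j) * fps_X) (- c) $ n\<bar> \<le>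
        fps_powr (1 - fps_const 1 * fps_X) (- c) $ n"
      unfolding fps_powr_linear_nth
      by (simp add: abs_mult power_abs divide_right_mono mult_left_le)
  qed
  also have "(\<Prod>j<k. fps_powr (1 - fps_const 1 * fps_X) (- c)) =
      fps_powr (1 - fps_const 1 * fps_X) (- (real k * c))"
    by (simp add: fps_powr_power)
  also have "\<dots> $ n = pochhammer (real k * c) n / fact n"
    by (simp only: fps_powr_linear_nth) simp
  also have "\<dots> \<le> 2 ^ (L + n)" using assms by (intro pochhammer_div_fact_le_power2) auto
  finally show ?thesis .
qed

lemma abs_J_weight_le:
  assumes k: "k > 0" and l: "l > 0" and km: "k * m \<le> n" and L: "real k * l \<le> real L"
    and d: "0 < d" "d \<le> real k * l" "d \<le> 1"
  shows "\<bar>J_weight k l n m\<bar> \<le> (l + 1) ^ m * (2 ^ (L + n) / (d ^ n * fact n))"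
proof -
  have "\<bar>fps_powr (cheb_base k 1) (- (l + real m)) $ (n - k * m)\<bar> \<le> 2 ^ (L + k * m + (n - k * m))"
    using l L by (intro abs_fps_powr_cheb_prod_nth_le) (auto simp: algebra_simps)
  hence root_power: "\<bar>fps_powr (cheb_base k 1) (- (l + real m)) $ (n - k * m)\<bar> \<le> 2 ^ (L + n)"
    using km by simp
  have numerator: "pochhammer l m / fact m \<le> (l + 1) ^ m"
    using norm_pochhammer_le[of l m] l by (simp add: divide_le_eq)
  have pos: "pochhammer (real k * l) n > 0" "pochhammer l m > 0"
    using k l by (auto intro: pochhammer_pos)
  have denominator: "1 / pochhammer (real k * l) n \<le> 1 / (d ^ n * fact n)"
    using power_mult_fact_le_pochhammer[of d "real k * l" n] d pos by (intro divide_left_mono) auto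
  have "\<bar>J_weight k l n m\<bar> \<le> (pochhammer l m / fact m *
      \<bar>fps_powr (cheb_base k 1) (- (l + real m)) $ (n - k * m)\<bar>) * (1 / pochhammer (real k * l) n)"
    using pos by (simp add: J_weight_def abs_mult)
  also have "\<dots> \<le> ((l + 1) ^ m * 2 ^ (L + n)) * (1 / (d ^ n * fact n))"
    using pos l by (intro mult_mono numerator root_power denominator)
        (auto intro!: mult_nonneg_nonneg)
  finally show ?thesis by simp
qed

lemma abs_mixed_monomial_le:
  assumes "k * m \<le> n" and "i \<le> m"
  shows "\<bar>mixed_monomial k n m i z\<bar> \<le> cmod z ^ n"
proof -
  have "\<bar>mixed_monomial k n m i z\<bar> = cmod z ^ (n - k * m) * \<bar>Re (z ^ k)\<bar> ^ i * \<bar>Im (z ^ k)\<bar> ^ (m - i)"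
    by (simp add: mixed_monomial_def abs_mult power_abs)
  also have "\<dots> \<le> cmod z ^ (n - k * m) * cmod (z ^ k) ^ i * cmod (z ^ k) ^ (m - i)"
    by (intro mult_mono power_mono abs_Re_le_cmod abs_Im_le_cmod) auto
  also have "\<dots> = cmod z ^ (n - k * m + k * i + k * (m - i))"
    by (simp add: norm_power power_add power_mult)
  also have "n - k * m + k * i + k * (m - i) = n"
    using assms by (simp add: diff_mult_distrib2)
  finally show ?thesis .
qed

lemma sum_power_le:
  fixes E :: real
  assumes "E \<ge> 1" and "N \<le> n"
  shows "(\<Sum>m\<le>N. E ^ m) \<le> (2 * E) ^ n"
proof -
  have "(\<Sum>m\<le>N. E ^ m) \<le> (\<Sum>m\<le>N. E ^ n)" using assms by (intro sum_mono power_increasing) auto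
  also have "\<dots> = real (Suc N) * E ^ n" by simp
  also have "\<dots> \<le> 2 ^ n * E ^ n"
  proof (intro mult_right_mono)
    have "Suc N \<le> 2 ^ n" using assms(2) by (intro Suc_leI) (meson le_less_trans less_exp)
    hence "real (Suc N) \<le> real (2 ^ n)" by (rule of_nat_mono)
    thus "real (Suc N) \<le> 2 ^ n" by simp
  qed (use assms in auto)
  finally show ?thesis by (simp add: power_mult_distrib)
qed

lemma abs_J_coeff_summand_le:
  assumes k: "k > 0" and l: "l > 0" and T: "\<And>i j. \<bar>T i j\<bar> \<le> 1" and m: "m \<le> n div k" and s: "s \<le> m"
    and L: "real k * l \<le> real L" and d: "0 < d" "d \<le> real k * l" "d \<le> 1"
  shows "\<bar>J_weight k l n m * (2 * (1 / 2) ^ k) ^ m * real (m choose s) * T s (m - s) *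
      mixed_monomial k n m s z * form_coeff n (mixed_monomial k n m s) i\<bar> \<le>
    (l + 1) ^ m * (2 ^ (L + n) / (d ^ n * fact n)) * 1 * real (m choose s) * 1 * cmod z ^ n *
    real (n choose i)"
proof (cases "even (n - k * m)")
  case True
  have km: "k * m \<le> n" using m k by (simp add: le_div_iff_mult_le)
  have weight: "\<bar>J_weight k l n m\<bar> \<le> (l + 1) ^ m * (2 ^ (L + n) / (d ^ n * fact n))"
    by (rule abs_J_weight_le[OF k l km L d])
  have "2 * (1 / 2 :: real) ^ k \<le> 1" using k by (cases k) (auto simp: power_le_one)
  hence "(2 * (1 / 2 :: real) ^ k) ^ m \<le> 1" by (intro power_le_one) auto
  hence half: "\<bar>(2 * (1 / 2 :: real) ^ k) ^ m\<bar> \<le> 1" by (subst abs_of_nonneg) auto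
  have form: "\<bar>form_coeff n (mixed_monomial k n m s) i\<bar> \<le> real (n choose i)"
    by (intro dominated_form_coeff(1) dominated_form_mixed_monomial km True s)
  show ?thesis
    unfolding abs_mult using l d
    by (intro mult_mono weight half form abs_mixed_monomial_le[OF km s] T) auto
qed (use l d in \<open>simp add: J_weight_eq_0[OF k]\<close>)

lemma abs_J_coeff_le:
  assumes k: "k > 0" and l: "l > 0" and T: "\<And>i j. \<bar>T i j\<bar> \<le> 1"
    and L: "real k * l \<le> real L" and d: "0 < d" "d \<le> real k * l" "d \<le> 1"
  shows "\<bar>J_coeff k l T z i j\<bar> \<le> 2 ^ L * (8 * (l + 1) * cmod z / d) ^ (i + j)"
proof -
  define n where "n = i + j"
  define W where "W = 2 ^ (L + n) / (d ^ n * fact n)"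
  have W: "W \<ge> 0" using d by (simp add: W_def)
  have "\<bar>J_coeff k l T z i j\<bar> \<le> fact i * fact j *
      (\<Sum>m\<le>n div k. \<Sum>s\<le>m. (l + 1) ^ m * W * 1 * real (m choose s) * 1 * cmod z ^ n *
      real (n choose i))"
    unfolding J_coeff_def n_def[symmetric] abs_mult W_def
    by (intro mult_mono order_trans[OF sum_abs] sum_mono)
       (use abs_J_coeff_summand_le[OF k l T _ _ L d] in auto)
  also have "\<dots> = fact i * fact j * real (n choose i) * W * cmod z ^ n *
      (\<Sum>m\<le>n div k. (l + 1) ^ m * (\<Sum>s\<le>m. real (m choose s)))"
    by (simp add: sum_distrib_left mult_ac)
  also have "(\<Sum>m\<le>n div k. (l + 1) ^ m * (\<Sum>s\<le>m. real (m choose s))) = (\<Sum>m\<le>n div k. (2 * (l + 1)) ^ m)"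
  proof (intro sum.cong refl)
    fix m
    have "(\<Sum>s\<le>m. real (m choose s)) = 2 ^ m" by (simp add: choose_row_sum flip: of_nat_sum)
    thus "(l + 1) ^ m * (\<Sum>s\<le>m. real (m choose s)) = (2 * (l + 1)) ^ m"
      by (simp only: power_mult_distrib mult.commute)
  qed
  also have "fact i * fact j * real (n choose i) = fact n"
    by (simp add: n_def binomial_fact)
  also have "fact n * W * cmod z ^ n * (\<Sum>m\<le>n div k. (2 * (l + 1)) ^ m) \<le>
      fact n * W * cmod z ^ n * (2 * (2 * (l + 1))) ^ n"
    using W l by (intro mult_left_mono sum_power_le) auto
  also have "\<dots> = 2 ^ L * (2 ^ n * (2 * (2 * (l + 1))) ^ n * cmod z ^ n / d ^ n)"
    using d by (simp add: W_def power_add)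
  also have "\<dots> = 2 ^ L * (2 * (2 * (2 * (l + 1))) * cmod z / d) ^ n"
    by (simp only: power_mult_distrib[symmetric] power_divide[symmetric])
  finally show ?thesis by (simp add: n_def)
qed

lemma geom_bounded_J_coeff:
  assumes "k > 0" and "l > 0" and "\<And>i j. \<bar>T i j\<bar> \<le> 1"
  shows "geom_bounded (J_coeff k l T z)"
proof -
  obtain L where "real k * l \<le> real L" using real_arch_simple by blast
  moreover define d where "d = min (real k * l) 1"
  moreover have "0 < d" "d \<le> real k * l" "d \<le> 1" using assms by (auto simp: d_def)
  ultimately show ?thesis
    unfolding geom_bounded_def using abs_J_coeff_le[OF assms] assms(2)
    by (intro exI[of _ "2 ^ L"] exI[of _ "8 * (l + 1) * cmod z / d"]) auto
qed

lemma humbert_Phi2_cheb_root_has_sum: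
  assumes "gam > 0"
  shows "((\<lambda>n. fps_powr (cheb_prod k r q) (- l) $ n / pochhammer gam n)
    has_sum humbert_Phi2 k (\<lambda>_. l) gam (\<lambda>j. r * cheb_root k q j)) UNIV"
proof -
  have "fps_powr (cheb_prod k r q) (- l) =
      (\<Prod>i<k. fps_powr (1 - fps_const (r * cheb_root k q i) * fps_X) (- l))"
    unfolding cheb_prod_def by (rule fps_powr_prod) simp
  thus ?thesis using humbert_Phi2_has_sum[OF assms, where m = k and bet = "\<lambda>_. l"] by simp
qed

lemma fps_powr_cheb_prod_symmetrized:
  assumes k: "k > 0"
  shows "(fps_powr (cheb_prod k r q) (- l) $ n + fps_powr (cheb_prod k r (pi - q)) (- l) $ n) /
      (2 * pochhammer (real k * l) n) =
    (\<Sum>m\<le>n div k. J_weight k l n m * r ^ (n - k * m) * (2 * (r / 2) ^ k * cos q) ^ m)"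
  unfolding fps_powr_cheb_prod_nth[OF k, of r q l n] fps_powr_cheb_prod_nth[OF k, of r "pi - q" l n]
    sum.distrib[symmetric] sum_divide_distrib
proof (intro sum.cong refl)
  fix m
  define y where "y = 2 * (r / 2) ^ k * cos q"
  define A where "A = fps_powr (cheb_base k 1) (- (l + real m)) $ (n - k * m)"
  have "2 * (r / 2) ^ k * cos (pi - q) = - y" by (simp add: y_def)
  moreover have "(pochhammer l m / fact m * y ^ m * (r ^ (n - k * m) * A) +
      pochhammer l m / fact m * (- y) ^ m * (r ^ (n - k * m) * A)) / (2 * pochhammer (real k * l) n) =
      J_weight k l n m * r ^ (n - k * m) * y ^ m"
    by (cases "even m") (simp_all add: J_weight_def A_def)
  ultimately show "(pochhammer l m / fact m * (2 * (r / 2) ^ k * cos q) ^ m *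
        fps_powr (cheb_base k r) (- (l + real m)) $ (n - k * m) +
      pochhammer l m / fact m * (2 * (r / 2) ^ k * cos (pi - q)) ^ m *
        fps_powr (cheb_base k r) (- (l + real m)) $ (n - k * m)) / (2 * pochhammer (real k * l) n) =
      J_weight k l n m * r ^ (n - k * m) * (2 * (r / 2) ^ k * cos q) ^ m"
    by (simp only: fps_powr_cheb_prod_nth_scale[of k r] y_def A_def)
qed

lemma g_fun_has_sum:
  assumes k: "k > 0" and ab: "a + b > 0" and x: "\<bar>x\<bar> \<le> 1"
  shows "((\<lambda>n. \<Sum>m\<le>n div k. J_weight k (a + b) n m * r ^ (n - k * m) * (2 * (r / 2) ^ k * x) ^ m)
    has_sum g_fun k a b r x) UNIV"
proof -
  define q where "q = arccos x"
  define l where "l = a + b"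
  define c where "c q n = fps_powr (cheb_prod k r q) (- l) $ n / pochhammer (real k * l) n" for q n
  have "real k * l > 0" using k ab by (simp add: l_def)
  hence series:
      "(c q has_sum humbert_Phi2 k (\<lambda>_. l) (real k * l) (\<lambda>j. r * cheb_root k q j)) UNIV" for q
    unfolding c_def by (rule humbert_Phi2_cheb_root_has_sum)
  have "((\<lambda>n. (c q n + c (pi - q) n) * (1 / 2)) has_sum g_fun k a b r x) UNIV"
    unfolding g_fun_def Let_def q_def[symmetric] l_def[symmetric]
    using has_sum_cmult_left[OF has_sum_add[OF series[of q] series[of "pi - q"]], of "1 / 2"]
    by (simp add: cheb_root_def)
  moreover have "(c q n + c (pi - q) n) * (1 / 2) =
      (\<Sum>m\<le>n div k. J_weight k l n m * r ^ (n - k * m) * (2 * (r / 2) ^ k * x) ^ m)" for n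
  proof -
    have "cos q = x" using x by (simp add: q_def cos_arccos_abs)
    thus ?thesis
      using fps_powr_cheb_prod_symmetrized[OF k, of r q l n] by (simp add: c_def add_divide_distrib)
  qed
  ultimately show ?thesis by (simp add: l_def)
qed

lemma abs_xi_uv_le_1:
  assumes "\<bar>u\<bar> \<le> 1" and "\<bar>v\<bar> \<le> 1"
  shows "\<bar>xi_uv u v s t\<bar> \<le> 1"
proof -
  have abs_mult_le: "\<bar>x * y\<bar> \<le> (x\<^sup>2 + y\<^sup>2) / 2" for x y :: real
    using sum_squares_bound[of "\<bar>x\<bar>" "\<bar>y\<bar>"] by (simp add: abs_mult)
  have "\<bar>v * (cos s * cos t)\<bar> \<le> 1 * ((cos s)\<^sup>2 + (cos t)\<^sup>2) / 2"
    using mult_mono[OF assms(2) abs_mult_le[of "cos s" "cos t"]] by (simp add: abs_mult)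
  moreover have "\<bar>u * (sin s * sin t)\<bar> \<le> 1 * ((sin s)\<^sup>2 + (sin t)\<^sup>2) / 2"
    using mult_mono[OF assms(1) abs_mult_le[of "sin s" "sin t"]] by (simp add: abs_mult)
  ultimately have "\<bar>xi_uv u v s t\<bar> \<le> ((cos s)\<^sup>2 + (cos t)\<^sup>2) / 2 + ((sin s)\<^sup>2 + (sin t)\<^sup>2) / 2"
    unfolding xi_uv_def mult.assoc by linarith
  thus ?thesis using sin_cos_squared_add[of s] sin_cos_squared_add[of t] by argo
qed

lemma power_eq_cmod_cos_sin_Arg:
  shows "Re (z ^ k) = cmod z ^ k * cos (real k * Arg z)"
    and "Im (z ^ k) = cmod z ^ k * sin (real k * Arg z)"
proof -
  have "z ^ k = (of_real (cmod z) * cis (Arg z)) ^ k"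
    using rcis_cmod_Arg[of z] by (simp add: rcis_def)
  hence "z ^ k = of_real (cmod z ^ k) * cis (real k * Arg z)"
    by (simp add: power_mult_distrib Complex.DeMoivre)
  thus "Re (z ^ k) = cmod z ^ k * cos (real k * Arg z)"
    and "Im (z ^ k) = cmod z ^ k * sin (real k * Arg z)"
    by (simp_all del: of_real_power)
qed

lemma cos_form_plus_sin_form:
  "2 * (cmod (z * w) / 2) ^ k * xi_uv u v (real k * Arg z) (real k * Arg w) =
    v * cos_form k z w + u * sin_form k z w"
  unfolding cos_form_def sin_form_def power_eq_cmod_cos_sin_Arg xi_uv_def
  by (simp add: norm_mult power_mult_distrib power_divide algebra_simps)

lemma J_uv_has_sum_J_homog:
  assumes "k > 0" and "a + b > 0" and u: "\<bar>u\<bar> \<le> 1" and v: "\<bar>v\<bar> \<le> 1"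
  shows "((\<lambda>n. J_homog k (a + b) (\<lambda>i j. v ^ i * u ^ j) z w n) has_sum J_uv k a b u v z w) UNIV"
  using g_fun_has_sum[OF assms(1,2) abs_xi_uv_le_1[OF u v, of "real k * Arg z" "real k * Arg w"],
      where r = "cmod (z * w)"]
  unfolding cos_form_plus_sin_form J_uv_def J_homog_def umbral_power_powers .

lemma geom_bounded_J_coeff_powers:
  assumes "k > 0" and "l > 0" and "\<bar>u\<bar> \<le> 1" and "\<bar>v\<bar> \<le> 1"
  shows "geom_bounded (J_coeff k l (\<lambda>i j. v ^ i * u ^ j) z)"
  using assms
  by (intro geom_bounded_J_coeff) (auto simp: abs_mult power_abs power_le_one mult_le_one)

lemma J_uv_eq_exp_series:
  assumes "k > 0" and "a + b > 0" and "\<bar>u\<bar> \<le> 1" and "\<bar>v\<bar> \<le> 1"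
  shows "J_uv k a b u v z = exp_series (J_coeff k (a + b) (\<lambda>i j. v ^ i * u ^ j) z)"
  using J_uv_has_sum_J_homog[OF assms] geom_bounded_J_coeff_powers[OF assms]
  by (intro ext exp_series_eq_if_antidiagonal_has_sum[symmetric])
     (simp_all add: J_homog_eq_sum_J_coeff[OF assms(1)])

lemma p_uv_eq_poly_pairing:
  assumes "k > 0" and "a + b > 0" and "\<bar>u\<bar> \<le> 1" and "\<bar>v\<bar> \<le> 1"
  shows "p_uv k a b p u v z = poly_pairing p (J_coeff k (a + b) (\<lambda>i j. v ^ i * u ^ j) z)"
  unfolding p_uv_def J_uv_eq_exp_series[OF assms]
  by (rule poly_diff_op_exp_series_0[OF geom_bounded_J_coeff_powers[OF assms]])

section \<open>A solution of the Dunkl recursion\<close>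

lemma umbral_power_add:
  "umbral_power (\<lambda>i j. S i j + T i j) X Y m = umbral_power S X Y m + umbral_power T X Y m"
  by (simp add: umbral_power_def sum.distrib[symmetric] algebra_simps)

lemma umbral_power_scale: "umbral_power (\<lambda>i j. c * T i j) X Y m = c * umbral_power T X Y m"
  by (simp add: umbral_power_def sum_distrib_left mult_ac)

lemma umbral_power_swap: "umbral_power T X Y m = umbral_power (\<lambda>i j. T j i) Y X m"
  unfolding umbral_power_def
  by (rule sum.reindex_bij_witness[where i = "\<lambda>i. m - i" and j = "\<lambda>i. m - i"])
     (auto simp: binomial_symmetric[symmetric] mult_ac)

lemma umbral_power_minus_left:
  "umbral_power T (- X) Y m =
    umbral_power (\<lambda>i j. (- 1) ^ i * T i j) X Y m"
  unfolding umbral_power_def power_minus[of X] by (simp add: mult_ac)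

lemma umbral_power_minus_right:
  "umbral_power T X (- Y) m =
    umbral_power (\<lambda>i j. (- 1) ^ j * T i j) X Y m"
  unfolding umbral_power_def power_minus[of Y] by (simp add: mult_ac)

lemma of_nat_mult_umbral_power:
  "real m * umbral_power T X Y m = umbral_power (\<lambda>i j. (real i + real j) * T i j) X Y m"
  by (simp add: umbral_power_def sum_distrib_left mult_ac)

lemma umbral_power_Suc_left:
  "umbral_power (\<lambda>i j. real i * T (i - 1) j) X Y (Suc m) = real (Suc m) * X * umbral_power T X Y m"
proof -
  have "umbral_power (\<lambda>i j. real i * T (i - 1) j) X Y (Suc m) =
      (\<Sum>i\<le>m. (real (Suc i) * real (Suc m choose Suc i)) * (T i (m - i) * X ^ Suc i * Y ^ (m - i)))"
    unfolding umbral_power_def sum.atMost_Suc_shift by (simp add: mult_ac del: of_nat_Suc power_Suc)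
  also have "\<dots> = (\<Sum>i\<le>m. (real (Suc m) * real (m choose i)) * (T i (m - i) * X ^ Suc i * Y ^ (m - i)))"
    unfolding of_nat_mult[symmetric] Suc_times_binomial ..
  finally show ?thesis
    by (simp add: umbral_power_def sum_distrib_left mult_ac del: of_nat_Suc)
qed

lemma umbral_power_Suc_right:
  "umbral_power (\<lambda>i j. real j * T i (j - 1)) X Y (Suc m) = real (Suc m) * Y * umbral_power T X Y m"
  using umbral_power_Suc_left[of "\<lambda>i j. T j i" Y X m]
  by (simp add: umbral_power_swap[of _ X Y] del: of_nat_Suc)

primrec rank1_coeff :: "real \<Rightarrow> nat \<Rightarrow> real" where
  "rank1_coeff b 0 = 1"
| "rank1_coeff b (Suc n) = real (Suc n) / (real (Suc n) + b * (1 - (- 1) ^ Suc n)) * rank1_coeff b n"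

lemma rank1_coeff_rec:
  assumes "b > 0"
  shows "(real n + b * (1 - (- 1) ^ n)) * rank1_coeff b n = real n * rank1_coeff b (n - 1)"
proof (cases n)
  case (Suc m)
  have "(- 1 :: real) ^ Suc m \<le> 1" by (cases "even m") auto
  hence "real (Suc m) + b * (1 - (- 1) ^ Suc m) > 0" using assms by (intro add_pos_nonneg) auto
  thus ?thesis by (simp add: Suc del: of_nat_Suc power_Suc)
qed simp

definition rank2_moments :: "real \<Rightarrow> real \<Rightarrow> nat \<Rightarrow> nat \<Rightarrow> real" where
  "rank2_moments a b i j = rank1_coeff b i * rank1_coeff a j"

text \<open>For \<open>X = Re \<zeta> * Re \<eta>\<close>, \<open>Y = Im \<zeta> * Im \<eta>\<close> the umbral power with these moments is the image of
  \<open>(\<lambda>\<zeta>. (\<zeta> \<bullet> \<eta>) ^ m)\<close> under the (product) intertwining operator of the group generated by the two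
  coordinate reflections.\<close>

lemma umbral_power_rank2_rec:
  assumes a: "a > 0" and b: "b > 0"
  shows "(real (Suc m) + (a + b)) * umbral_power (rank2_moments a b) X Y (Suc m)
      - a * umbral_power (rank2_moments a b) X (- Y) (Suc m)
      - b * umbral_power (rank2_moments a b) (- X) Y (Suc m) =
    real (Suc m) * (X + Y) * umbral_power (rank2_moments a b) X Y m"
proof -
  let ?T = "rank2_moments a b"
  let ?U = "\<lambda>T. umbral_power T X Y (Suc m)"
  have moments_rec: "(real i + real j) * ?T i j + ((a + b) * ?T i j +
      ((- a) * ((- 1) ^ j * ?T i j) + (- b) * ((- 1) ^ i * ?T i j))) =
      real i * ?T (i - 1) j + real j * ?T i (j - 1)" for i j
  proof -
    have "(real i + b * (1 - (- 1) ^ i)) * ?T i j = real i * ?T (i - 1) j"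
      and "(real j + a * (1 - (- 1) ^ j)) * ?T i j = real j * ?T i (j - 1)"
      using rank1_coeff_rec[OF a, of j] rank1_coeff_rec[OF b, of i]
      by (simp_all add: rank2_moments_def)
    thus ?thesis by (simp add: algebra_simps)
  qed
  have "(real (Suc m) + (a + b)) * ?U ?T - a * umbral_power ?T X (- Y) (Suc m) -
      b * umbral_power ?T (- X) Y (Suc m) =
      real (Suc m) * ?U ?T + ((a + b) * ?U ?T +
        ((- a) * ?U (\<lambda>i j. (- 1) ^ j * ?T i j) + (- b) * ?U (\<lambda>i j. (- 1) ^ i * ?T i j)))"
    unfolding umbral_power_minus_left umbral_power_minus_right by algebra
  also have "\<dots> = ?U (\<lambda>i j. real i * ?T (i - 1) j + real j * ?T i (j - 1))"
    unfolding moments_rec[symmetric] of_nat_mult_umbral_power umbral_power_add umbral_power_scale ..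
  also have "\<dots> = real (Suc m) * (X + Y) * umbral_power ?T X Y m"
    unfolding umbral_power_add umbral_power_Suc_left umbral_power_Suc_right
    by (simp add: algebra_simps)
  finally show ?thesis .
qed

definition rank2_series :: "real \<Rightarrow> real \<Rightarrow> real \<Rightarrow> real \<Rightarrow> real fps" where
  "rank2_series a b X Y =
     Abs_fps (\<lambda>m. pochhammer (a + b + 1) m / fact m * umbral_power (rank2_moments a b) X Y m)"

lemma fps_euler_rank2_series:
  assumes a: "a > 0" and b: "b > 0"
  shows "fps_euler (a + b) ((1 - fps_const (X + Y) * fps_X) * rank2_series a b X Y) =
    fps_const a * rank2_series a b X (- Y) + fps_const b * rank2_series a b (- X) Y"
proof (rule fps_ext)
  fix n
  define P where "P m = pochhammer (a + b + 1) m / fact m" for m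
  let ?U = "umbral_power (rank2_moments a b)"
  show "fps_euler (a + b) ((1 - fps_const (X + Y) * fps_X) * rank2_series a b X Y) $ n =
    (fps_const a * rank2_series a b X (- Y) + fps_const b * rank2_series a b (- X) Y) $ n"
  proof (cases n)
    case 0
    thus ?thesis by (simp add: rank2_series_def umbral_power_def rank2_moments_def)
  next
    case (Suc m)
    have "real (Suc m) * P (Suc m) = (real (Suc m) + (a + b)) * P m"
    proof -
      have "P (Suc m) = P m * (a + b + 1 + real m) / real (Suc m)"
        by (simp add: P_def pochhammer_Suc del: of_nat_Suc)
      thus ?thesis by (simp add: mult_ac)
    qed
    hence "(real (Suc m) + (a + b)) * (P (Suc m) * ?U X Y (Suc m) - (X + Y) * (P m * ?U X Y m)) =
        P (Suc m) * ((real (Suc m) + (a + b)) * ?U X Y (Suc m) - real (Suc m) * (X + Y) * ?U X Y m)"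
      by algebra
    also have "\<dots> = P (Suc m) * (a * ?U X (- Y) (Suc m) + b * ?U (- X) Y (Suc m))"
      unfolding umbral_power_rank2_rec[OF a b, symmetric] by simp
    finally show ?thesis
      unfolding Suc fps_euler_nth left_diff_distrib fps_sub_nth mult.assoc
          fps_mult_left_const_nth fps_add_nth
      by (simp add: rank2_series_def P_def algebra_simps)
  qed
qed

lemma sum_prod_linear_factors_omit:
  fixes c :: "'i \<Rightarrow> 'a :: comm_ring_1"
  assumes "finite I"
  shows "(\<Sum>l\<in>I. \<Prod>i\<in>I - {l}. 1 - fps_const (c i) * fps_X) =
    fps_const (of_nat (card I)) * (\<Prod>i\<in>I. 1 - fps_const (c i) * fps_X)
    - fps_X * fps_deriv (\<Prod>i\<in>I. 1 - fps_const (c i) * fps_X)"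
  using assms
proof (induction I rule: finite_induct)
  case (insert x I)
  define f where "f i = 1 - fps_const (c i) * fps_X" for i
  define P where "P = (\<Prod>i\<in>I. f i)"
  have "(\<Prod>i\<in>insert x I - {l}. f i) = f x * (\<Prod>i\<in>I - {l}. f i)" if "l \<in> I" for l
  proof -
    have "insert x I - {l} = insert x (I - {l})" using that insert by auto
    thus ?thesis using insert by simp
  qed
  moreover have "insert x I - {x} = I" using insert by auto
  ultimately have "(\<Sum>l\<in>insert x I. \<Prod>i\<in>insert x I - {l}. f i) = P + f x * (\<Sum>l\<in>I. \<Prod>i\<in>I - {l}. f i)"
    using insert by (simp add: P_def sum_distrib_left)
  also have "\<dots> = P + f x * (fps_const (of_nat (card I)) * P - fps_X * fps_deriv P)"
    using insert.IH by (simp only: f_def P_def)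
  also have "\<dots> = (1 + fps_const (of_nat (card I))) * (f x * P) - fps_X * fps_deriv (f x * P)"
  proof -
    have "f x = 1 + fps_X * fps_deriv (f x)" by (simp add: f_def algebra_simps)
    hence "P = P * (f x - fps_X * fps_deriv (f x))" by (metis add_diff_cancel_right' mult_1_right)
    thus ?thesis unfolding fps_deriv_mult by (simp add: algebra_simps)
  qed
  finally show ?case using insert by (simp add: f_def P_def flip: fps_const_add)
qed simp

definition dih_rot :: "nat \<Rightarrow> nat \<Rightarrow> complex \<Rightarrow> complex" where
  "dih_rot k j z = z * cis (real j * pi / real k)"

lemma dih_refl_eq_dih_rot_cnj: "dih_refl k j z = dih_rot k j (cnj z)"
  by (simp add: dih_refl_def dih_rot_def)

lemma dih_rot_add: "dih_rot k (i + j) z = dih_rot k i (dih_rot k j z)"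
  by (simp add: dih_rot_def cis_mult distrib_right add_divide_distrib add.commute)

lemma dih_rot_0 [simp]: "dih_rot k 0 z = z"
  by (simp add: dih_rot_def)

lemma cmod_dih_rot [simp]: "cmod (dih_rot k j z) = cmod z"
  by (simp add: dih_rot_def norm_mult)

lemma dih_rot_power:
  assumes "k > 0"
  shows "dih_rot k j z ^ k = of_real ((- 1) ^ j) * z ^ k"
proof -
  have "cis (real j * pi) = of_real ((- 1) ^ j)" by (simp add: complex_eq_iff cos_npi)
  thus ?thesis using assms by (simp add: dih_rot_def power_mult_distrib Complex.DeMoivre)
qed

lemma dih_rot_period:
  assumes "k > 0"
  shows "dih_rot k (2 * (i mod k)) z = dih_rot k (2 * i) z"
proof -
  have "dih_rot k (2 * k * m) z = z" for m
  proof -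
    have "cis (2 * pi * real m) = 1" using cis_multiple_2pi[of "real m"] by simp
    thus ?thesis using assms by (simp add: dih_rot_def mult_ac)
  qed
  moreover have "2 * i = 2 * (i mod k) + 2 * k * (i div k)"
    by (metis distrib_left mod_mult_div_eq mult.assoc)
  ultimately show ?thesis by (metis dih_rot_add)
qed

lemma inner_rcis: "rcis r x \<bullet> rcis s y = r * s * cos (y - x)"
  by (simp add: inner_complex_def cos_diff algebra_simps)

lemma inner_dih_rot_even:
  assumes "k > 0"
  shows "dih_rot k (2 * j) z \<bullet> w = cmod (z * w) * cheb_root k (real k * (Arg w - Arg z)) j"
proof -
  have "dih_rot k (2 * j) (rcis r x) = rcis r (x + 2 * real j * pi / real k)" for r x
    by (simp add: dih_rot_def rcis_def cis_mult mult.assoc)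
  hence "dih_rot k (2 * j) z \<bullet> w = cmod (z * w) * cos (Arg w - (Arg z + 2 * real j * pi / real k))"
    by (metis inner_rcis norm_mult rcis_cmod_Arg)
  moreover have "Arg w - (Arg z + 2 * real j * pi / real k) =
      (real k * (Arg w - Arg z) - 2 * real j * pi) / real k"
    using assms by (simp add: field_simps)
  ultimately show ?thesis by (simp only: cheb_root_def)
qed

lemma cos_form_dih_rot: "k > 0 \<Longrightarrow> cos_form k (dih_rot k j z) w = (- 1) ^ j * cos_form k z w"
  by (simp add: cos_form_def dih_rot_power)

lemma sin_form_dih_rot: "k > 0 \<Longrightarrow> sin_form k (dih_rot k j z) w = (- 1) ^ j * sin_form k z w"
  by (simp add: sin_form_def dih_rot_power)

lemma cos_form_cnj: "cos_form k (cnj z) w = cos_form k z w"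
  by (simp add: cos_form_def flip: complex_cnj_power)

lemma sin_form_cnj: "sin_form k (cnj z) w = - sin_form k z w"
  by (simp add: sin_form_def flip: complex_cnj_power)

lemma prod_dih_rot_linear_factors:
  assumes "k > 0"
  shows "(\<Prod>j<k. 1 - fps_const (dih_rot k (2 * j) z \<bullet> w) * fps_X) =
    cheb_base k (cmod (z * w)) - fps_const (cos_form k z w + sin_form k z w) * fps_X ^ k"
proof -
  define q where "q = real k * (Arg w - Arg z)"
  have "(\<Prod>j<k. 1 - fps_const (dih_rot k (2 * j) z \<bullet> w) * fps_X) = cheb_prod k (cmod (z * w)) q"
    unfolding cheb_prod_def q_def by (simp only: inner_dih_rot_even[OF assms])
  also have "\<dots> = cheb_base k (cmod (z * w)) -
      fps_const (2 * (cmod (z * w) / 2) ^ k * cos q) * fps_X ^ k"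
    by (rule cheb_prod_eq[OF assms])
  also have "2 * (cmod (z * w) / 2) ^ k * cos q = cos_form k z w + sin_form k z w"
  proof -
    have "cos q = xi_uv 1 1 (real k * Arg z) (real k * Arg w)"
      by (simp add: q_def xi_uv_def right_diff_distrib cos_diff mult_ac)
    thus ?thesis using cos_form_plus_sin_form[of z w k 1 1] by simp
  qed
  finally show ?thesis .
qed

text \<open>The factor \<open>1 - (z \<bullet> w) X\<close> of the full rotation-invariant product is left out: the Dunkl
  recursion multiplies by it.\<close>

definition dunkl_series :: "nat \<Rightarrow> real \<Rightarrow> real \<Rightarrow> complex \<Rightarrow> complex \<Rightarrow> real fps" where
  "dunkl_series k a b z w =
     fps_powr_subst k (a + b + 1) (cheb_base k (cmod (z * w)))
       (rank2_series a b (cos_form k z w) (sin_form k z w)) *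
     (\<Prod>j\<in>{1..<k}. 1 - fps_const (dih_rot k (2 * j) z \<bullet> w) * fps_X)"

lemma dunkl_series_nth_0:
  assumes "k > 0"
  shows "dunkl_series k a b z w $ 0 = 1"
  using assms
  by (simp add: dunkl_series_def fps_powr_subst_def rank2_series_def umbral_power_def
      rank2_moments_def fps_prod_nth_0)

definition rotation_sum :: "nat \<Rightarrow> real \<Rightarrow> real \<Rightarrow> real fps \<Rightarrow> real fps" where
  "rotation_sum k l r d =
     (fps_const (real k) * cheb_base k r - fps_X * fps_deriv (cheb_base k r)) *
     fps_powr_subst k (l + 1) (cheb_base k r) d"

lemma rotation_sum_add: "rotation_sum k l r (d + e) = rotation_sum k l r d + rotation_sum k l r e"
  by (simp only: rotation_sum_def fps_powr_subst_add distrib_left)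

lemma rotation_sum_const_mult:
  assumes "k > 0"
  shows "rotation_sum k l r (fps_const c * d) = fps_const c * rotation_sum k l r d"
  unfolding rotation_sum_def fps_powr_subst_const_mult[OF assms] by (simp only: mult_ac)

lemma fps_euler_powr_subst_cheb_base:
  assumes "k > 0"
  shows "fps_euler (real k * l) (fps_powr_subst k l (cheb_base k r) d) =
      rotation_sum k l r (fps_euler l d)"
  using fps_euler_powr_subst[OF cheb_prod_nth_0 assms] by (simp add: rotation_sum_def)

lemma bij_betw_add_mod:
  fixes k l :: nat
  assumes "l < k"
  shows "bij_betw (\<lambda>j. (j + l) mod k) {1..<k} ({..<k} - {l})"
proof -
  have add_mod: "(i + l) mod k = (if i + l < k then i + l else i + l - k)" if "i < k" for i
    using that assms by (auto simp: le_mod_geq not_less)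
  have inj: "inj_on (\<lambda>j. (j + l) mod k) {1..<k}"
    by (rule inj_onI) (auto simp: add_mod split: if_splits)
  moreover have "(\<lambda>j. (j + l) mod k) ` {1..<k} = {..<k} - {l}"
  proof (rule card_subset_eq)
    show "(\<lambda>j. (j + l) mod k) ` {1..<k} \<subseteq> {..<k} - {l}"
      using assms by (auto simp: add_mod)
    show "card ((\<lambda>j. (j + l) mod k) ` {1..<k}) = card ({..<k} - {l})"
      unfolding card_image[OF inj] using assms by simp
  qed simp
  ultimately show ?thesis by (simp add: bij_betw_def)
qed

lemma prod_dih_rot_translate:
  assumes "l < k"
  shows "(\<Prod>j\<in>{1..<k}. f (dih_rot k (2 * j) (dih_rot k (2 * l) z))) =
      (\<Prod>i\<in>{..<k} - {l}. f (dih_rot k (2 * i) z))"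
proof -
  have "dih_rot k (2 * j) (dih_rot k (2 * l) z) = dih_rot k (2 * ((j + l) mod k)) z" for j
    using assms by (subst dih_rot_period) (simp_all add: distrib_left dih_rot_add)
  thus ?thesis using prod.reindex_bij_betw[OF bij_betw_add_mod[OF assms]] by simp
qed

lemma sum_dunkl_series_rotations:
  assumes k: "k > 0"
  shows "(\<Sum>l<k. dunkl_series k a b (dih_rot k (2 * l) z) w) =
    rotation_sum k (a + b) (cmod (z * w)) (rank2_series a b (cos_form k z w) (sin_form k z w))"
proof -
  define A where "A = cheb_base k (cmod (z * w))"
  define y where "y = cos_form k z w + sin_form k z w"
  define P where "P = (\<Prod>j<k. 1 - fps_const (dih_rot k (2 * j) z \<bullet> w) * fps_X)"
  define R where "R =
      fps_powr_subst k (a + b + 1) A (rank2_series a b (cos_form k z w) (sin_form k z w))"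
  have "dunkl_series k a b (dih_rot k (2 * l) z) w =
      R * (\<Prod>i\<in>{..<k} - {l}. 1 - fps_const (dih_rot k (2 * i) z \<bullet> w) * fps_X)" if "l < k" for l
    using k prod_dih_rot_translate[OF that, of "\<lambda>x. 1 - fps_const (x \<bullet> w) * fps_X" z]
    by (simp add: dunkl_series_def R_def A_def cos_form_dih_rot sin_form_dih_rot norm_mult
        del: One_nat_def)
  hence "(\<Sum>l<k. dunkl_series k a b (dih_rot k (2 * l) z) w) =
      R * (fps_const (real k) * P - fps_X * fps_deriv P)"
    using sum_prod_linear_factors_omit[of "{..<k}" "\<lambda>i. dih_rot k (2 * i) z \<bullet> w"]
    by (simp add: P_def sum_distrib_left[symmetric])
  also have "fps_const (real k) * P - fps_X * fps_deriv P =
      fps_const (real k) * A - fps_X * fps_deriv A"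
  proof -
    have P: "P = A - fps_const y * fps_X ^ k"
      unfolding P_def A_def y_def by (rule prod_dih_rot_linear_factors[OF k])
    have deriv_P:
        "fps_X * fps_deriv P = fps_X * fps_deriv A - fps_const y * (fps_const (real k) * fps_X ^ k)"
      unfolding P fps_X_mult_deriv_X_power[symmetric]
      by (simp only: fps_deriv_sub fps_deriv_mult fps_deriv_const) (simp add: algebra_simps)
    show ?thesis unfolding deriv_P unfolding P by (simp add: algebra_simps)
  qed
  finally show ?thesis by (simp add: rotation_sum_def R_def A_def mult.commute)
qed

lemma sum_lessThan_double:
  fixes k :: nat
  shows "(\<Sum>j<2 * k. f j) = (\<Sum>l<k. f (2 * l) + f (2 * l + 1) :: 'a :: comm_monoid_add)"
  by (induction k) (simp_all add: add.assoc)

lemma fps_euler_dunkl_series: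
  assumes k: "k > 0" and a: "a > 0" and b: "b > 0"
  shows "fps_euler (real k * (a + b)) ((1 - fps_const (z \<bullet> w) * fps_X) * dunkl_series k a b z w) =
    (\<Sum>j<2 * k. fps_const (dih_kappa a b j) * dunkl_series k a b (dih_refl k j z) w)"
proof -
  define A where "A = cheb_base k (cmod (z * w))"
  define c where "c = cos_form k z w"
  define s where "s = sin_form k z w"
  let ?S = "rank2_series a b"
  let ?R = "rotation_sum k (a + b) (cmod (z * w))"
  have "{..<k} = insert 0 {1..<k}" using k by auto
  hence "(1 - fps_const (z \<bullet> w) * fps_X) * dunkl_series k a b z w =
      (\<Prod>j<k. 1 - fps_const (dih_rot k (2 * j) z \<bullet> w) * fps_X) *
      fps_powr_subst k (a + b + 1) A (?S c s)"
    by (simp add: dunkl_series_def A_def c_def s_def mult_ac)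
  also have "\<dots> = fps_powr_subst k (a + b) A ((1 - fps_const (c + s) * fps_X) * ?S c s)"
    unfolding prod_dih_rot_linear_factors[OF k] A_def[symmetric] c_def[symmetric] s_def[symmetric]
    by (rule fps_powr_subst_linear_mult[symmetric]) (simp_all add: A_def k)
  finally have "fps_euler (real k * (a + b)) ((1 - fps_const (z \<bullet> w) * fps_X) *
      dunkl_series k a b z w) =
      ?R (fps_const a * ?S c (- s) + fps_const b * ?S (- c) s)"
    by (simp only: A_def fps_euler_powr_subst_cheb_base[OF k] fps_euler_rank2_series[OF a b])
  moreover have "?R (?S c (- s)) = (\<Sum>l<k. dunkl_series k a b (dih_refl k (2 * l) z) w)"
    unfolding dih_refl_eq_dih_rot_cnj sum_dunkl_series_rotations[OF k]
    by (simp add: c_def s_def cos_form_cnj sin_form_cnj norm_mult)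
  moreover have "?R (?S (- c) s) = (\<Sum>l<k. dunkl_series k a b (dih_refl k (2 * l + 1) z) w)"
    unfolding dih_refl_eq_dih_rot_cnj dih_rot_add sum_dunkl_series_rotations[OF k]
    by (simp add: c_def s_def cos_form_cnj sin_form_cnj cos_form_dih_rot sin_form_dih_rot k norm_mult
        del: One_nat_def)
  ultimately show ?thesis
    unfolding rotation_sum_add rotation_sum_const_mult[OF k] sum_lessThan_double
    by (simp add: sum.distrib sum_distrib_left dih_kappa_def)
qed

section \<open>Polynomial functions on the plane\<close>

lemma poly_repI:
  assumes "finite S" and "\<And>ij. ij \<notin> S \<Longrightarrow> c ij = 0"
    and "\<And>x. f x = (\<Sum>(i, j)\<in>S. c (i, j) * Re x ^ i * Im x ^ j)"
  shows "poly_rep c f"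
  unfolding poly_rep_def
proof (intro conjI allI)
  have support: "{ij. c ij \<noteq> 0} \<subseteq> S" using assms(2) by auto
  thus "finite {ij. c ij \<noteq> 0}" using assms(1) finite_subset by blast
  show "f x = (\<Sum>(i, j)\<in>{ij. c ij \<noteq> 0}. c (i, j) * Re x ^ i * Im x ^ j)" for x
    unfolding assms(3) by (rule sum.mono_neutral_right[OF assms(1) support]) auto
qed

lemma poly_rep_eq_sum:
  assumes "poly_rep c f" and "finite S" and "{ij. c ij \<noteq> 0} \<subseteq> S"
  shows "f x = (\<Sum>(i, j)\<in>S. c (i, j) * Re x ^ i * Im x ^ j)"
proof -
  have "f x = (\<Sum>(i, j)\<in>{ij. c ij \<noteq> 0}. c (i, j) * Re x ^ i * Im x ^ j)"
    using assms(1) by (simp add: poly_rep_def)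
  also have "\<dots> = (\<Sum>(i, j)\<in>S. c (i, j) * Re x ^ i * Im x ^ j)"
    by (rule sum.mono_neutral_left[OF assms(2,3)]) auto
  finally show ?thesis .
qed

lemma poly_rep_poly_coeffs: "polyfun p \<Longrightarrow> poly_rep (poly_coeffs p) p"
  unfolding polyfun_def poly_coeffs_def by (rule someI_ex[of "\<lambda>c. poly_rep c p"])

lemma finite_poly_coeffs: "polyfun p \<Longrightarrow> finite {ij. poly_coeffs p ij \<noteq> 0}"
  using poly_rep_poly_coeffs by (auto simp: poly_rep_def)

lemma polyfun_eq_poly_pairing: "polyfun p \<Longrightarrow> p x = poly_pairing p (\<lambda>i j. Re x ^ i * Im x ^ j)"
  using poly_rep_poly_coeffs[of p] by (simp add: poly_rep_def poly_pairing_def mult.assoc)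

lemma poly_pairing_scale: "poly_pairing p (\<lambda>i j. s * h i j) = s * poly_pairing p h"
  by (simp add: poly_pairing_def sum_distrib_left case_prod_unfold mult_ac)

lemma poly_pairing_sum: "poly_pairing p (\<lambda>i j. \<Sum>x\<in>A. h x i j) = (\<Sum>x\<in>A. poly_pairing p (h x))"
  unfolding poly_pairing_def case_prod_unfold sum_distrib_left by (rule sum.swap)

lemma polyfun_lincomb:
  assumes "polyfun f" and "polyfun g"
  shows "polyfun (\<lambda>x. s * f x + t * g x)"
proof -
  obtain c d where c: "poly_rep c f" and d: "poly_rep d g" using assms by (auto simp: polyfun_def)
  define S where "S = {ij. c ij \<noteq> 0} \<union> {ij. d ij \<noteq> 0}"
  have S: "finite S" using c d by (simp add: S_def poly_rep_def)
  have "poly_rep (\<lambda>ij. s * c ij + t * d ij) (\<lambda>x. s * f x + t * g x)"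
  proof (rule poly_repI[OF S])
    show "s * f x + t * g x = (\<Sum>(i, j)\<in>S. (s * c (i, j) + t * d (i, j)) * Re x ^ i * Im x ^ j)" for x
      using poly_rep_eq_sum[OF c S] poly_rep_eq_sum[OF d S]
      by (simp add: S_def sum_distrib_left sum.distrib[symmetric] case_prod_unfold algebra_simps)
  qed (auto simp: S_def)
  thus ?thesis by (auto simp: polyfun_def)
qed

lemma polyfun_monomial: "polyfun (\<lambda>x. Re x ^ i * Im x ^ j)"
proof -
  have "poly_rep (\<lambda>ij. if ij = (i, j) then 1 else 0) (\<lambda>x. Re x ^ i * Im x ^ j)"
    by (rule poly_repI[where S = "{(i, j)}"]) auto
  thus ?thesis by (auto simp: polyfun_def)
qed

lemma polyfun_const: "polyfun (\<lambda>x. c)"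
  using polyfun_lincomb[OF polyfun_monomial[of 0 0] polyfun_monomial[of 0 0], of c 0] by simp

lemma polyfun_sum:
  assumes "\<And>i. i \<in> I \<Longrightarrow> polyfun (f i)"
  shows "polyfun (\<lambda>x. \<Sum>i\<in>I. c i * f i x)"
  using assms
proof (induction I rule: infinite_finite_induct)
  case (insert i I)
  thus ?case using polyfun_lincomb[of "f i" _ "c i" 1] by simp
qed (simp_all add: polyfun_const)

lemma polyfun_mult:
  assumes "polyfun f" and "polyfun g"
  shows "polyfun (\<lambda>x. f x * g x)"
proof -
  define S where "S p = {ij. poly_coeffs p ij \<noteq> 0}" for p
  have "f x * g x = (\<Sum>(p, q)\<in>S f \<times> S g. (poly_coeffs f p * poly_coeffs g q) *
      (Re x ^ (fst p + fst q) * Im x ^ (snd p + snd q)))" for x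
    unfolding polyfun_eq_poly_pairing[OF assms(1), of x] polyfun_eq_poly_pairing[OF assms(2), of x]
    by (simp add: poly_pairing_def S_def sum_product sum.cartesian_product case_prod_unfold
        power_add mult_ac)
  thus ?thesis by (simp add: case_prod_unfold polyfun_sum polyfun_monomial)
qed

lemma polyfun_power: "polyfun f \<Longrightarrow> polyfun (\<lambda>x. f x ^ n)"
  by (induction n) (auto intro: polyfun_mult polyfun_const)

lemma polyfun_linear: "polyfun (\<lambda>x. s * Re x + t * Im x)"
  using polyfun_lincomb[OF polyfun_monomial[of 1 0] polyfun_monomial[of 0 1]] by simp

lemma polyfun_continuous_on:
  assumes "polyfun f"
  shows "continuous_on S f"
proof -
  have "continuous_on S (\<lambda>x. poly_pairing f (\<lambda>i j. Re x ^ i * Im x ^ j))"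
    unfolding poly_pairing_def case_prod_unfold by (intro continuous_intros)
  thus ?thesis by (simp flip: polyfun_eq_poly_pairing[OF assms])
qed

lemma poly_rep_uminus:
  assumes "poly_rep c f"
  shows "poly_rep (\<lambda>(i, j). (- 1) ^ (i + j) * c (i, j)) (\<lambda>x. f (- x))"
proof (rule poly_repI[where S = "{ij. c ij \<noteq> 0}"])
  show "f (- x) = (\<Sum>(i, j)\<in>{ij. c ij \<noteq> 0}.
      (case (i, j) of (i, j) \<Rightarrow> (- 1) ^ (i + j) * c (i, j)) * Re x ^ i * Im x ^ j)" for x
    unfolding poly_rep_eq_sum[OF assms _ order_refl, of "- x"]
    using assms by (simp add: poly_rep_def power_minus[of "Re x"] power_minus[of "Im x"]
        power_add mult_ac)
qed (use assms in \<open>auto simp: poly_rep_def\<close>)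

lemma inner_power_eq_sum:
  "(x \<bullet> w) ^ n = (\<Sum>i\<le>n. real (n choose i) * Re w ^ i * Im w ^ (n - i) * (Re x ^ i * Im x ^ (n - i)))"
proof -
  have "(x \<bullet> w) ^ n = (Re x * Re w + Im x * Im w) ^ n" by (simp add: inner_complex_def)
  thus ?thesis by (simp add: binomial_ring power_mult_distrib mult_ac)
qed

lemma homog_polyfun_inner_power: "homog_polyfun n (\<lambda>x. (x \<bullet> w) ^ n)"
proof -
  define c where "c = (\<lambda>(i, j). if i + j = n then real (n choose i) * Re w ^ i * Im w ^ j else 0)"
  define S where "S = (\<lambda>i. (i, n - i)) ` {..n}"
  have S: "S = {(i, j). i + j = n}" by (force simp: S_def)
  have "poly_rep c (\<lambda>x. (x \<bullet> w) ^ n)"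
  proof (rule poly_repI[where S = S])
    show "finite S" by (simp add: S_def)
    have "inj_on (\<lambda>i. (i, n - i)) {..n}" by (rule inj_onI) auto
    thus "(x \<bullet> w) ^ n = (\<Sum>(i, j)\<in>S. c (i, j) * Re x ^ i * Im x ^ j)" for x
      unfolding S_def by (simp add: sum.reindex inner_power_eq_sum c_def mult_ac)
  qed (auto simp: S c_def)
  thus ?thesis unfolding homog_polyfun_def by (auto simp: c_def split: if_splits)
qed

lemma homog_polyfun_imp_polyfun: "homog_polyfun n f \<Longrightarrow> polyfun f"
  by (auto simp: homog_polyfun_def polyfun_def)

lemma homog_polyfun_euler:
  assumes "homog_polyfun n q"
  shows "Re z * pderiv_dir 1 q z + Im z * pderiv_dir \<i> q z = real n * q z"
proof -
  obtain c where c: "poly_rep c q" and degree: "\<And>i j. c (i, j) \<noteq> 0 \<Longrightarrow> i + j = n"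
    using assms unfolding homog_polyfun_def by blast
  define S where "S = {ij. c ij \<noteq> 0}"
  have q: "q x = (\<Sum>p\<in>S. c p * Re x ^ fst p * Im x ^ snd p)" for x
    using c by (simp add: poly_rep_def S_def case_prod_unfold)
  have "((\<lambda>t. q (z + of_real t * 1)) has_real_derivative
      (\<Sum>p\<in>S. c p * (real (fst p) * Re z ^ (fst p - 1)) * Im z ^ snd p)) (at 0)"
    unfolding q by (auto intro!: derivative_eq_intros sum.cong simp: mult_ac)
  hence deriv_Re:
      "pderiv_dir 1 q z = (\<Sum>p\<in>S. c p * (real (fst p) * Re z ^ (fst p - 1)) * Im z ^ snd p)"
    unfolding pderiv_dir_def by (rule DERIV_imp_deriv)
  have "((\<lambda>t. q (z + of_real t * \<i>)) has_real_derivative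
      (\<Sum>p\<in>S. c p * Re z ^ fst p * (real (snd p) * Im z ^ (snd p - 1)))) (at 0)"
    unfolding q by (auto intro!: derivative_eq_intros sum.cong simp: mult_ac)
  hence deriv_Im:
      "pderiv_dir \<i> q z = (\<Sum>p\<in>S. c p * Re z ^ fst p * (real (snd p) * Im z ^ (snd p - 1)))"
    unfolding pderiv_dir_def by (rule DERIV_imp_deriv)
  have "Re z * (c p * (real (fst p) * Re z ^ (fst p - 1)) * Im z ^ snd p) +
      Im z * (c p * Re z ^ fst p * (real (snd p) * Im z ^ (snd p - 1))) =
      real n * (c p * Re z ^ fst p * Im z ^ snd p)" if "p \<in> S" for p
  proof -
    have mult_deriv: "x * (real i * x ^ (i - 1)) = real i * x ^ i" for x :: real and i
      by (cases i) auto
    have "Re z * (c p * (real (fst p) * Re z ^ (fst p - 1)) * Im z ^ snd p) +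
        Im z * (c p * Re z ^ fst p * (real (snd p) * Im z ^ (snd p - 1))) =
        c p * (Re z * (real (fst p) * Re z ^ (fst p - 1))) * Im z ^ snd p +
        c p * Re z ^ fst p * (Im z * (real (snd p) * Im z ^ (snd p - 1)))"
      by (simp only: mult_ac)
    also have "\<dots> = (real (fst p) + real (snd p)) * (c p * Re z ^ fst p * Im z ^ snd p)"
      unfolding mult_deriv by (simp add: algebra_simps)
    finally show ?thesis using degree[of "fst p" "snd p"] that by (simp add: S_def flip: of_nat_add)
  qed
  thus ?thesis
    unfolding deriv_Re deriv_Im q sum_distrib_left sum.distrib[symmetric] by (rule sum.cong[OF refl])
qed

lemma pderiv_dir_inner_power:
  "pderiv_dir e (\<lambda>x. (x \<bullet> w) ^ n) = (\<lambda>x. (real n * (e \<bullet> w)) * (x \<bullet> w) ^ (n - 1))"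
proof
  fix x
  have inner_line: "(x + of_real t * e) \<bullet> w = x \<bullet> w + t * (e \<bullet> w)" for t
    by (simp add: inner_add_left flip: scaleR_conv_of_real)
  have "((\<lambda>t. (x \<bullet> w + t * (e \<bullet> w)) ^ n)
      has_real_derivative (real n * (e \<bullet> w)) * (x \<bullet> w) ^ (n - 1)) (at 0)"
    by (auto intro!: derivative_eq_intros)
  thus "pderiv_dir e (\<lambda>x. (x \<bullet> w) ^ n) x = (real n * (e \<bullet> w)) * (x \<bullet> w) ^ (n - 1)"
    unfolding pderiv_dir_def inner_line by (rule DERIV_imp_deriv)
qed

section \<open>Euler's identity for the intertwining operator\<close>

definition off_mirrors :: "nat \<Rightarrow> complex \<Rightarrow> bool" where
  "off_mirrors k z \<longleftrightarrow> Im (z ^ (2 * k)) \<noteq> 0"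

lemma inner_dih_root_nonzero:
  assumes "k > 0" and "off_mirrors k z"
  shows "dih_root k j \<bullet> z \<noteq> 0"
proof
  assume orth: "dih_root k j \<bullet> z = 0"
  define \<psi> where "\<psi> = real j * pi / (2 * real k)"
  define x where "x = z * cis (- \<psi>)"
  have root: "dih_root k j = cis (\<psi> + pi / 2)" by (simp add: dih_root_def \<psi>_def)
  have "Im x = 0"
    using orth unfolding root x_def by (simp add: inner_complex_def cos_add sin_add algebra_simps)
  hence "x = of_real (Re x)" by (simp add: complex_eq_iff)
  moreover have "z = x * cis \<psi>" by (simp add: x_def mult.assoc cis_mult)
  ultimately have "z ^ (2 * k) = of_real (Re x) ^ (2 * k) * cis (real (2 * k) * \<psi>)"
    by (metis Complex.DeMoivre power_mult_distrib)
  also have "real (2 * k) * \<psi> = real j * pi" using assms(1) by (simp add: \<psi>_def)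
  also have "of_real (Re x) ^ (2 * k) * cis (real j * pi) = of_real (Re x ^ (2 * k) * (- 1) ^ j)"
    by (simp add: complex_eq_iff cos_npi)
  finally show False using assms(2) unfolding off_mirrors_def by (metis Im_complex_of_real)
qed

lemma dih_refl_power:
  assumes "k > 0"
  shows "dih_refl k j z ^ (2 * k) = cnj (z ^ (2 * k))"
proof -
  have "dih_refl k j z ^ (2 * k) = (dih_refl k j z ^ k)\<^sup>2" by (simp add: power_mult mult.commute)
  also have "\<dots> = (cnj z ^ k)\<^sup>2"
    unfolding dih_refl_eq_dih_rot_cnj dih_rot_power[OF assms]
    by (simp add: power_mult_distrib flip: power_mult)
  finally show ?thesis by (simp add: mult.commute flip: power_mult)
qed

lemma sum_dih_kappa: "(\<Sum>j<2 * k. dih_kappa a b j) = real k * (a + b)"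
  by (simp add: sum_lessThan_double dih_kappa_def)

lemma dunkl_euler:
  assumes "\<And>j. j < 2 * k \<Longrightarrow> dih_root k j \<bullet> z \<noteq> 0"
  shows "Re z * dunkl k a b 1 f z + Im z * dunkl k a b \<i> f z =
    Re z * pderiv_dir 1 f z + Im z * pderiv_dir \<i> f z
    + (\<Sum>j<2 * k. dih_kappa a b j * (f z - f (dih_refl k j z)))"
proof -
  define r where "r e j =
      dih_kappa a b j * (dih_root k j \<bullet> e) * (f z - f (dih_refl k j z)) / (dih_root k j \<bullet> z)"
    for e j
  have "Re z * r 1 j + Im z * r \<i> j = dih_kappa a b j * (f z - f (dih_refl k j z))"
    if "j < 2 * k" for j
  proof -
    have "Re z * r 1 j + Im z * r \<i> j = dih_kappa a b j * (f z - f (dih_refl k j z)) *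
        (Re z * (dih_root k j \<bullet> 1) + Im z * (dih_root k j \<bullet> \<i>)) / (dih_root k j \<bullet> z)"
      by (simp add: r_def algebra_simps add_divide_distrib diff_divide_distrib)
    also have "Re z * (dih_root k j \<bullet> 1) + Im z * (dih_root k j \<bullet> \<i>) = dih_root k j \<bullet> z"
      by (simp add: inner_complex_def mult.commute)
    finally show ?thesis using assms[OF that] by simp
  qed
  hence "Re z * (\<Sum>j<2 * k. r 1 j) + Im z * (\<Sum>j<2 * k. r \<i> j) =
      (\<Sum>j<2 * k. dih_kappa a b j * (f z - f (dih_refl k j z)))"
    unfolding sum_distrib_left sum.distrib[symmetric] by (intro sum.cong) auto
  thus ?thesis unfolding dunkl_def r_def[symmetric] by (simp add: algebra_simps)
qed

lemma weighted_average_eq_0: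
  fixes d :: "'a \<Rightarrow> real"
  assumes S: "finite S" and \<sigma>: "\<And>j x. j \<in> J \<Longrightarrow> x \<in> S \<Longrightarrow> \<sigma> j x \<in> S"
    and \<kappa>: "\<And>j. j \<in> J \<Longrightarrow> \<kappa> j \<ge> 0" and less: "(\<Sum>j\<in>J. \<kappa> j) < N"
    and avg: "\<And>x. x \<in> S \<Longrightarrow> N * d x = (\<Sum>j\<in>J. \<kappa> j * d (\<sigma> j x))"
    and z: "z \<in> S"
  shows "d z = 0"
proof -
  define M where "M = Max ((\<lambda>x. \<bar>d x\<bar>) ` S)"
  have "M \<in> (\<lambda>x. \<bar>d x\<bar>) ` S" unfolding M_def using S z by (intro Max_in) auto
  then obtain x where x: "x \<in> S" "M = \<bar>d x\<bar>" by auto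
  have d_le: "\<bar>d y\<bar> \<le> M" if "y \<in> S" for y unfolding M_def using S that by (intro Max_ge) auto
  have "N > 0" using sum_nonneg[of J \<kappa>] \<kappa> less by fastforce
  hence "N * M = \<bar>\<Sum>j\<in>J. \<kappa> j * d (\<sigma> j x)\<bar>" using avg[OF x(1)] x(2) by (metis abs_mult abs_of_pos)
  also have "\<dots> \<le> (\<Sum>j\<in>J. \<kappa> j * M)"
    using \<kappa> by (intro order_trans[OF sum_abs] sum_mono)
      (auto simp: abs_mult intro!: mult_left_mono d_le \<sigma> x(1))
  finally have "(N - (\<Sum>j\<in>J. \<kappa> j)) * M \<le> 0" by (simp add: left_diff_distrib sum_distrib_right)
  hence "M \<le> 0" using less by (simp add: mult_le_0_iff)
  thus "d z = 0" using d_le[OF z] by simp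
qed

locale dihedral_intertwiner =
  fixes k :: nat and a b :: real and V :: "(complex \<Rightarrow> real) \<Rightarrow> (complex \<Rightarrow> real)"
  assumes k: "k > 0" and a: "a > 0" and b: "b > 0" and V: "is_intertwiner k a b V"
begin

lemma V_lincomb:
  "polyfun f \<Longrightarrow> polyfun g \<Longrightarrow> V (\<lambda>x. s * f x + t * g x) = (\<lambda>x. s * V f x + t * V g x)"
  using V unfolding is_intertwiner_def by blast

lemma V_scale: "polyfun f \<Longrightarrow> V (\<lambda>x. s * f x) = (\<lambda>x. s * V f x)"
  using V_lincomb[of f f s 0] by simp

lemma V_sum:
  assumes "finite I" and "\<And>i. i \<in> I \<Longrightarrow> polyfun (f i)"
  shows "V (\<lambda>x. \<Sum>i\<in>I. c i * f i x) = (\<lambda>x. \<Sum>i\<in>I. c i * V (f i) x)"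
  using assms
proof (induction I rule: finite_induct)
  case empty
  show ?case using V_scale[OF polyfun_const[of 0], of 0] by simp
next
  case (insert i I)
  thus ?case using V_lincomb[of "f i" "\<lambda>x. \<Sum>i\<in>I. c i * f i x" "c i" 1] polyfun_sum[of I f c] by simp
qed

lemma V_const_1: "V (\<lambda>_. 1) = (\<lambda>_. 1)"
  using V unfolding is_intertwiner_def by blast

lemma polyfun_V: "polyfun f \<Longrightarrow> polyfun (V f)"
  using V unfolding is_intertwiner_def bij_betw_def by auto

lemma homog_polyfun_V: "homog_polyfun n f \<Longrightarrow> homog_polyfun n (V f)"
  using V unfolding is_intertwiner_def by blast

lemma dunkl_V:
  assumes "e \<in> Basis" and "polyfun f" and "off_mirrors k z"
  shows "dunkl k a b e (V f) z = V (pderiv_dir e f) z"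
  using V assms inner_dih_root_nonzero[OF k assms(3)] unfolding is_intertwiner_def by blast

lemma V_inner_power_euler:
  assumes z: "off_mirrors k z"
  shows "(real n + real k * (a + b)) * V (\<lambda>x. (x \<bullet> w) ^ n) z =
    (\<Sum>j<2 * k. dih_kappa a b j * V (\<lambda>x. (x \<bullet> w) ^ n) (dih_refl k j z))
    + real n * (z \<bullet> w) * V (\<lambda>x. (x \<bullet> w) ^ (n - 1)) z"
proof -
  let ?q = "V (\<lambda>x. (x \<bullet> w) ^ n)"
  have polyfun: "polyfun (\<lambda>x. (x \<bullet> w) ^ n)" for n
    using homog_polyfun_imp_polyfun[OF homog_polyfun_inner_power] .
  have "dunkl k a b e ?q z = (real n * (e \<bullet> w)) * V (\<lambda>x. (x \<bullet> w) ^ (n - 1)) z" if "e \<in> Basis" for e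
    unfolding dunkl_V[OF that polyfun z] pderiv_dir_inner_power using V_scale[OF polyfun] by simp
  hence "Re z * dunkl k a b 1 ?q z + Im z * dunkl k a b \<i> ?q z =
      real n * (z \<bullet> w) * V (\<lambda>x. (x \<bullet> w) ^ (n - 1)) z"
    by (simp add: Basis_complex_def inner_complex_def algebra_simps)
  moreover have "Re z * dunkl k a b 1 ?q z + Im z * dunkl k a b \<i> ?q z =
      real n * ?q z + (\<Sum>j<2 * k. dih_kappa a b j * (?q z - ?q (dih_refl k j z)))"
    unfolding dunkl_euler[OF inner_dih_root_nonzero[OF k z]]
    by (simp only: homog_polyfun_euler[OF homog_polyfun_V[OF homog_polyfun_inner_power]])
  moreover have "(\<Sum>j<2 * k. dih_kappa a b j * (?q z - ?q (dih_refl k j z))) =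
      real k * (a + b) * ?q z - (\<Sum>j<2 * k. dih_kappa a b j * ?q (dih_refl k j z))"
    by (simp add: right_diff_distrib sum_subtractf sum_dih_kappa flip: sum_distrib_right)
  ultimately show ?thesis unfolding distrib_right by linarith
qed

definition dunkl_power :: "complex \<Rightarrow> nat \<Rightarrow> complex \<Rightarrow> real" where
  "dunkl_power w n z = pochhammer (real k * (a + b) + 1) n / fact n * V (\<lambda>x. (x \<bullet> w) ^ n) z"

lemma dunkl_power_rec:
  assumes "off_mirrors k z"
  shows "(real (Suc n) + real k * (a + b)) * (dunkl_power w (Suc n) z - (z \<bullet> w) * dunkl_power w n z) =
    (\<Sum>j<2 * k. dih_kappa a b j * dunkl_power w (Suc n) (dih_refl k j z))"
proof -
  define K where "K = real k * (a + b)"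
  define P where "P n = pochhammer (K + 1) n / fact n" for n
  let ?V = "\<lambda>n. V (\<lambda>x. (x \<bullet> w) ^ n)"
  have P_Suc: "P (Suc n) * real (Suc n) = (real (Suc n) + K) * P n"
    unfolding P_def pochhammer_Suc fact_Suc by (simp add: divide_simps)
  have "P (Suc n) * ((real (Suc n) + K) * ?V (Suc n) z) =
      P (Suc n) * (\<Sum>j<2 * k. dih_kappa a b j * ?V (Suc n) (dih_refl k j z)) +
      (P (Suc n) * real (Suc n)) * ((z \<bullet> w) * ?V n z)"
    unfolding K_def V_inner_power_euler[OF assms] diff_Suc_1 by (simp only: distrib_left mult_ac)
  thus ?thesis
    unfolding dunkl_power_def K_def[symmetric] P_def[symmetric] P_Suc
    by (simp add: right_diff_distrib sum_distrib_left mult_ac del: of_nat_Suc)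
qed

lemma dunkl_series_rec:
  "(real (Suc n) + real k * (a + b)) *
      (dunkl_series k a b z w $ Suc n - (z \<bullet> w) * dunkl_series k a b z w $ n) =
    (\<Sum>j<2 * k. dih_kappa a b j * dunkl_series k a b (dih_refl k j z) w $ Suc n)"
  using arg_cong[OF fps_euler_dunkl_series[OF k a b, of z w], of "\<lambda>f. f $ Suc n"]
  by (simp add: left_diff_distrib mult.assoc fps_sum_nth del: of_nat_Suc)

lemma dunkl_power_eq_dunkl_series_nth:
  assumes "off_mirrors k z"
  shows "dunkl_power w n z = dunkl_series k a b z w $ n"
  using assms
proof (induction n arbitrary: z)
  case 0
  show ?case by (simp add: dunkl_power_def V_const_1 dunkl_series_nth_0[OF k])
next
  case (Suc n)
  define d where "d x = dunkl_power w (Suc n) x - dunkl_series k a b x w $ Suc n" for x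
  define S where "S = {x. x ^ (2 * k) = z ^ (2 * k)} \<union> {x. x ^ (2 * k) = cnj (z ^ (2 * k))}"
  have "d z = 0"
  proof (rule weighted_average_eq_0[where S = S and J = "{..<2 * k}" and \<sigma> = "dih_refl k"
        and \<kappa> = "dih_kappa a b" and N = "real (Suc n) + real k * (a + b)"])
    show "finite S" unfolding S_def using k by (intro finite_UnI finite_nth_roots) auto
    show "dih_refl k j x \<in> S" if "x \<in> S" for j x
      using that by (auto simp: S_def dih_refl_power[OF k] simp del: complex_cnj_power)
    show "(real (Suc n) + real k * (a + b)) * d x = (\<Sum>j<2 * k. dih_kappa a b j * d (dih_refl k j x))"
      if "x \<in> S" for x
    proof -
      have x: "off_mirrors k x"
        using that Suc.prems by (auto simp: S_def off_mirrors_def simp del: complex_cnj_power)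
      show ?thesis
        using dunkl_power_rec[OF x, of n w] dunkl_series_rec[of n x w] Suc.IH[OF x]
        by (simp add: d_def right_diff_distrib sum_subtractf del: of_nat_Suc)
    qed
    show "(\<Sum>j<2 * k. dih_kappa a b j) < real (Suc n) + real k * (a + b)"
      by (simp add: sum_dih_kappa)
  qed (use a b in \<open>auto simp: S_def dih_kappa_def\<close>)
  thus ?case by (simp add: d_def)
qed

end

section \<open>Averaging over the dihedral group\<close>

definition even_moments :: "real \<Rightarrow> real \<Rightarrow> nat \<Rightarrow> nat \<Rightarrow> real" where
  "even_moments a b i j = (if even i \<and> even j then rank2_moments a b i j else 0)"

lemma sum_signs_umbral_power:
  "umbral_power T X Y m + umbral_power T (- X) (- Y) m + umbral_power T X (- Y) m +
      umbral_power T (- X) Y m =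
    4 * umbral_power (\<lambda>i j. if even i \<and> even j then T i j else 0) X Y m"
  unfolding umbral_power_def sum_distrib_left sum.distrib[symmetric]
proof (intro sum.cong refl)
  fix i
  show "real (m choose i) * T i (m - i) * X ^ i * Y ^ (m - i) +
      real (m choose i) * T i (m - i) * (- X) ^ i * (- Y) ^ (m - i) +
      real (m choose i) * T i (m - i) * X ^ i * (- Y) ^ (m - i) +
      real (m choose i) * T i (m - i) * (- X) ^ i * Y ^ (m - i) =
      4 * (real (m choose i) * (if even i \<and> even (m - i) then T i (m - i) else 0) *
      X ^ i * Y ^ (m - i))"
    by (cases "even i"; cases "even (m - i)") simp_all
qed

definition even_series :: "real \<Rightarrow> real \<Rightarrow> real \<Rightarrow> real \<Rightarrow> real fps" where
  "even_series a b X Y =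
     Abs_fps (\<lambda>m. pochhammer (a + b) m / fact m * umbral_power (even_moments a b) X Y m)"

lemma pochhammer_plus_1: "c * pochhammer (c + 1) n = (c + of_nat n) * pochhammer c n"
  using pochhammer_rec[of c n] by (simp add: pochhammer_Suc mult.commute)

lemma sum_signs_rank2_series:
  "fps_const (a + b) * (rank2_series a b X Y + rank2_series a b (- X) (- Y) +
      rank2_series a b X (- Y) + rank2_series a b (- X) Y) =
    fps_const 4 * fps_euler (a + b) (even_series a b X Y)"
proof (rule fps_ext)
  fix m
  let ?U = "umbral_power (rank2_moments a b)"
  define P where "P = pochhammer (a + b + 1) m / fact m"
  have rank2_nth: "rank2_series a b X Y $ m = P * ?U X Y m" for X Y
    by (simp add: rank2_series_def P_def)
  have "(fps_const (a + b) * (rank2_series a b X Y + rank2_series a b (- X) (- Y) +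
      rank2_series a b X (- Y) + rank2_series a b (- X) Y)) $ m =
      (a + b) * P * (?U X Y m + ?U (- X) (- Y) m + ?U X (- Y) m + ?U (- X) Y m)"
    unfolding fps_mult_left_const_nth fps_add_nth rank2_nth by algebra
  also have "(a + b) * P = (a + b + real m) * pochhammer (a + b) m / fact m"
    using pochhammer_plus_1[of "a + b" m] by (simp add: P_def)
  finally show "(fps_const (a + b) * (rank2_series a b X Y + rank2_series a b (- X) (- Y) +
      rank2_series a b X (- Y) + rank2_series a b (- X) Y)) $ m =
      (fps_const 4 * fps_euler (a + b) (even_series a b X Y)) $ m"
    unfolding sum_signs_umbral_power
    by (simp add: even_series_def even_moments_def[abs_def] mult_ac add_ac)
qed

lemma umbral_power_even_moments_odd: "odd m \<Longrightarrow> umbral_power (even_moments a b) X Y m = 0"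
  unfolding umbral_power_def by (intro sum.neutral) (auto simp: even_moments_def)

lemma fps_powr_subst_even_series_nth:
  assumes k: "k > 0" and ab: "a + b > 0"
  shows "fps_powr_subst k (a + b) (cheb_base k (cmod (z * w)))
      (even_series a b (cos_form k z w) (sin_form k z w)) $ n =
    pochhammer (real k * (a + b)) n * J_homog k (a + b) (even_moments a b) z w n"
proof -
  have "pochhammer (real k * (a + b)) n > 0" using k ab by (intro pochhammer_pos) simp
  hence "even_series a b X Y $ m * fps_powr (cheb_base k r) (- (a + b + real m)) $ (n - k * m) =
      pochhammer (real k * (a + b)) n *
      (J_weight k (a + b) n m * r ^ (n - k * m) * umbral_power (even_moments a b) X Y m)" for X Y r m
    unfolding fps_powr_cheb_prod_nth_scale[of k r]
    by (cases "even m") (simp_all add: even_series_def J_weight_def umbral_power_even_moments_odd)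
  thus ?thesis
    unfolding fps_powr_subst_nth[OF cheb_prod_nth_0 k] J_homog_def sum_distrib_left by simp
qed

definition dih_elem :: "nat \<Rightarrow> nat \<Rightarrow> complex \<Rightarrow> complex" where
  "dih_elem k j z = (if even j then dih_rot k (j div 2) z else cnj (dih_rot k (j div 2) z))"

definition dih_elem_adj :: "nat \<Rightarrow> nat \<Rightarrow> complex \<Rightarrow> complex" where
  "dih_elem_adj k j w = (if even j then w else cnj w) * cis (- (real (j div 2) * pi / real k))"

lemma inner_dih_elem: "dih_elem k j z \<bullet> w = z \<bullet> dih_elem_adj k j w"
  by (simp add: dih_elem_def dih_elem_adj_def dih_rot_def inner_complex_def algebra_simps)

lemma dunkl_series_dih_elem_adj_even:
  assumes "k > 0"
  shows "dunkl_series k a b z (dih_elem_adj k (2 * j) w) = dunkl_series k a b (dih_rot k j z) w"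
proof -
  have "cis (- (real j * pi)) = of_real ((- 1) ^ j)" by (simp add: complex_eq_iff cos_npi)
  hence "dih_elem_adj k (2 * j) w ^ k = of_real ((- 1) ^ j) * w ^ k"
    using assms by (simp add: dih_elem_adj_def power_mult_distrib Complex.DeMoivre)
  hence "cos_form k z (dih_elem_adj k (2 * j) w) = cos_form k (dih_rot k j z) w"
    and "sin_form k z (dih_elem_adj k (2 * j) w) = sin_form k (dih_rot k j z) w"
    by (simp_all add: cos_form_dih_rot sin_form_dih_rot assms)
        (simp_all add: cos_form_def sin_form_def)
  moreover have "cmod (z * dih_elem_adj k (2 * j) w) = cmod (dih_rot k j z * w)"
    by (simp add: dih_elem_adj_def norm_mult)
  moreover have "dih_rot k i z \<bullet> dih_elem_adj k (2 * j) w = dih_rot k i (dih_rot k j z) \<bullet> w" for i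
    unfolding dih_rot_add[symmetric] add.commute[of i j]
    by (simp add: dih_rot_add inner_dih_elem[symmetric]) (simp add: dih_elem_def)
  ultimately show ?thesis by (simp only: dunkl_series_def)
qed

lemma dih_elem_adj_odd: "dih_elem_adj k (2 * j + 1) w = dih_elem_adj k (2 * j) (cnj w)"
  by (simp add: dih_elem_adj_def)

lemma sum_dunkl_series_dihedral:
  assumes k: "k > 0"
  shows "fps_const (a + b) * (\<Sum>j<2 * (2 * k). dunkl_series k a b z (dih_elem_adj k j w)) =
    fps_const 4 * fps_euler (real k * (a + b)) (fps_powr_subst k (a + b) (cheb_base k (cmod (z * w)))
      (even_series a b (cos_form k z w) (sin_form k z w)))"
proof -
  define c where "c = cos_form k z w"
  define s where "s = sin_form k z w"
  let ?S = "rank2_series a b"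
  let ?R = "rotation_sum k (a + b) (cmod (z * w))"
  have cnj_right: "cos_form k x (cnj w) = cos_form k x w"
    "sin_form k x (cnj w) = - sin_form k x w" for x
    by (simp_all add: cos_form_def sin_form_def flip: complex_cnj_power)
  have rotations:
    "(\<Sum>l<k. dunkl_series k a b (dih_rot k (2 * l + i) z) w) =
        ?R (?S ((- 1) ^ i * c) ((- 1) ^ i * s))"
    "(\<Sum>l<k. dunkl_series k a b (dih_rot k (2 * l + i) z) (cnj w)) =
        ?R (?S ((- 1) ^ i * c) (- ((- 1) ^ i * s)))" for i
    unfolding dih_rot_add sum_dunkl_series_rotations[OF k]
    by (simp_all add: c_def s_def cos_form_dih_rot sin_form_dih_rot k cnj_right norm_mult)
  have "(\<Sum>j<2 * (2 * k). dunkl_series k a b z (dih_elem_adj k j w)) =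
      (\<Sum>j<2 * k. dunkl_series k a b (dih_rot k j z) w + dunkl_series k a b (dih_rot k j z) (cnj w))"
    unfolding sum_lessThan_double[of _ "2 * k"] dih_elem_adj_odd
        dunkl_series_dih_elem_adj_even[OF k] ..
  also have "\<dots> = ?R (?S c s + ?S (- c) (- s) + ?S c (- s) + ?S (- c) s)"
    unfolding sum_lessThan_double sum.distrib rotation_sum_add rotations
    using rotations[of 0] by simp
  finally have "fps_const (a + b) * (\<Sum>j<2 * (2 * k). dunkl_series k a b z (dih_elem_adj k j w)) =
      ?R (fps_const (a + b) * (?S c s + ?S (- c) (- s) + ?S c (- s) + ?S (- c) s))"
    by (simp only: rotation_sum_const_mult[OF k])
  thus ?thesis
    by (simp only: sum_signs_rank2_series rotation_sum_const_mult[OF k]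
        fps_euler_powr_subst_cheb_base[OF k] c_def s_def)
qed

lemma sum_dunkl_series_dihedral_nth:
  assumes "k > 0" and "a + b > 0"
  shows "(a + b) * (\<Sum>j<2 * (2 * k). dunkl_series k a b z (dih_elem_adj k j w) $ n) =
    4 * (real n + real k * (a + b)) * pochhammer (real k * (a + b)) n *
    J_homog k (a + b) (even_moments a b) z w n"
proof -
  have "(a + b) * (\<Sum>j<2 * (2 * k). dunkl_series k a b z (dih_elem_adj k j w) $ n) =
      (fps_const (a + b) * (\<Sum>j<2 * (2 * k). dunkl_series k a b z (dih_elem_adj k j w))) $ n"
    by (simp only: fps_mult_left_const_nth fps_sum_nth)
  thus ?thesis
    unfolding sum_dunkl_series_dihedral[OF assms(1)] fps_mult_left_const_nth fps_euler_nth
      fps_powr_subst_even_series_nth[OF assms] by (simp only: mult.assoc)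
qed

lemma polyfun_dih_elem_monomial: "polyfun (\<lambda>x. Re (dih_elem k j x) ^ i * Im (dih_elem k j x) ^ l)"
proof -
  define t where "t = real (j div 2) * pi / real k"
  have "Re (dih_elem k j x) = cos t * Re x + (- sin t) * Im x"
    "Im (dih_elem k j x) = (if even j then sin t else - sin t) * Re x +
        (if even j then cos t else - cos t) * Im x" for x
    by (simp_all add: dih_elem_def dih_rot_def t_def mult.commute)
  thus ?thesis by (simp only: polyfun_mult polyfun_power polyfun_linear)
qed

lemma invariant_dih_elem:
  assumes k: "k > 0" and inv: "\<And>j z. j < 2 * k \<Longrightarrow> p (dih_refl k j z) = p z" and j: "j < 2 * (2 * k)"
  shows "p (dih_elem k j x) = p x"
proof -
  have cnj: "p (cnj z) = p z" for z using inv[of 0 z] k by (simp add: dih_refl_def)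
  have "p (dih_rot k (j div 2) x) = p x"
    using inv[of "j div 2" "cnj x"] j
    by (simp add: dih_refl_eq_dih_rot_cnj cnj less_mult_imp_div_less)
  thus ?thesis by (simp add: dih_elem_def cnj)
qed

lemma binary_form_coeff_eq:
  fixes c d :: "nat \<Rightarrow> real"
  assumes "\<And>w. (\<Sum>i\<le>n. c i * Re w ^ i * Im w ^ (n - i)) = (\<Sum>i\<le>n. d i * Re w ^ i * Im w ^ (n - i))"
    and "i \<le> n"
  shows "c i = d i"
proof -
  have "(\<Sum>i\<le>n. (c i - d i) * x ^ i) = 0" for x
    using assms(1)[of "Complex x 1"] by (simp add: left_diff_distrib sum_subtractf)
  hence "c i - d i = 0" using assms(2) polyfun_eq_0[of "\<lambda>i. c i - d i" n] by blast
  thus ?thesis by simp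
qed

lemma continuous_on_J_coeff: "continuous_on S (\<lambda>z. J_coeff k l T z i j)"
  unfolding J_coeff_def mixed_monomial_def by (intro continuous_intros)

lemma continuous_on_poly_pairing:
  assumes "\<And>i j. continuous_on S (\<lambda>z. h z i j)"
  shows "continuous_on S (\<lambda>z. poly_pairing p (h z))"
  unfolding poly_pairing_def case_prod_unfold by (intro continuous_intros assms)

lemma off_mirrors_rotate:
  assumes "k > 0" and "z \<noteq> 0" and "\<not> off_mirrors k z" and "0 < t" and "t < pi"
  shows "off_mirrors k (z * cis (t / (2 * real k)))"
proof -
  have real: "z ^ (2 * k) = of_real (Re (z ^ (2 * k)))"
    using assms(3) by (simp add: off_mirrors_def complex_eq_iff)
  hence "Re (z ^ (2 * k)) \<noteq> 0" using assms(1,2) by (metis of_real_0 power_eq_0_iff)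
  moreover have "(z * cis (t / (2 * real k))) ^ (2 * k) = of_real (Re (z ^ (2 * k))) * cis t"
    using assms(1) by (subst real[symmetric]) (simp add: power_mult_distrib Complex.DeMoivre)
  moreover have "sin t > 0" using assms(4,5) by (intro sin_gt_zero)
  ultimately show ?thesis by (simp add: off_mirrors_def)
qed

lemma closure_off_mirrors:
  assumes "k > 0"
  shows "closure (Collect (off_mirrors k)) = UNIV"
proof -
  have nonzero: "z \<in> closure (Collect (off_mirrors k))" if "z \<noteq> 0" for z
  proof (cases "off_mirrors k z")
    case False
    define y where "y n = z * cis (inverse (real (Suc n)) / (2 * real k))" for n
    have "y n \<in> Collect (off_mirrors k)" for n
    proof -
      have "inverse (real (Suc n)) \<le> 1" by (simp add: inverse_le_1_iff)
      hence "inverse (real (Suc n)) < pi" using pi_gt3 by linarith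
      thus ?thesis unfolding y_def mem_Collect_eq
        by (intro off_mirrors_rotate[OF assms that False]) auto
    qed
    moreover have "y \<longlonglongrightarrow> z"
    proof -
      have "(\<lambda>n. inverse (real (Suc n)) / (2 * real k)) \<longlonglongrightarrow> 0"
        by (rule tendsto_divide_zero[OF LIMSEQ_inverse_real_of_nat])
      hence "y \<longlonglongrightarrow> z * cis 0" unfolding y_def by (intro tendsto_intros)
      thus ?thesis by simp
    qed
    ultimately show ?thesis unfolding closure_sequential by blast
  qed (use closure_subset[of "Collect (off_mirrors k)"] in blast)
  hence "closure (- {0}) \<subseteq> closure (Collect (off_mirrors k))"
    by (intro closure_minimal) auto
  thus ?thesis by (auto simp: closure_complement)
qed

context dihedral_intertwiner
begin

lemma V_inner_power_dih_elem:
  "V (\<lambda>x. (x \<bullet> dih_elem_adj k j w) ^ n) z =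
    (\<Sum>i\<le>n. (real (n choose i) * Re w ^ i * Im w ^ (n - i)) *
      V (\<lambda>x. Re (dih_elem k j x) ^ i * Im (dih_elem k j x) ^ (n - i)) z)"
  unfolding inner_dih_elem[symmetric] inner_power_eq_sum
  by (simp only: V_sum[OF finite_atMost polyfun_dih_elem_monomial])

lemma sum_V_inner_power_dihedral:
  assumes "off_mirrors k z"
  shows "(\<Sum>j<2 * (2 * k). V (\<lambda>x. (x \<bullet> dih_elem_adj k j w) ^ n) z) / fact n =
    4 * real k * J_homog k (a + b) (even_moments a b) z w n"
proof -
  define K where "K = real k * (a + b)"
  define P where "P = pochhammer (K + 1) n"
  define J where "J = J_homog k (a + b) (even_moments a b) z w n"
  have pos: "a + b > 0" "P > 0"
    using a b by (auto simp: P_def K_def intro!: pochhammer_pos add_nonneg_pos)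
  have "((a + b) * P) * ((\<Sum>j<2 * (2 * k). V (\<lambda>x. (x \<bullet> dih_elem_adj k j w) ^ n) z) / fact n) =
      (a + b) * (\<Sum>j<2 * (2 * k). dunkl_power (dih_elem_adj k j w) n z)"
    by (simp add: dunkl_power_def P_def K_def sum_distrib_left sum_divide_distrib mult_ac)
  also have "\<dots> = 4 * ((K + real n) * pochhammer K n) * J"
    unfolding dunkl_power_eq_dunkl_series_nth[OF assms] sum_dunkl_series_dihedral_nth[OF k pos(1)]
    by (simp add: K_def J_def add.commute)
  also have "\<dots> = ((a + b) * P) * (4 * real k * J)"
    unfolding pochhammer_plus_1[symmetric] by (simp add: P_def K_def)
  finally show ?thesis
    unfolding J_def by (rule mult_left_cancel[THEN iffD1, rotated]) (use pos in simp)
qed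

lemma J_coeff_eq_dihedral_average:
  assumes "off_mirrors k z"
  shows "4 * real k * J_coeff k (a + b) (even_moments a b) z i l =
    (\<Sum>j<2 * (2 * k). V (\<lambda>x. Re (dih_elem k j x) ^ i * Im (dih_elem k j x) ^ l) z)"
proof -
  define M where "M i l =
      (\<Sum>j<2 * (2 * k). V (\<lambda>x. Re (dih_elem k j x) ^ i * Im (dih_elem k j x) ^ l) z)" for i l
  let ?c = "J_coeff k (a + b) (even_moments a b) z"
  have "(\<Sum>i\<le>n. M i (n - i) / (fact i * fact (n - i)) * Re w ^ i * Im w ^ (n - i)) =
      (\<Sum>i\<le>n. 4 * real k * ?c i (n - i) / (fact i * fact (n - i)) * Re w ^ i * Im w ^ (n - i))" for n w
  proof -
    have "(\<Sum>j<2 * (2 * k). V (\<lambda>x. (x \<bullet> dih_elem_adj k j w) ^ n) z) / fact n =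
        (\<Sum>i\<le>n. real (n choose i) * Re w ^ i * Im w ^ (n - i) * M i (n - i)) / fact n"
      unfolding V_inner_power_dih_elem M_def sum_distrib_left by (subst sum.swap) simp
    also have "\<dots> = (\<Sum>i\<le>n. M i (n - i) / (fact i * fact (n - i)) * Re w ^ i * Im w ^ (n - i))"
      unfolding sum_divide_distrib by (intro sum.cong refl) (simp add: binomial_fact)
    finally show ?thesis
      unfolding sum_V_inner_power_dihedral[OF assms] J_homog_eq_sum_J_coeff[OF k]
      by (simp add: sum_distrib_left mult_ac)
  qed
  from binary_form_coeff_eq[OF this, of i "i + l"] show ?thesis by (simp add: M_def)
qed

lemma V_compose_dih_elem:
  assumes "polyfun p"
  shows "V (\<lambda>x. p (dih_elem k j x)) z =
    poly_pairing p (\<lambda>i l. V (\<lambda>x. Re (dih_elem k j x) ^ i * Im (dih_elem k j x) ^ l) z)"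
proof -
  have "V (\<lambda>x. p (dih_elem k j x)) =
      V (\<lambda>x. \<Sum>ij\<in>{ij. poly_coeffs p ij \<noteq> 0}. poly_coeffs p ij *
        (Re (dih_elem k j x) ^ fst ij * Im (dih_elem k j x) ^ snd ij))"
    by (subst polyfun_eq_poly_pairing[OF assms]) (simp add: poly_pairing_def case_prod_unfold)
  thus ?thesis
    by (simp only: V_sum[OF finite_poly_coeffs[OF assms] polyfun_dih_elem_monomial])
       (simp add: poly_pairing_def case_prod_unfold)
qed

lemma V_invariant_off_mirrors:
  assumes p: "polyfun p" and inv: "\<And>j z. j < 2 * k \<Longrightarrow> p (dih_refl k j z) = p z"
    and z: "off_mirrors k z"
  shows "V p z = poly_pairing p (J_coeff k (a + b) (even_moments a b) z)"
proof -
  have "4 * real k * V p z = (\<Sum>j<2 * (2 * k). V (\<lambda>x. p (dih_elem k j x)) z)"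
    by (simp add: invariant_dih_elem[OF k inv])
  also have "\<dots> = 4 * real k * poly_pairing p (J_coeff k (a + b) (even_moments a b) z)"
    unfolding V_compose_dih_elem[OF p] poly_pairing_sum[symmetric] poly_pairing_scale[symmetric]
      J_coeff_eq_dihedral_average[OF z] ..
  finally show ?thesis using k by simp
qed

lemma V_invariant:
  assumes p: "polyfun p" and inv: "\<And>j z. j < 2 * k \<Longrightarrow> p (dih_refl k j z) = p z"
  shows "V p z = poly_pairing p (J_coeff k (a + b) (even_moments a b) z)"
proof -
  define F where "F z = V p z - poly_pairing p (J_coeff k (a + b) (even_moments a b) z)" for z
  have "continuous_on (closure (Collect (off_mirrors k))) F"
    unfolding F_def
    by (intro continuous_intros continuous_on_poly_pairing continuous_on_J_coeff
        polyfun_continuous_on polyfun_V p)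
  moreover have "F z = 0" if "z \<in> Collect (off_mirrors k)" for z
    using V_invariant_off_mirrors[OF p inv] that by (simp add: F_def)
  moreover have "z \<in> closure (Collect (off_mirrors k))" unfolding closure_off_mirrors[OF k] by simp
  ultimately have "F z = 0" by (rule continuous_constant_on_closure)
  thus ?thesis by (simp add: F_def)
qed

end

section \<open>Integration against the beta measures\<close>

definition nu_density :: "real \<Rightarrow> real \<Rightarrow> real" where
  "nu_density b v = nu_const b * (1 - v\<^sup>2) powr (b - 1)"

lemma Gamma_duplication_real:
  fixes b :: real
  assumes "b > 0"
  shows "Gamma b * Gamma (b + 1 / 2) = 2 powr (1 - 2 * b) * sqrt pi * Gamma (2 * b)"
proof -
  have pos_notin: "x \<notin> \<int>\<^sub>\<le>\<^sub>0" if "x > 0" for x :: real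
    using that by (auto elim!: nonpos_Ints_cases)
  have "complex_of_real b \<notin> \<int>\<^sub>\<le>\<^sub>0" and "complex_of_real (b + 1 / 2) \<notin> \<int>\<^sub>\<le>\<^sub>0"
    unfolding of_real_in_nonpos_Ints_iff using assms by (auto intro!: pos_notin)
  hence "Gamma (complex_of_real b) * Gamma (complex_of_real b + 1 / 2) =
      exp ((1 - 2 * complex_of_real b) * of_real (ln 2)) * of_real (sqrt pi) *
      Gamma (2 * complex_of_real b)"
    by (intro Gamma_legendre_duplication) simp_all
  moreover have "complex_of_real b + 1 / 2 = of_real (b + 1 / 2)"
    "2 * complex_of_real b = of_real (2 * b)"
    "(1 - of_real (2 * b)) * complex_of_real (ln 2) = of_real ((1 - 2 * b) * ln 2)"
    by simp_all
  ultimately have "Gamma b * Gamma (b + 1 / 2) = exp ((1 - 2 * b) * ln 2) * sqrt pi * Gamma (2 * b)"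
    by (simp only: Gamma_complex_of_real exp_of_real of_real_mult[symmetric] of_real_eq_iff)
  thus ?thesis by (simp add: powr_def mult.commute)
qed

lemma nu_const_mult_Beta:
  assumes b: "b > 0"
  shows "nu_const b * 4 powr (b - 1) * (2 * Beta b b) = 1"
proof -
  have Gamma_pos: "Gamma b > 0" "Gamma (2 * b) > 0" using b by (auto intro: Gamma_real_pos)
  have "4 powr (b - 1) = (2 powr 2) powr (b - 1)" by simp
  hence four_powr: "4 powr (b - 1) = 2 powr (2 * (b - 1))" by (simp only: powr_powr)
  have "nu_const b * 4 powr (b - 1) * (2 * Beta b b) =
      (Gamma b * Gamma (b + 1 / 2)) * (2 * 4 powr (b - 1)) / (sqrt pi * Gamma (2 * b))"
    using Gamma_pos by (simp add: nu_const_def Beta_def field_simps)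
  also have "\<dots> = 2 powr 1 * 2 powr (2 * (b - 1)) * 2 powr (1 - 2 * b)"
    unfolding Gamma_duplication_real[OF b] four_powr using Gamma_pos by simp
  also have "\<dots> = 1" unfolding powr_add[symmetric] by (simp add: algebra_simps)
  finally show ?thesis .
qed

lemma nu_density_has_integral_1:
  assumes b: "b > 0"
  shows "(nu_density b has_integral 1) {-1..1}"
proof -
  define B where "B x = (x / 2 + 1 / 2) powr (b - 1) * (1 - (x / 2 + 1 / 2)) powr (b - 1)" for x
  have "((\<lambda>t. t powr (b - 1) * (1 - t) powr (b - 1)) has_integral Beta b b) (cbox 0 1)"
    using has_integral_Beta_real[OF b b] by simp
  from has_integral_affinity'[OF this, of "1 / 2" "1 / 2"]
  have "(B has_integral 2 * Beta b b) {-1..1}" by (simp add: B_def[abs_def])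
  from has_integral_mult_right[OF this, of "nu_const b * 4 powr (b - 1)"]
  have "((\<lambda>x. nu_const b * 4 powr (b - 1) * B x) has_integral 1) {-1..1}"
    unfolding nu_const_mult_Beta[OF b] .
  moreover have "nu_const b * 4 powr (b - 1) * B x = nu_density b x" if "x \<in> {-1..1}" for x
  proof -
    have "4 powr (b - 1) * B x = (4 * ((x / 2 + 1 / 2) * (1 - (x / 2 + 1 / 2)))) powr (b - 1)"
      unfolding B_def using that
      by (subst powr_mult, simp, simp, subst powr_mult) (auto simp: field_simps)
    also have "4 * ((x / 2 + 1 / 2) * (1 - (x / 2 + 1 / 2))) = 1 - x\<^sup>2"
      by (simp add: field_simps power2_eq_square)
    finally show ?thesis by (simp add: nu_density_def)
  qed
  ultimately show ?thesis by (rule has_integral_eq[rotated])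
qed

lemma nu_density_measurable [measurable]: "nu_density b \<in> borel_measurable borel"
  unfolding nu_density_def by measurable

lemma nu_density_nonneg: "b > 0 \<Longrightarrow> nu_density b v \<ge> 0"
  unfolding nu_density_def nu_const_def
  by (intro mult_nonneg_nonneg divide_nonneg_nonneg less_imp_le[OF Gamma_real_pos]) auto

lemma set_integrable_nu_density_power:
  assumes b: "b > 0"
  shows "set_integrable lborel {-1..1} (\<lambda>v. nu_density b v * v ^ n)"
proof -
  have "nu_density b absolutely_integrable_on {-1..1}"
    using nu_density_has_integral_1[OF b] nu_density_nonneg[OF b]
    by (intro nonnegative_absolutely_integrable_1) (auto simp: integrable_on_def)
  hence "set_integrable lborel {-1..1} (nu_density b)"
    unfolding set_integrable_def by (subst (asm) integrable_completion) auto
  thus ?thesis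
  proof (rule set_integrable_bound)
    show "set_borel_measurable lborel {- 1..1} (\<lambda>v. nu_density b v * v ^ n)"
      unfolding set_borel_measurable_def by measurable
    show "AE v in lborel. v \<in> {- 1..1} \<longrightarrow> norm (nu_density b v * v ^ n) \<le> norm (nu_density b v)"
      using nu_density_nonneg[OF b]
      by (intro AE_I2 impI) (auto simp: abs_mult power_abs mult_left_le power_le_one abs_le_iff)
  qed
qed

lemma nu_density_deriv_has_integral_0:
  assumes b: "b > 0"
  shows "((\<lambda>v. (real n * v ^ (n - 1) * (1 - v\<^sup>2) - 2 * b * v ^ (n + 1)) * nu_density b v)
      has_integral 0) {-1..1}"
proof -
  let ?F = "\<lambda>v. nu_const b * (v ^ n * (1 - v\<^sup>2) powr b)"
  let ?f = "\<lambda>v. (real n * v ^ (n - 1) * (1 - v\<^sup>2) - 2 * b * v ^ (n + 1)) * nu_density b v"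
  have "(?f has_integral (?F 1 - ?F (- 1))) {-1..1}"
  proof (rule fundamental_theorem_of_calculus_interior)
    have "v\<^sup>2 \<le> 1" if "v \<in> {-1..1}" for v :: real using that by (simp add: abs_square_le_1 abs_le_iff)
    thus "continuous_on {- 1..1} ?F"
      using b by (intro continuous_intros continuous_on_powr') auto
    fix v :: real assume v: "v \<in> {-1<..<1}"
    have pos: "1 - v\<^sup>2 > 0" using v by (simp add: abs_square_less_1 abs_less_iff)
    hence powr: "(1 - v\<^sup>2) powr b = (1 - v\<^sup>2) * (1 - v\<^sup>2) powr (b - 1)"
      by (simp add: powr_diff)
    have "(?F has_real_derivative nu_const b * (real n * v ^ (n - 1) * (1 - v\<^sup>2) powr b +
        v ^ n * (b * (1 - v\<^sup>2) powr (b - 1) * (- 2 * v)))) (at v)"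
      using pos by (auto intro!: derivative_eq_intros simp: algebra_simps)
    also have "nu_const b * (real n * v ^ (n - 1) * (1 - v\<^sup>2) powr b +
        v ^ n * (b * (1 - v\<^sup>2) powr (b - 1) * (- 2 * v))) = ?f v"
      unfolding powr nu_density_def by (simp add: algebra_simps)
    finally show "(?F has_vector_derivative ?f v) (at v)"
      by (simp add: has_real_derivative_iff_has_vector_derivative)
  qed simp
  thus ?thesis using b by simp
qed

definition nu_moment :: "real \<Rightarrow> nat \<Rightarrow> real" where
  "nu_moment b n = (LINT v:{-1..1}|lborel. nu_density b v * v ^ n)"

lemma nu_moment_has_integral:
  assumes "b > 0"
  shows "((\<lambda>v. nu_density b v * v ^ n) has_integral nu_moment b n) {-1..1}"
  unfolding nu_moment_def
      set_borel_integral_eq_integral(2)[OF set_integrable_nu_density_power[OF assms]]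
  using set_borel_integral_eq_integral(1)[OF set_integrable_nu_density_power[OF assms]]
  by (rule integrable_integral)

lemma nu_moment_0: "b > 0 \<Longrightarrow> nu_moment b 0 = 1"
  using has_integral_unique[OF nu_moment_has_integral[of b 0]] nu_density_has_integral_1[of b] by simp

lemma nu_moment_1:
  assumes "b > 0"
  shows "nu_moment b 1 = 0"
proof -
  have "((\<lambda>v. (- 2 * b) * (nu_density b v * v ^ 1)) has_integral 0) {-1..1}"
    using nu_density_deriv_has_integral_0[OF assms, of 0] by (simp add: mult_ac)
  hence "(- 2 * b) * nu_moment b 1 = 0"
    by (rule has_integral_unique[OF has_integral_mult_right[OF nu_moment_has_integral[OF assms]]])
  thus ?thesis using assms by simp
qed

lemma nu_moment_Suc_Suc:
  assumes b: "b > 0"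
  shows "(real n + 1 + 2 * b) * nu_moment b (Suc (Suc n)) = (real n + 1) * nu_moment b n"
proof -
  let ?f = "\<lambda>v. (real n + 1) * (nu_density b v * v ^ n) -
      (real n + 1 + 2 * b) * (nu_density b v * v ^ Suc (Suc n))"
  have "(?f has_integral
      (real n + 1) * nu_moment b n - (real n + 1 + 2 * b) * nu_moment b (Suc (Suc n))) {-1..1}"
    by (intro has_integral_diff has_integral_mult_right nu_moment_has_integral b)
  moreover have "(?f has_integral 0) {-1..1}"
  proof -
    have "(real (n + 1) * v ^ (n + 1 - 1) * (1 - v\<^sup>2) - 2 * b * v ^ (n + 1 + 1)) *
        nu_density b v = ?f v" for v
      by (simp add: power2_eq_square algebra_simps)
    thus ?thesis using nu_density_deriv_has_integral_0[OF b, of "n + 1"] by simp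
  qed
  ultimately have
    "(real n + 1) * nu_moment b n - (real n + 1 + 2 * b) * nu_moment b (Suc (Suc n)) = 0"
    by (rule has_integral_unique)
  thus ?thesis by simp
qed

lemma nu_moment_eq:
  assumes b: "b > 0"
  shows "nu_moment b n = (if even n then rank1_coeff b n else 0)"
proof (induction n rule: induct_nat_012)
  case (ge2 n)
  have pos: "real n + 1 + 2 * b > 0" using b by simp
  hence "nu_moment b (Suc (Suc n)) = (real n + 1) / (real n + 1 + 2 * b) * nu_moment b n"
    using nu_moment_Suc_Suc[OF b, of n] by (simp add: field_simps)
  moreover have "rank1_coeff b (Suc (Suc n)) =
      (real n + 1) / (real n + 1 + 2 * b) * rank1_coeff b n" if "even n"
    using that by (simp add: add.commute mult.commute)
  ultimately show ?case using ge2.IH(1) by simp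
qed (use nu_moment_0[OF b] nu_moment_1[OF b] in simp_all)

lemma nu_density_integral_sum:
  assumes b: "b > 0"
  shows "(LINT v:{-1..1}|lborel. nu_density b v * (\<Sum>x\<in>I. q x * v ^ n x)) =
      (\<Sum>x\<in>I. q x * nu_moment b (n x))"
proof -
  have "(LINT v:{-1..1}|lborel. nu_density b v * (\<Sum>x\<in>I. q x * v ^ n x)) =
      (LINT v|lborel. (\<Sum>x\<in>I. q x * (indicator {-1..1} v *\<^sub>R (nu_density b v * v ^ n x))))"
    unfolding set_lebesgue_integral_def by (simp add: sum_distrib_left sum_distrib_right mult_ac)
  also have "\<dots> = (\<Sum>x\<in>I. q x * nu_moment b (n x))"
    unfolding nu_moment_def set_lebesgue_integral_def
    using set_integrable_nu_density_power[OF b] unfolding set_integrable_def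
    by (subst Bochner_Integration.integral_sum) auto
  finally show ?thesis .
qed

lemma nu_density_double_integral_sum:
  assumes a: "a > 0" and b: "b > 0"
  shows "(LINT v:{-1..1}|lborel. nu_density b v *
      (LINT u:{-1..1}|lborel. nu_density a u * (\<Sum>x\<in>I. q x * (v ^ i x * u ^ j x)))) =
    (\<Sum>x\<in>I. q x * even_moments a b (i x) (j x))"
proof -
  have "(LINT u:{-1..1}|lborel. nu_density a u * (\<Sum>x\<in>I. q x * (v ^ i x * u ^ j x))) =
      (\<Sum>x\<in>I. (q x * nu_moment a (j x)) * v ^ i x)" for v
    using nu_density_integral_sum[OF a, where I = I and q = "\<lambda>x. q x * v ^ i x" and n = j]
    by (simp add: mult_ac)
  hence "(LINT v:{-1..1}|lborel. nu_density b v *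
      (LINT u:{-1..1}|lborel. nu_density a u * (\<Sum>x\<in>I. q x * (v ^ i x * u ^ j x)))) =
      (\<Sum>x\<in>I. (q x * nu_moment a (j x)) * nu_moment b (i x))"
    by (simp only: nu_density_integral_sum[OF b])
  also have "\<dots> = (\<Sum>x\<in>I. q x * even_moments a b (i x) (j x))"
    by (intro sum.cong refl) (simp add: nu_moment_eq a b even_moments_def rank2_moments_def)
  finally show ?thesis .
qed

lemma poly_pairing_J_coeff_linear:
  assumes "polyfun p"
  obtains I :: "((nat \<times> nat) \<times> nat \<times> nat) set" and q i j
    where "finite I" and "\<And>T. poly_pairing p (J_coeff k l T z) = (\<Sum>x\<in>I. q x * T (i x) (j x))"
proof -
  define S where "S = {ij. poly_coeffs p ij \<noteq> 0}"
  define M where "M ij = (SIGMA m:{..(fst ij + snd ij) div k}. {..m})" for ij :: "nat \<times> nat"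
  define q where "q = (\<lambda>(ij, m, s). poly_coeffs p ij * (fact (fst ij) * fact (snd ij) *
    (J_weight k l (fst ij + snd ij) m * (2 * (1 / 2) ^ k) ^ m * real (m choose s) *
     mixed_monomial k (fst ij + snd ij) m s z *
     form_coeff (fst ij + snd ij) (mixed_monomial k (fst ij + snd ij) m s) (fst ij))))"
  have "finite S" unfolding S_def by (rule finite_poly_coeffs[OF assms])
  hence finite: "finite (SIGMA ij:S. M ij)" by (auto simp: M_def)
  have "poly_pairing p (J_coeff k l T z) =
      (\<Sum>ij\<in>S. \<Sum>m\<le>(fst ij + snd ij) div k. \<Sum>s\<le>m. q (ij, m, s) * T s (m - s))" for T
    unfolding poly_pairing_def S_def[symmetric] case_prod_unfold J_coeff_def q_def prod.sel
    by (simp add: sum_distrib_left mult_ac)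
  hence "poly_pairing p (J_coeff k l T z) =
      (\<Sum>x\<in>(SIGMA ij:S. M ij). q x * T (snd (snd x)) (fst (snd x) - snd (snd x)))" for T
    using \<open>finite S\<close> by (simp add: sum.Sigma M_def case_prod_unfold)
  with finite show ?thesis by (rule that)
qed

lemma double_integral_p_uv:
  assumes k: "k > 0" and a: "a > 0" and b: "b > 0" and p: "polyfun p"
  shows "(LINT v:{-1..1}|lborel. nu_density b v *
      (LINT u:{-1..1}|lborel. nu_density a u * p_uv k a b p u v z)) =
    poly_pairing p (J_coeff k (a + b) (even_moments a b) z)"
proof -
  obtain I :: "((nat \<times> nat) \<times> nat \<times> nat) set" and q i j
    where linear: "\<And>T. poly_pairing p (J_coeff k (a + b) T z) = (\<Sum>x\<in>I. q x * T (i x) (j x))"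
    using poly_pairing_J_coeff_linear[OF p] by metis
  have "(LINT v:{-1..1}|lborel. nu_density b v *
      (LINT u:{-1..1}|lborel. nu_density a u * p_uv k a b p u v z)) =
      (LINT v:{-1..1}|lborel. nu_density b v *
        (LINT u:{-1..1}|lborel. nu_density a u * (\<Sum>x\<in>I. q x * (v ^ i x * u ^ j x))))"
  proof (intro set_lebesgue_integral_cong ballI arg_cong2[where f = "(*)"] refl allI impI)
    fix u v :: real assume "u \<in> {-1..1}" "v \<in> {-1..1}"
    hence "\<bar>u\<bar> \<le> 1" "\<bar>v\<bar> \<le> 1" by auto
    thus "p_uv k a b p u v z = (\<Sum>x\<in>I. q x * (v ^ i x * u ^ j x))"
      using a b by (simp add: p_uv_eq_poly_pairing k linear)
  qed auto
  also have "\<dots> = poly_pairing p (J_coeff k (a + b) (even_moments a b) z)"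
    unfolding nu_density_double_integral_sum[OF a b] linear ..
  finally show ?thesis .
qed

section \<open>Gaussian integrals of Hermite polynomials\<close>

definition gauss_wave :: "nat \<Rightarrow> real \<Rightarrow> real \<Rightarrow> complex" where
  "gauss_wave n y x = of_real (1 / sqrt (2 * pi)) * exp (- (of_real x)\<^sup>2 / 2) * of_real x ^ n *
      exp (- (\<i> * of_real x * of_real y))"

lemma gauss_wave_eq:
  "gauss_wave n y x =
    of_real (std_normal_density x * x ^ n) * exp (- (\<i> * of_real x * of_real y))"
proof -
  have "exp (- (complex_of_real x)\<^sup>2 / 2) = of_real (exp (- x\<^sup>2 / 2))"
    by (simp add: exp_of_real[symmetric])
  thus ?thesis by (simp add: gauss_wave_def std_normal_density_def)
qed

lemma norm_gauss_wave: "norm (gauss_wave n y x) = std_normal_density x * \<bar>x\<bar> ^ n"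
  by (simp add: gauss_wave_eq norm_mult norm_power)

lemma gauss_wave_measurable [measurable]: "gauss_wave n y \<in> borel_measurable borel"
  unfolding gauss_wave_def by (intro borel_measurable_continuous_onI continuous_intros) auto

lemma gauss_wave_integrable: "integrable lborel (gauss_wave n y)"
  by (rule Bochner_Integration.integrable_bound[OF integrable_std_normal_moment_abs[of n]])
      (auto simp: norm_gauss_wave)

lemma norm_gauss_wave_le:
  "norm (gauss_wave n y x) \<le>
    exp (1 / 2) / sqrt (2 * pi) * (\<bar>x\<bar> ^ n / exp \<bar>x\<bar>)"
proof -
  have "0 \<le> (\<bar>x\<bar> - 1)\<^sup>2" by simp
  hence "- x\<^sup>2 / 2 \<le> 1 / 2 - \<bar>x\<bar>" by (simp add: power2_eq_square algebra_simps)
  hence "exp (- x\<^sup>2 / 2) \<le> exp (1 / 2) / exp \<bar>x\<bar>" by (simp add: exp_diff[symmetric])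
  hence "exp (- x\<^sup>2 / 2) * \<bar>x\<bar> ^ n / sqrt (2 * pi) \<le>
      (exp (1 / 2) / exp \<bar>x\<bar>) * \<bar>x\<bar> ^ n / sqrt (2 * pi)"
    by (intro divide_right_mono mult_right_mono) auto
  thus ?thesis by (simp add: norm_gauss_wave std_normal_density_def mult_ac)
qed

lemma gauss_wave_tendsto_0:
  "(gauss_wave n y \<longlongrightarrow> 0) at_top" "(gauss_wave n y \<longlongrightarrow> 0) at_bot"
proof -
  define C where "C = exp (1 / 2) / sqrt (2 * pi)"
  have majorant: "((\<lambda>x. C * (x ^ n / exp x)) \<longlongrightarrow> 0) at_top"
    by (intro tendsto_mult_right_zero tendsto_power_div_exp_0)
  have bound: "norm (gauss_wave n y x) \<le> C * (x ^ n / exp x)"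
    "norm (gauss_wave n y (- x)) \<le> C * (x ^ n / exp x)" if "x \<ge> 0" for x
    using that norm_gauss_wave_le[of n y x] norm_gauss_wave_le[of n y "- x"] by (simp_all add: C_def)
  have "(gauss_wave n y \<longlongrightarrow> 0) at_top" and "((\<lambda>x. gauss_wave n y (- x)) \<longlongrightarrow> 0) at_top"
    by (rule Lim_null_comparison[OF eventually_at_top_linorderI[of 0] majorant], rule bound, simp)+
  thus "(gauss_wave n y \<longlongrightarrow> 0) at_top" "(gauss_wave n y \<longlongrightarrow> 0) at_bot"
    by (simp_all add: filterlim_at_bot_mirror)
qed

definition gauss_fourier :: "nat \<Rightarrow> real \<Rightarrow> complex" where
  "gauss_fourier n y = integral\<^sup>L lborel (gauss_wave n y)"

lemma gauss_wave_has_vector_derivative: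
  "(gauss_wave n y has_vector_derivative
     of_nat n * gauss_wave (n - 1) y x - gauss_wave (Suc n) y x -
     \<i> * of_real y * gauss_wave n y x) (at x)"
proof -
  define c where "c = complex_of_real (1 / sqrt (2 * pi))"
  have wave:
      "gauss_wave m y x = c * exp (- (of_real x)\<^sup>2 / 2) * of_real x ^ m *
          exp (- (\<i> * of_real x * of_real y))" for m x
    by (simp only: gauss_wave_def c_def)
  have "((\<lambda>z. c * exp (- z\<^sup>2 / 2) * z ^ n * exp (- (\<i> * z * of_real y))) has_field_derivative
      of_nat n * gauss_wave (n - 1) y x - gauss_wave (Suc n) y x -
      \<i> * of_real y * gauss_wave n y x) (at (of_real x))"
    unfolding wave by (auto intro!: derivative_eq_intros simp: algebra_simps power2_eq_square)
  thus ?thesis unfolding wave[abs_def] by (rule has_vector_derivative_real_field)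
qed

lemma gauss_fourier_Suc:
  "gauss_fourier (Suc n) y = of_nat n * gauss_fourier (n - 1) y - \<i> * of_real y * gauss_fourier n y"
proof -
  define F' where "F' x = of_nat n * gauss_wave (n - 1) y x - gauss_wave (Suc n) y x -
      \<i> * of_real y * gauss_wave n y x" for x
  have integrable: "integrable lborel F'"
    unfolding F'_def
    by (intro Bochner_Integration.integrable_diff integrable_mult_right gauss_wave_integrable)
  have "(LBINT x=-\<infinity>..\<infinity>. F' x) = 0 - 0"
  proof (rule interval_integral_FTC_integrable)
    show "(gauss_wave n y has_vector_derivative F' x) (at x)" for x
      unfolding F'_def by (rule gauss_wave_has_vector_derivative)
    show "isCont F' x" for x
      unfolding F'_def gauss_wave_def by (intro continuous_intros) auto
    show "set_integrable lborel (einterval (- \<infinity>) \<infinity>) F'"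
      using integrable by (simp add: einterval_eq_UNIV set_integrable_def)
    show "((gauss_wave n y \<circ> real_of_ereal) \<longlongrightarrow> 0) (at_right (- \<infinity>))"
      "((gauss_wave n y \<circ> real_of_ereal) \<longlongrightarrow> 0) (at_left \<infinity>)"
      using gauss_wave_tendsto_0 by (simp_all add: ereal_tendsto_simps)
  qed simp
  hence "integral\<^sup>L lborel F' = 0"
    by (simp add: interval_lebesgue_integral_def einterval_eq_UNIV set_lebesgue_integral_def)
  moreover have "integral\<^sup>L lborel F' =
      of_nat n * gauss_fourier (n - 1) y - gauss_fourier (Suc n) y -
      \<i> * of_real y * gauss_fourier n y"
    unfolding F'_def gauss_fourier_def by (simp add: gauss_wave_integrable)
  ultimately show ?thesis by (simp add: algebra_simps)
qed

lemma gauss_fourier_0: "gauss_fourier 0 y = of_real (exp (- y\<^sup>2 / 2))"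
proof -
  have "char std_normal_distribution (- y) = (LINT x|lborel. std_normal_density x *\<^sub>R iexp (- y * x))"
    unfolding char_def by (subst integral_density) auto
  also have "(\<lambda>x. std_normal_density x *\<^sub>R iexp (- y * x)) = gauss_wave 0 y"
    by (auto simp: gauss_wave_eq fun_eq_iff scaleR_conv_of_real mult_ac)
  finally show ?thesis by (simp add: gauss_fourier_def char_std_normal_distribution)
qed

primrec hermite :: "nat \<Rightarrow> real poly" where
  "hermite 0 = 1"
| "hermite (Suc n) = [:0, 1:] * hermite n - pderiv (hermite n)"

lemma pderiv_hermite_Suc: "pderiv (hermite (Suc n)) = smult (real (Suc n)) (hermite n)"
proof (induction n)
  case 0
  show ?case by (simp add: pderiv_pCons)
next
  case (Suc n)
  have "pderiv (hermite (Suc (Suc n))) =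
      hermite (Suc n) + [:0, 1:] * pderiv (hermite (Suc n)) - pderiv (pderiv (hermite (Suc n)))"
    by (simp only: hermite.simps(2)[of "Suc n"] pderiv_diff pderiv_mult)
       (simp add: pderiv_pCons del: hermite.simps)
  also have "\<dots> = hermite (Suc n) + smult (real (Suc n)) (hermite (Suc n))"
    unfolding Suc pderiv_smult
    by (simp only: hermite.simps(2)[of n] smult_diff_right mult_smult_right add_diff_eq)
  also have "\<dots> = smult (real (Suc (Suc n))) (hermite (Suc n))"
    unfolding of_nat_Suc[of "Suc n"] smult_add_left smult_1_left ..
  finally show ?case .
qed

lemma gauss_fourier_eq_hermite:
  "gauss_fourier n y = (- \<i>) ^ n * of_real (poly (hermite n) y * exp (- y\<^sup>2 / 2))"
proof (induction n rule: induct_nat_012)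
  case (ge2 n)
  define e where "e = complex_of_real (exp (- y\<^sup>2 / 2))"
  define H where "H m = complex_of_real (poly (hermite m) y)" for m
  have IH: "gauss_fourier n y = (- \<i>) ^ n * (H n * e)"
    "gauss_fourier (Suc n) y = (- \<i>) ^ Suc n * (H (Suc n) * e)"
    using ge2.IH by (simp_all only: of_real_mult e_def H_def)
  have "poly (hermite (Suc (Suc n))) y =
      y * poly (hermite (Suc n)) y - real (Suc n) * poly (hermite n) y"
    by (simp only: hermite.simps(2)[of "Suc n"] pderiv_hermite_Suc)
        (simp del: hermite.simps of_nat_Suc)
  hence three_term: "H (Suc (Suc n)) = of_real y * H (Suc n) - of_nat (Suc n) * H n"
    by (simp only: H_def of_real_mult of_real_diff of_real_of_nat_eq)
  have "gauss_fourier (Suc (Suc n)) y =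
      of_nat (Suc n) * gauss_fourier n y - \<i> * of_real y * gauss_fourier (Suc n) y"
    unfolding gauss_fourier_Suc[of "Suc n"] diff_Suc_1 ..
  also have "\<dots> = (- \<i>) ^ Suc (Suc n) * (H (Suc (Suc n)) * e)"
    unfolding IH three_term by (simp add: algebra_simps del: of_nat_Suc)
  finally show ?case by (simp only: H_def e_def of_real_mult)
qed (simp_all add: gauss_fourier_Suc gauss_fourier_0)

definition gauss_mean :: "real poly \<Rightarrow> real" where
  "gauss_mean q = integral\<^sup>L lborel (\<lambda>x. std_normal_density x * poly q x)"

lemma gauss_poly_integrable: "integrable lborel (\<lambda>x. std_normal_density x * poly q x)"
proof -
  have "(\<lambda>x. std_normal_density x * poly q x) =
      (\<lambda>x. \<Sum>i\<le>degree q. coeff q i * (std_normal_density x * x ^ i))"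
    by (simp add: poly_altdef sum_distrib_left mult_ac)
  thus ?thesis by (simp add: integrable_std_normal_moment)
qed

lemma gauss_mean_add: "gauss_mean (p + q) = gauss_mean p + gauss_mean q"
  using gauss_poly_integrable by (simp add: gauss_mean_def distrib_left)

lemma gauss_mean_diff: "gauss_mean (p - q) = gauss_mean p - gauss_mean q"
  using gauss_poly_integrable by (simp add: gauss_mean_def right_diff_distrib)

lemma gauss_mean_smult: "gauss_mean (smult c q) = c * gauss_mean q"
  by (simp add: gauss_mean_def mult.left_commute)

lemma gauss_mean_1: "gauss_mean 1 = 1"
  using integral_std_normal_moment_even[of 0] by (simp add: gauss_mean_def)

lemma gauss_mean_monom_Suc: "gauss_mean (monom 1 (Suc n)) = real n * gauss_mean (monom 1 (n - 1))"
proof -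
  have transform_at_0: "gauss_fourier n 0 = of_real (gauss_mean (monom 1 n))" for n
  proof -
    have "gauss_wave n 0 = (\<lambda>x. complex_of_real (std_normal_density x * poly (monom 1 n) x))"
      by (simp add: fun_eq_iff gauss_wave_eq poly_monom)
    thus ?thesis unfolding gauss_fourier_def gauss_mean_def by (simp only: integral_complex_of_real)
  qed
  from gauss_fourier_Suc[of n 0, unfolded transform_at_0]
  have "complex_of_real (gauss_mean (monom 1 (Suc n))) =
      of_real (real n * gauss_mean (monom 1 (n - 1)))" by simp
  thus ?thesis by (simp only: of_real_eq_iff)
qed

lemma gauss_mean_X_mult: "gauss_mean ([:0, 1:] * q) = gauss_mean (pderiv q)"
proof -
  have monomial: "gauss_mean ([:0, 1:] * monom c i) = gauss_mean (pderiv (monom c i))" for c i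
  proof -
    have "[:0, 1:] * monom c i = smult c (monom 1 (Suc i))" by (simp add: smult_monom monom_Suc)
    moreover have "pderiv (monom c i) = smult (c * real i) (monom 1 (i - 1))"
      by (simp add: pderiv_monom smult_monom mult.commute)
    ultimately show ?thesis by (simp only: gauss_mean_smult gauss_mean_monom_Suc mult.assoc)
  qed
  have "gauss_mean ([:0, 1:] * (\<Sum>i\<in>I. monom (c i) i)) =
      gauss_mean (pderiv (\<Sum>i\<in>I. monom (c i) i))" for I c
  proof (induction I rule: infinite_finite_induct)
    case (insert i I)
    have "(\<Sum>i\<in>insert i I. monom (c i) i) = monom (c i) i + (\<Sum>i\<in>I. monom (c i) i)"
      using insert by simp
    thus ?case using insert.IH by (simp only: distrib_left pderiv_add gauss_mean_add monomial)
  qed (simp_all add: gauss_mean_def)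
  from this[of "coeff q" "{..degree q}"] show ?thesis by (simp only: poly_as_sum_of_monoms)
qed

lemma gauss_mean_hermite_mult: "gauss_mean (hermite n * q) = gauss_mean ((pderiv ^^ n) q)"
proof (induction n arbitrary: q)
  case (Suc n)
  have "gauss_mean (hermite (Suc n) * q) =
      gauss_mean ([:0, 1:] * (hermite n * q)) - gauss_mean (pderiv (hermite n) * q)"
    by (simp only: hermite.simps left_diff_distrib gauss_mean_diff mult.assoc)
  also have "\<dots> = gauss_mean (hermite n * pderiv q)"
    unfolding gauss_mean_X_mult pderiv_mult gauss_mean_add by (simp add: mult.commute)
  finally show ?case by (simp add: Suc funpow_swap1)
qed simp

lemma funpow_pderiv_smult: "(pderiv ^^ n) (smult c q) = smult c ((pderiv ^^ n) q)"
  by (induction n) (simp_all add: pderiv_smult)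

lemma funpow_pderiv_hermite: "(pderiv ^^ n) (hermite n) = [:fact n:]"
proof (induction n)
  case (Suc n)
  have "(pderiv ^^ Suc n) (hermite (Suc n)) = (pderiv ^^ n) (pderiv (hermite (Suc n)))"
    by (simp add: funpow_swap1)
  thus ?case unfolding pderiv_hermite_Suc funpow_pderiv_smult Suc by simp
qed (simp add: one_pCons)

lemma funpow_pderiv_hermite_eq_0:
  assumes "m < n"
  shows "(pderiv ^^ n) (hermite m) = 0"
proof -
  obtain d where "n = Suc d + m" using less_imp_Suc_add[OF assms] by (auto simp: add.commute)
  hence "(pderiv ^^ n) (hermite m) = (pderiv ^^ d) (pderiv [:fact m:])"
    by (simp only: funpow_add funpow_Suc_right comp_def funpow_pderiv_hermite)
  also have "\<dots> = 0" by (induction d) (simp_all add: pderiv_pCons)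
  finally show ?thesis .
qed

lemma gauss_mean_hermite: "gauss_mean (hermite n * hermite m) = (if n = m then fact n else 0)"
proof -
  have orthogonal: "gauss_mean (hermite n * hermite m) = 0" if "m < n" for m n
    unfolding gauss_mean_hermite_mult funpow_pderiv_hermite_eq_0[OF that]
    by (simp add: gauss_mean_def)
  consider "n = m" | "m < n" | "n < m" by linarith
  thus ?thesis
  proof cases
    assume "n = m"
    moreover have "gauss_mean [:fact m:] = fact m"
      using gauss_mean_smult[of "fact m" 1] by (simp add: gauss_mean_1)
    ultimately show ?thesis by (simp add: gauss_mean_hermite_mult funpow_pderiv_hermite)
  next
    assume "n < m"
    thus ?thesis using orthogonal[of n m] by (simp add: mult.commute)
  qed (simp add: orthogonal)
qed

lemma gauss_mean_abs_mult_le: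
  assumes "s > 0"
  shows "(LINT x|lborel. std_normal_density x * \<bar>poly (p * q) x\<bar>) \<le>
      (s * gauss_mean (p * p) + gauss_mean (q * q) / s) / 2"
proof -
  have "(LINT x|lborel. std_normal_density x * \<bar>poly (p * q) x\<bar>) \<le>
     (LINT x|lborel. (s * (std_normal_density x * poly (p * p) x) +
     (std_normal_density x * poly (q * q) x) / s) / 2)"
  proof (rule integral_mono)
    have "integrable lborel (\<lambda>x. \<bar>std_normal_density x * poly (p * q) x\<bar>)"
      using gauss_poly_integrable by (rule integrable_abs)
    thus "integrable lborel (\<lambda>x. std_normal_density x * \<bar>poly (p * q) x\<bar>)" by (simp add: abs_mult)
    show "integrable lborel (\<lambda>x. (s * (std_normal_density x * poly (p * p) x) +
        (std_normal_density x * poly (q * q) x) / s) / 2)"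
      using gauss_poly_integrable[of "p * p"] gauss_poly_integrable[of "q * q"]
      by (intro integrable_divide_zero Bochner_Integration.integrable_add integrable_mult_right) auto
    fix x
    define X where "X = \<bar>poly p x\<bar>"
    define Y where "Y = \<bar>poly q x\<bar>"
    have "0 \<le> (s * X - Y)\<^sup>2" by simp
    hence "2 * s * (X * Y) \<le> s * s * (X * X) + Y * Y" by (simp add: power2_eq_square algebra_simps)
    hence "X * Y \<le> (s * (X * X) + (Y * Y) / s) / 2" using assms by (simp add: field_simps)
    hence "std_normal_density x * (X * Y) \<le> std_normal_density x * ((s * (X * X) + (Y * Y) / s) / 2)"
      by (intro mult_left_mono) auto
    thus "std_normal_density x * \<bar>poly (p * q) x\<bar> \<le>
        (s * (std_normal_density x * poly (p * p) x) +
        (std_normal_density x * poly (q * q) x) / s) / 2"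
      by (simp add: X_def Y_def abs_mult algebra_simps add_divide_distrib)
  qed
  also have "\<dots> = (s * gauss_mean (p * p) + gauss_mean (q * q) / s) / 2"
    unfolding gauss_mean_def
    using gauss_poly_integrable[of "p * p"] gauss_poly_integrable[of "q * q"] by simp
  finally show ?thesis .
qed

section \<open>The Fourier pairing\<close>

lemma measurable_Complex [measurable]:
  "(\<lambda>(x, y). Complex x y) \<in> borel_measurable (lborel \<Otimes>\<^sub>M lborel)"
proof -
  have "(\<lambda>(x, y). Complex x y) = (\<lambda>p. of_real (fst p) + \<i> * of_real (snd p))"
    by (auto simp: complex_eq_iff)
  thus ?thesis by simp
qed

lemma lborel_complex_eq_distr: "lborel = distr (lborel \<Otimes>\<^sub>M lborel) borel (\<lambda>(x, y). Complex x y)"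
proof (rule lborel_eqI)
  fix l u :: complex assume "\<And>b. b \<in> Basis \<Longrightarrow> l \<bullet> b \<le> u \<bullet> b"
  from this[of 1] this[of \<i>] have corners: "Re l \<le> Re u" "Im l \<le> Im u" by (auto simp: Basis_complex_def)
  have "(\<lambda>(x, y). Complex x y) -` box l u \<inter> space (lborel \<Otimes>\<^sub>M lborel) =
      {Re l<..<Re u} \<times> {Im l<..<Im u}"
    by (auto simp: in_box_complex_iff space_pair_measure)
  hence "emeasure (distr (lborel \<Otimes>\<^sub>M lborel) borel (\<lambda>(x, y). Complex x y)) (box l u) =
      emeasure (lborel \<Otimes>\<^sub>M lborel) ({Re l<..<Re u} \<times> {Im l<..<Im u})"
    by (subst emeasure_distr) auto
  also have "\<dots> = ennreal (Re u - Re l) * ennreal (Im u - Im l)"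
    using corners by (subst lborel.emeasure_pair_measure_Times) auto
  also have "\<dots> = (\<Prod>b\<in>Basis. (u - l) \<bullet> b)"
    using corners by (simp add: Basis_complex_def ennreal_mult)
  finally show "emeasure (distr (lborel \<Otimes>\<^sub>M lborel) borel (\<lambda>(x, y). Complex x y)) (box l u) =
      (\<Prod>b\<in>Basis. (u - l) \<bullet> b)" .
qed simp

lemma integral_complex_product:
  fixes f g :: "real \<Rightarrow> complex"
  assumes f: "integrable lborel f" and g: "integrable lborel g"
  shows "integrable lborel (\<lambda>z. f (Re z) * g (Im z))"
    and "(LINT z|lborel. f (Re z) * g (Im z)) = integral\<^sup>L lborel f * integral\<^sup>L lborel g"
proof -
  have [measurable]: "f \<in> borel_measurable borel" "g \<in> borel_measurable borel"
    using borel_measurable_integrable[OF f] borel_measurable_integrable[OF g] by auto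
  have product: "integrable (lborel \<Otimes>\<^sub>M lborel) (\<lambda>p. f (fst p) * g (snd p))"
  proof (rule lborel_pair.Fubini_integrable)
    show "integrable lborel (\<lambda>x. LINT y|lborel. norm (f (fst (x, y)) * g (snd (x, y))))"
      using f by (simp add: norm_mult)
    show "AE x in lborel. integrable lborel (\<lambda>y. f (fst (x, y)) * g (snd (x, y)))"
      using g by simp
  qed measurable
  have pull_back:
      "(\<lambda>p. f (Re (case p of (x, y) \<Rightarrow> Complex x y)) * g (Im (case p of (x, y) \<Rightarrow> Complex x y))) =
      (\<lambda>p. f (fst p) * g (snd p))"
    by (auto simp: fun_eq_iff)
  show "integrable lborel (\<lambda>z. f (Re z) * g (Im z))"
    by (subst lborel_complex_eq_distr, subst integrable_distr_eq) (auto simp: pull_back product)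
  have "(LINT z|lborel. f (Re z) * g (Im z)) =
      integral\<^sup>L (lborel \<Otimes>\<^sub>M lborel) (\<lambda>p. f (fst p) * g (snd p))"
    by (subst lborel_complex_eq_distr, subst integral_distr) (auto simp: pull_back)
  also have "\<dots> = (LINT x|lborel. LINT y|lborel. f x * g y)"
    using lborel_pair.integral_fst'[OF product] by simp
  finally show "(LINT z|lborel. f (Re z) * g (Im z)) =
      integral\<^sup>L lborel f * integral\<^sup>L lborel g" by simp
qed

lemma integral_norm_complex_product:
  fixes f g :: "real \<Rightarrow> complex"
  assumes "integrable lborel f" and "integrable lborel g"
  shows "(LINT z|lborel. norm (f (Re z) * g (Im z))) =
      (LINT x|lborel. norm (f x)) * (LINT x|lborel. norm (g x))"
proof -
  have "(LINT z|lborel. complex_of_real (norm (f (Re z))) * complex_of_real (norm (g (Im z)))) =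
     (LINT x|lborel. complex_of_real (norm (f x))) * (LINT x|lborel. complex_of_real (norm (g x)))"
    using assms by (intro integral_complex_product integrable_of_real integrable_norm)
  hence "complex_of_real (LINT z|lborel. norm (f (Re z)) * norm (g (Im z))) =
     complex_of_real ((LINT x|lborel. norm (f x)) * (LINT x|lborel. norm (g x)))"
    by (simp only: of_real_mult[symmetric] integral_complex_of_real)
  thus ?thesis by (simp only: of_real_eq_iff norm_mult)
qed

lemma has_sum_integral:
  fixes f :: "'i \<Rightarrow> 'a \<Rightarrow> complex"
  assumes A: "countable A" "infinite A"
    and int: "\<And>i. i \<in> A \<Longrightarrow> integrable M (f i)"
    and summable: "(\<lambda>i. LINT x|M. norm (f i x)) summable_on A"
    and F: "\<And>x. ((\<lambda>i. f i x) has_sum F x) A"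
  shows "integrable M F" and "((\<lambda>i. integral\<^sup>L M (f i)) has_sum integral\<^sup>L M F) A"
proof -
  have enum: "bij_betw (from_nat_into A) UNIV A" by (rule bij_betw_from_nat_into[OF A])
  define g where "g n = f (from_nat_into A n)" for n
  have int_g: "integrable M (g n)" for n
    unfolding g_def using int bij_betwE[OF enum] by simp
  have "(\<lambda>n. LINT x|M. norm (g n x)) summable_on UNIV"
    unfolding g_def using summable
    by (simp add: summable_on_reindex_bij_betw[OF enum, of "\<lambda>i. LINT x|M. norm (f i x)"])
  hence summable_norms: "summable (\<lambda>n. LINT x|M. norm (g n x))"
    by (rule summable_on_imp_summable)
  have series: "((\<lambda>n. g n x) has_sum F x) UNIV" for x
    unfolding g_def using F[of x] by (simp add: has_sum_reindex_bij_betw[OF enum, of "\<lambda>i. f i x"])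
  have sums: "(\<Sum>n. g n x) = F x" for x
    by (rule sums_unique[symmetric, OF has_sum_imp_sums[OF series]])
  have summable_norm: "summable (\<lambda>n. norm (g n x))" for x
    using has_sum_imp_summable[OF series[of x]]
    by (intro summable_on_imp_summable) (simp only: summable_on_iff_abs_summable_on_complex)
  have "integrable M (\<lambda>x. \<Sum>n. g n x)"
    using int_g summable_norms summable_norm by (intro integrable_suminf) auto
  thus "integrable M F" unfolding sums .
  have "(\<lambda>n. integral\<^sup>L M (g n)) sums (LINT x|M. (\<Sum>n. g n x))"
    using int_g summable_norms summable_norm by (intro sums_integral) auto
  moreover have "summable (\<lambda>n. norm (integral\<^sup>L M (g n)))"
    by (rule summable_comparison_test[OF _ summable_norms]) (use integral_norm_bound in auto)
  ultimately have "((\<lambda>n. integral\<^sup>L M (g n)) has_sum integral\<^sup>L M F) UNIV"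
    unfolding sums by (intro norm_summable_imp_has_sum)
  thus "((\<lambda>i. integral\<^sup>L M (f i)) has_sum integral\<^sup>L M F) A"
    unfolding g_def using has_sum_reindex_bij_betw[OF enum, of "\<lambda>i. integral\<^sup>L M (f i)"] by simp
qed

lemma exp_summableI:
  assumes "D \<ge> 0" and nonneg: "\<And>i. s i \<ge> 0"
    and bound: "\<And>R i. R > 0 \<Longrightarrow> s i \<le> M * (D ^ i * fact i / R ^ i + R ^ i * G)"
  shows "exp_summable s"
  unfolding exp_summable_def
proof (intro allI impI)
  fix C :: real assume C: "C \<ge> 0"
  define R where "R = 2 * C * D + 1"
  have "C * D \<ge> 0" using assms(1) C by simp
  hence R: "R > 0" "\<bar>C * D / R\<bar> < 1" by (auto simp: R_def add_nonneg_pos divide_simps)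
  have "summable (\<lambda>i. norm (C * D / R) ^ i)" using R(2) by (intro summable_geometric) simp
  hence "(\<lambda>i. (C * D / R) ^ i) summable_on UNIV"
    by (intro norm_summable_imp_summable_on) (simp only: norm_power)
  hence majorant: "(\<lambda>i. ((C * D / R) ^ i + (C * R) ^ i / fact i * G) * M) summable_on UNIV"
    by (intro summable_on_add summable_on_cmult_left exp_terms_summable_on)
  have "C ^ i / fact i * s i \<le> ((C * D / R) ^ i + (C * R) ^ i / fact i * G) * M" for i
  proof -
    have "C ^ i / fact i * s i \<le> C ^ i / fact i * (M * (D ^ i * fact i / R ^ i + R ^ i * G))"
      using C R by (intro mult_left_mono bound) auto
    also have "\<dots> = ((C * D / R) ^ i + (C * R) ^ i / fact i * G) * M"
      by (simp add: power_mult_distrib power_divide distrib_left distrib_right mult_ac)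
    finally show ?thesis .
  qed
  thus "(\<lambda>i. C ^ i / fact i * s i) summable_on UNIV"
    by (rule summable_on_comparison_test[OF majorant]) (simp add: C nonneg)
qed

lemma exp_series_tensor_integral:
  fixes \<phi> \<psi> :: "nat \<Rightarrow> real \<Rightarrow> complex"
  assumes h: "geom_bounded h"
    and \<phi>: "\<And>i. integrable lborel (\<phi> i)" "exp_summable (\<lambda>i. LINT x|lborel. norm (\<phi> i x))"
    and \<psi>: "\<And>j. integrable lborel (\<psi> j)" "exp_summable (\<lambda>j. LINT x|lborel. norm (\<psi> j x))"
    and F: "\<And>z. ((\<lambda>(i, j). of_real (h i j / (fact i * fact j)) * (\<phi> i (Re z) * \<psi> j (Im z)))
      has_sum F z) UNIV"
  shows "integrable lborel F"
    and "((\<lambda>(i, j). of_real (h i j / (fact i * fact j)) *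
        (integral\<^sup>L lborel (\<phi> i) * integral\<^sup>L lborel (\<psi> j)))
      has_sum integral\<^sup>L lborel F) UNIV"
proof -
  define T where "T p z = of_real (h (fst p) (snd p) / (fact (fst p) * fact (snd p))) *
    (\<phi> (fst p) (Re z) * \<psi> (snd p) (Im z))" for p z
  have int: "integrable lborel (T p)" for p
    unfolding T_def by (intro integrable_mult_right integral_complex_product \<phi> \<psi>)
  have "(LINT z|lborel. norm (T p z)) = (case p of (i, j) \<Rightarrow> \<bar>h i j\<bar> / (fact i * fact j) *
      ((LINT x|lborel. norm (\<phi> i x)) * (LINT x|lborel. norm (\<psi> j x))))" for p
    unfolding T_def norm_mult[of "of_real _"] norm_of_real integral_mult_right_zero
      integral_norm_complex_product[OF \<phi>(1) \<psi>(1)] by (simp add: case_prod_unfold)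
  hence summable: "(\<lambda>p. LINT z|lborel. norm (T p z)) summable_on UNIV"
    using geom_bounded_exp_summable[OF h \<phi>(2) _ \<psi>(2)] by simp
  have pointwise: "((\<lambda>p. T p z) has_sum F z) UNIV" for z
    using F[of z] by (simp add: T_def case_prod_unfold)
  have countable: "countable (UNIV :: (nat \<times> nat) set)" "infinite (UNIV :: (nat \<times> nat) set)"
    by (simp_all add: finite_prod)
  show "integrable lborel F"
    by (rule has_sum_integral(1)[OF countable int summable pointwise])
  show "((\<lambda>(i, j). of_real (h i j / (fact i * fact j)) *
      (integral\<^sup>L lborel (\<phi> i) * integral\<^sup>L lborel (\<psi> j)))
      has_sum integral\<^sup>L lborel F) UNIV"
    using has_sum_integral(2)[OF countable int summable pointwise]
    unfolding T_def integral_mult_right_zero integral_complex_product(2)[OF \<phi>(1) \<psi>(1)]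
    by (simp add: case_prod_unfold)
qed

lemma exp_summable_gauss_wave: "exp_summable (\<lambda>i. LINT x|lborel. norm (gauss_wave i y x))"
proof (rule exp_summableI[where D = 2 and G = 1 and M = "1 / 2"])
  fix R :: real and i assume R: "R > 0"
  have "(LINT x|lborel. norm (gauss_wave i y x)) =
      (LINT x|lborel. std_normal_density x * \<bar>poly (monom 1 i * 1) x\<bar>)"
    by (simp add: norm_gauss_wave poly_monom power_abs)
  also have "\<dots> \<le> (1 / R ^ i * gauss_mean (monom 1 i * monom 1 i) +
      gauss_mean (1 * 1) / (1 / R ^ i)) / 2"
    using R by (intro gauss_mean_abs_mult_le) auto
  also have "gauss_mean (monom 1 i * monom 1 i) = fact (2 * i) / (2 ^ i * fact i)"
    using integral_std_normal_moment_even[of i]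
    by (simp add: gauss_mean_def poly_monom mult_2 power_add)
  also have "\<dots> \<le> 2 ^ i * fact i"
  proof -
    have "fact (2 * i) = fact i * fact i * real (2 * i choose i)"
      by (simp add: binomial_fact)
    also have "\<dots> \<le> fact i * fact i * real (2 ^ (2 * i))"
      by (intro mult_left_mono of_nat_mono binomial_le_pow2) auto
    also have "real (2 ^ (2 * i)) = 2 ^ i * 2 ^ i" by (simp add: mult_2 power_add)
    also have "fact i * fact i * (2 ^ i * 2 ^ i) = (2 ^ i * fact i) * (2 ^ i * fact i :: real)"
      by (simp only: mult_ac)
    finally show ?thesis by (simp add: divide_le_eq)
  qed
  finally show "(LINT x|lborel. norm (gauss_wave i y x)) \<le>
      1 / 2 * (2 ^ i * fact i / R ^ i + R ^ i * 1)"
    using R by (simp add: gauss_mean_1 mult_left_mono divide_right_mono)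
qed auto

lemma fourier2_gauss_mult:
  "fourier2 (\<lambda>x. exp (- (cmod x)\<^sup>2 / 2) * f x) y =
    (LINT x|lborel. gauss_wave 0 (Re y) (Re x) * gauss_wave 0 (Im y) (Im x) * of_real (f x))"
proof -
  have pointwise:
      "(1 / (2 * pi)) * (exp (- \<i> * of_real (x \<bullet> y)) * of_real (exp (- (cmod x)\<^sup>2 / 2) * f x)) =
     gauss_wave 0 (Re y) (Re x) * gauss_wave 0 (Im y) (Im x) * of_real (f x)" for x
  proof -
    have density_split: "exp (- (cmod x)\<^sup>2 / 2) = exp (- (Re x)\<^sup>2 / 2) * exp (- (Im x)\<^sup>2 / 2)"
      by (simp add: cmod_power2 add_divide_distrib flip: exp_add)
    have "std_normal_density (Re x) * std_normal_density (Im x) =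
        1 / (2 * pi) * exp (- (cmod x)\<^sup>2 / 2)"
      unfolding density_split std_normal_density_def by simp
    hence densities:
        "complex_of_real (1 / (2 * pi) * exp (- (cmod x)\<^sup>2 / 2)) =
            of_real (std_normal_density (Re x)) * of_real (std_normal_density (Im x))"
      by (simp only: of_real_mult[symmetric])
    have wave_split:
        "exp (- \<i> * of_real (x \<bullet> y)) = exp (- (\<i> * of_real (Re x) * of_real (Re y))) *
            exp (- (\<i> * of_real (Im x) * of_real (Im y)))"
      by (simp add: inner_complex_def algebra_simps flip: exp_add)
    have "(1 / (2 * pi)) * (exp (- \<i> * of_real (x \<bullet> y)) * of_real (exp (- (cmod x)\<^sup>2 / 2) * f x)) =
       complex_of_real (1 / (2 * pi) * exp (- (cmod x)\<^sup>2 / 2)) * exp (- \<i> * of_real (x \<bullet> y)) *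
       of_real (f x)"
      by (simp add: mult_ac)
    thus ?thesis unfolding densities wave_split gauss_wave_eq by (simp add: mult_ac)
  qed
  have "fourier2 (\<lambda>x. exp (- (cmod x)\<^sup>2 / 2) * f x) y =
     (LINT x|lborel. (1 / (2 * pi)) *
     (exp (- \<i> * of_real (x \<bullet> y)) * of_real (exp (- (cmod x)\<^sup>2 / 2) * f x)))"
    unfolding fourier2_def by (simp only: integral_mult_right_zero)
  thus ?thesis unfolding pointwise .
qed

lemma gauss_wave_mult_power:
  "gauss_wave 0 y x * gauss_wave 0 y' x' * of_real (c * x ^ i * x' ^ j) =
      of_real c * (gauss_wave i y x * gauss_wave j y' x')"
  by (simp add: gauss_wave_def mult_ac)

lemma fourier2_gauss_exp_series:
  assumes "geom_bounded h"
  shows "((\<lambda>(i, j). of_real (h i j / (fact i * fact j)) *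
      (gauss_fourier i (Re y) * gauss_fourier j (Im y)))
    has_sum fourier2 (\<lambda>x. exp (- (cmod x)\<^sup>2 / 2) * exp_series h x) y) UNIV"
  unfolding fourier2_gauss_mult gauss_fourier_def
proof (rule exp_series_tensor_integral(2)[OF assms gauss_wave_integrable exp_summable_gauss_wave
      gauss_wave_integrable exp_summable_gauss_wave])
  fix x
  have "((\<lambda>p. gauss_wave 0 (Re y) (Re x) * gauss_wave 0 (Im y) (Im x) *
      of_real (case p of (i, j) \<Rightarrow> h i j / (fact i * fact j) * Re x ^ i * Im x ^ j)) has_sum
      gauss_wave 0 (Re y) (Re x) * gauss_wave 0 (Im y) (Im x) * of_real (exp_series h x)) UNIV"
    by (intro has_sum_cmult_right has_sum_of_real exp_series_has_sum assms)
  thus "((\<lambda>(i, j). of_real (h i j / (fact i * fact j)) *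
      (gauss_wave i (Re y) (Re x) * gauss_wave j (Im y) (Im x)))
      has_sum gauss_wave 0 (Re y) (Re x) * gauss_wave 0 (Im y) (Im x) *
      of_real (exp_series h x)) UNIV"
    unfolding case_prod_unfold gauss_wave_mult_power .
qed

lemma fourier2_gauss_monomials:
  assumes "finite S"
  shows "fourier2 (\<lambda>x. exp (- (cmod x)\<^sup>2 / 2) * (\<Sum>(i, j)\<in>S. c (i, j) * Re x ^ i * Im x ^ j)) y =
    (\<Sum>(i, j)\<in>S. of_real (c (i, j)) * (gauss_fourier i (Re y) * gauss_fourier j (Im y)))"
proof -
  have "fourier2 (\<lambda>x. exp (- (cmod x)\<^sup>2 / 2) * (\<Sum>(i, j)\<in>S. c (i, j) * Re x ^ i * Im x ^ j)) y =
    (LINT x|lborel. (\<Sum>p\<in>S. of_real (c p) *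
    (gauss_wave (fst p) (Re y) (Re x) * gauss_wave (snd p) (Im y) (Im x))))"
    unfolding fourier2_gauss_mult
    unfolding case_prod_unfold of_real_sum sum_distrib_left gauss_wave_mult_power by simp
  also have "\<dots> = (\<Sum>p\<in>S. of_real (c p) *
      (gauss_fourier (fst p) (Re y) * gauss_fourier (snd p) (Im y)))"
    using integral_complex_product[OF gauss_wave_integrable gauss_wave_integrable]
    by (subst Bochner_Integration.integral_sum) (auto simp: gauss_fourier_def)
  finally show ?thesis by (simp add: case_prod_unfold)
qed

definition gauss_fourier_pair :: "nat \<Rightarrow> nat \<Rightarrow> real \<Rightarrow> complex" where
  "gauss_fourier_pair i j t = gauss_fourier i t * gauss_fourier j t * exp (of_real (t\<^sup>2 / 2))"

lemma gauss_fourier_pair_eq: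
  "gauss_fourier_pair i j t = ((- \<i>) ^ (i + j) * of_real (sqrt (2 * pi))) *
      of_real (std_normal_density t * poly (hermite i * hermite j) t)"
proof -
  have "complex_of_real (exp (- t\<^sup>2 / 2)) * exp (of_real (t\<^sup>2 / 2)) = 1"
    unfolding exp_of_real[symmetric] exp_add[symmetric] by simp
  hence "gauss_fourier_pair i j t =
      (- \<i>) ^ (i + j) * of_real (exp (- t\<^sup>2 / 2) * poly (hermite i * hermite j) t)"
    unfolding gauss_fourier_pair_def gauss_fourier_eq_hermite
    by (simp add: power_add mult_ac)
  also have "exp (- t\<^sup>2 / 2) * poly (hermite i * hermite j) t =
      sqrt (2 * pi) * (std_normal_density t * poly (hermite i * hermite j) t)"
    by (simp add: std_normal_density_def)
  finally show ?thesis by (simp only: of_real_mult mult_ac)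
qed

lemma gauss_fourier_pair_integrable: "integrable lborel (gauss_fourier_pair i j)"
  unfolding gauss_fourier_pair_eq
  by (intro integrable_mult_right integrable_of_real gauss_poly_integrable)

lemma gauss_fourier_pair_integral:
  "integral\<^sup>L lborel (gauss_fourier_pair i j) =
      (if i = j then of_real (sqrt (2 * pi) * (- 1) ^ i * fact i) else 0)"
proof -
  have "integral\<^sup>L lborel (gauss_fourier_pair i j) =
      ((- \<i>) ^ (i + j) * of_real (sqrt (2 * pi))) * of_real (gauss_mean (hermite i * hermite j))"
    unfolding gauss_fourier_pair_eq gauss_mean_def
    by (simp only: integral_mult_right_zero integral_complex_of_real)
  moreover have "(- \<i>) ^ (i + i) = (- 1) ^ i" by (simp add: power_add flip: power_mult_distrib)
  ultimately show ?thesis by (simp add: gauss_mean_hermite)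
qed

lemma exp_summable_gauss_fourier_pair:
  "exp_summable (\<lambda>i. LINT t|lborel. norm (gauss_fourier_pair i j t))"
proof (rule exp_summableI[where D = 1 and G = "fact j" and M = "sqrt (2 * pi) / 2"])
  fix R :: real and i assume R: "R > 0"
  have "(LINT t|lborel. norm (gauss_fourier_pair i j t)) =
      sqrt (2 * pi) * (LINT t|lborel. std_normal_density t * \<bar>poly (hermite i * hermite j) t\<bar>)"
    by (simp only: gauss_fourier_pair_eq norm_mult norm_of_real norm_power norm_minus_cancel norm_ii
        power_one mult_1_left abs_mult integral_mult_right_zero) simp
  also have "\<dots> \<le> sqrt (2 * pi) * ((1 / R ^ i * gauss_mean (hermite i * hermite i)
      + gauss_mean (hermite j * hermite j) / (1 / R ^ i)) / 2)"
    using R by (intro mult_left_mono gauss_mean_abs_mult_le) auto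
  finally show "(LINT t|lborel. norm (gauss_fourier_pair i j t)) \<le>
      sqrt (2 * pi) / 2 * (1 ^ i * fact i / R ^ i + R ^ i * fact j)"
    by (simp add: gauss_mean_hermite mult_ac)
qed auto

lemma gauss_fourier_pair_integral_product:
  "integral\<^sup>L lborel (gauss_fourier_pair i k) * integral\<^sup>L lborel (gauss_fourier_pair j l) =
    (if (i, j) = (k, l) then of_real (2 * pi * ((- 1) ^ (k + l) * (fact k * fact l))) else 0)"
proof -
  have "sqrt (2 * pi) * sqrt (2 * pi) = 2 * pi" by simp
  hence "(sqrt (2 * pi) * (- 1) ^ k * fact k) * (sqrt (2 * pi) * (- 1) ^ l * fact l) =
      2 * pi * ((- 1) ^ (k + l) * (fact k * fact l))"
    by (simp add: power_add)
  hence "complex_of_real (sqrt (2 * pi) * (- 1) ^ k * fact k) *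
      of_real (sqrt (2 * pi) * (- 1) ^ l * fact l) =
      of_real (2 * pi * ((- 1) ^ (k + l) * (fact k * fact l)))"
    by (simp only: of_real_mult[symmetric])
  thus ?thesis unfolding gauss_fourier_pair_integral by (auto simp del: of_real_mult)
qed

lemma fourier2_gauss_exp_series_mult_has_sum:
  assumes "geom_bounded h"
  shows "((\<lambda>(i, j). of_real (h i j / (fact i * fact j)) *
      (gauss_fourier_pair i k (Re y) * gauss_fourier_pair j l (Im y))) has_sum
    fourier2 (\<lambda>x. exp (- (cmod x)\<^sup>2 / 2) * exp_series h x) y *
      (gauss_fourier k (Re y) * gauss_fourier l (Im y)) * exp ((cmod y)\<^sup>2 / 2)) UNIV"
proof -
  have "complex_of_real (exp ((cmod y)\<^sup>2 / 2)) =
      exp (of_real ((Re y)\<^sup>2 / 2)) * exp (of_real ((Im y)\<^sup>2 / 2))"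
    by (simp add: cmod_power2 add_divide_distrib exp_add flip: exp_of_real)
  hence "(case p of (i, j) \<Rightarrow> of_real (h i j / (fact i * fact j)) *
        (gauss_fourier i (Re y) * gauss_fourier j (Im y))) *
      (gauss_fourier k (Re y) * gauss_fourier l (Im y) * exp ((cmod y)\<^sup>2 / 2)) =
      (case p of (i, j) \<Rightarrow> of_real (h i j / (fact i * fact j)) *
        (gauss_fourier_pair i k (Re y) * gauss_fourier_pair j l (Im y)))" for p
    unfolding gauss_fourier_pair_def case_prod_unfold by (simp only: mult_ac)
  thus ?thesis
    using has_sum_cmult_left[OF fourier2_gauss_exp_series[OF assms, of y],
        of "gauss_fourier k (Re y) * gauss_fourier l (Im y) * exp ((cmod y)\<^sup>2 / 2)"]
    by (simp only: mult.assoc)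
qed

lemma fourier_pairing_monomial:
  fixes k l :: nat
  assumes h: "geom_bounded h"
  defines "I \<equiv> \<lambda>y. fourier2 (\<lambda>x. exp (- (cmod x)\<^sup>2 / 2) * exp_series h x) y *
    (gauss_fourier k (Re y) * gauss_fourier l (Im y)) * exp ((cmod y)\<^sup>2 / 2)"
  shows "integrable lborel I" and "integral\<^sup>L lborel I = of_real (2 * pi * ((- 1) ^ (k + l) * h k l))"
proof -
  note tensor = exp_series_tensor_integral[OF h
      gauss_fourier_pair_integrable exp_summable_gauss_fourier_pair
      gauss_fourier_pair_integrable exp_summable_gauss_fourier_pair
      fourier2_gauss_exp_series_mult_has_sum[OF h],
      of k l, folded I_def]
  show "integrable lborel I" by (rule tensor(1))
  define c where "c = complex_of_real (2 * pi * ((- 1) ^ (k + l) * h k l))"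
  have "(\<lambda>(i, j). of_real (h i j / (fact i * fact j)) *
      (integral\<^sup>L lborel (gauss_fourier_pair i k) * integral\<^sup>L lborel (gauss_fourier_pair j l))) =
      (\<lambda>p. if p = (k, l) then c else 0)"
    unfolding gauss_fourier_pair_integral_product by (auto simp: c_def)
  hence "((\<lambda>p. if p = (k, l) then c else 0) has_sum integral\<^sup>L lborel I) UNIV"
    using tensor(2) by (simp only:)
  moreover have "((\<lambda>p. if p = (k, l) then c else 0) has_sum c) UNIV"
    by (rule has_sum_finite_neutralI[where B = "{(k, l)}"]) auto
  ultimately show "integral\<^sup>L lborel I = of_real (2 * pi * ((- 1) ^ (k + l) * h k l))"
    unfolding c_def by (rule has_sum_unique)
qed

text \<open>The pairing of two monomials of degree \<open>n\<close> carries the sign \<open>(- 1) ^ n\<close>, which is absorbed by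
  the reflection \<open>x \<mapsto> - x\<close>.\<close>

lemma fourier_pairing:
  assumes h: "geom_bounded h" and p: "polyfun p"
  shows "(1 / (2 * pi)) * (LINT y|lborel.
      fourier2 (\<lambda>x. exp (- (cmod x)\<^sup>2 / 2) * exp_series h x) y *
      fourier2 (\<lambda>x. exp (- (cmod x)\<^sup>2 / 2) * p (- x)) y * exp ((cmod y)\<^sup>2 / 2)) =
    complex_of_real (poly_pairing p h)"
proof -
  define S where "S = {ij. poly_coeffs p ij \<noteq> 0}"
  define c where "c = (\<lambda>(i, j). (- 1) ^ (i + j) * poly_coeffs p (i, j))"
  define F where "F = fourier2 (\<lambda>x. exp (- (cmod x)\<^sup>2 / 2) * exp_series h x)"
  have S: "finite S" unfolding S_def by (rule finite_poly_coeffs[OF p])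
  have rep: "poly_rep c (\<lambda>x. p (- x))"
    unfolding c_def by (rule poly_rep_uminus[OF poly_rep_poly_coeffs[OF p]])
  have support: "{ij. c ij \<noteq> 0} \<subseteq> S" by (auto simp: S_def c_def)
  have "p (- x) = (\<Sum>(i, j)\<in>S. c (i, j) * Re x ^ i * Im x ^ j)" for x
    by (rule poly_rep_eq_sum[OF rep S support])
  hence "fourier2 (\<lambda>x. exp (- (cmod x)\<^sup>2 / 2) * p (- x)) y =
      (\<Sum>(i, j)\<in>S. of_real (c (i, j)) * (gauss_fourier i (Re y) * gauss_fourier j (Im y)))" for y
    by (simp only: fourier2_gauss_monomials[OF S])
  hence "(LINT y|lborel. F y * fourier2 (\<lambda>x. exp (- (cmod x)\<^sup>2 / 2) * p (- x)) y *
      exp ((cmod y)\<^sup>2 / 2)) =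
      (LINT y|lborel. (\<Sum>q\<in>S. of_real (c q) *
        (F y * (gauss_fourier (fst q) (Re y) * gauss_fourier (snd q) (Im y)) *
        exp ((cmod y)\<^sup>2 / 2))))"
    by (simp add: case_prod_unfold sum_distrib_left sum_distrib_right mult_ac)
  also have "\<dots> = (\<Sum>q\<in>S. of_real (c q) *
      of_real (2 * pi * ((- 1) ^ (fst q + snd q) * h (fst q) (snd q))))"
    using fourier_pairing_monomial[OF h] unfolding F_def[symmetric]
    by (subst Bochner_Integration.integral_sum) auto
  also have "\<dots> = of_real (2 * pi *
      (\<Sum>q\<in>S. ((- 1) ^ (fst q + snd q))\<^sup>2 * (poly_coeffs p q * h (fst q) (snd q))))"
    unfolding sum_distrib_left of_real_sum c_def case_prod_unfold
    by (intro sum.cong refl)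
        (simp only: of_real_mult[symmetric] prod.collapse power2_eq_square mult_ac)
  finally show ?thesis
    by (simp add: F_def poly_pairing_def S_def case_prod_unfold flip: power_mult)
qed

lemma J_uv_everywhere_convergent:
  assumes "k > 0" and "a + b > 0" and "\<bar>u\<bar> \<le> 1" and "\<bar>v\<bar> \<le> 1"
  shows "\<exists>c :: nat \<times> nat \<Rightarrow> real. \<forall>w.
    ((\<lambda>(i, j). c (i, j) * Re w ^ i * Im w ^ j) has_sum J_uv k a b u v z w) UNIV"
proof -
  define h where "h = J_coeff k (a + b) (\<lambda>i j. v ^ i * u ^ j) z"
  define c where "c = (\<lambda>(i, j). h i j / (fact i * fact j))"
  have "geom_bounded h" unfolding h_def by (rule geom_bounded_J_coeff_powers[OF assms])
  hence "((\<lambda>(i, j). c (i, j) * Re w ^ i * Im w ^ j) has_sum exp_series h w) UNIV" for w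
    using exp_series_has_sum[of h w] by (simp add: c_def)
  thus ?thesis unfolding J_uv_eq_exp_series[OF assms] h_def[symmetric] by blast
qed

lemma intertwiner_eq_double_integral:
  assumes "k > 0" and "a > 0" and "b > 0" and "is_intertwiner k a b V"
    and "polyfun p" and "\<And>j z. j < 2 * k \<Longrightarrow> p (dih_refl k j z) = p z"
  shows "V p z = (LINT v:{-1..1}|lborel. nu_density b v *
      (LINT u:{-1..1}|lborel. nu_density a u * p_uv k a b p u v z))"
proof -
  interpret dihedral_intertwiner k a b V by unfold_locales (use assms in auto)
  show ?thesis
    unfolding double_integral_p_uv[OF assms(1,2,3,5)] by (rule V_invariant[OF assms(5,6)])
qed

lemma p_uv_eq_fourier_pairing:
  assumes "k > 0" and "a + b > 0" and "\<bar>u\<bar> \<le> 1" and "\<bar>v\<bar> \<le> 1"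
    and "polyfun p" and even: "\<And>x. p (- x) = p x"
  shows "complex_of_real (p_uv k a b p u v z) = (1 / (2 * pi)) * (LINT y|lborel.
    fourier2 (\<lambda>x. exp (- (cmod x)\<^sup>2 / 2) * J_uv k a b u v z x) y *
    fourier2 (\<lambda>x. exp (- (cmod x)\<^sup>2 / 2) * p x) y * exp ((cmod y)\<^sup>2 / 2))"
  using fourier_pairing[OF geom_bounded_J_coeff_powers[OF assms(1-4)] assms(5)]
  unfolding J_uv_eq_exp_series[OF assms(1-4)] p_uv_eq_poly_pairing[OF assms(1-4)] even by simp

lemma dihedral_invariant_imp_even:
  assumes "k > 0" and "\<And>j z. j < 2 * k \<Longrightarrow> p (dih_refl k j z) = p z"
  shows "p (- x) = p x"
  using assms(2)[of k "cnj x"] assms(2)[of 0 x] assms(1) by (simp add: dih_refl_def)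

theorem mainTheorem16:
  fixes k :: nat and a b :: real and p :: "complex \<Rightarrow> real"
    and V :: "(complex \<Rightarrow> real) \<Rightarrow> (complex \<Rightarrow> real)"
  assumes "k \<ge> 2" and "a > 0" and "b > 0"
    and "polyfun p"
    and "\<And>j z. j < 2 * k \<Longrightarrow> p (dih_refl k j z) = p z"
    and "is_intertwiner k a b V"
  shows "(\<forall>z u v. u \<in> {-1..1} \<longrightarrow> v \<in> {-1..1} \<longrightarrow>
           (\<exists>c :: nat \<times> nat \<Rightarrow> real. \<forall>w.
              ((\<lambda>(i,j). c (i,j) * Re w ^ i * Im w ^ j) has_sum J_uv k a b u v z w) UNIV))
    \<and> (\<forall>z. V p z =
         (LINT v:{-1..1}|lborel. nu_const b * (1 - v\<^sup>2) powr (b - 1) *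
           (LINT u:{-1..1}|lborel. nu_const a * (1 - u\<^sup>2) powr (a - 1) * p_uv k a b p u v z)))
    \<and> (\<forall>z u v. u \<in> {-1..1} \<longrightarrow> v \<in> {-1..1} \<longrightarrow>
         complex_of_real (p_uv k a b p u v z) =
           (1 / (2 * pi)) * integral\<^sup>L lborel (\<lambda>y.
              fourier2 (\<lambda>x. exp (- (cmod x)\<^sup>2 / 2) * J_uv k a b u v z x) y *
              fourier2 (\<lambda>x. exp (- (cmod x)\<^sup>2 / 2) * p x) y *
              exp ((cmod y)\<^sup>2 / 2)))"
proof (intro conjI allI impI)
  have k: "k > 0" and ab: "a + b > 0" using assms(1-3) by auto
  fix z
  show "V p z = (LINT v:{-1..1}|lborel. nu_const b * (1 - v\<^sup>2) powr (b - 1) *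
      (LINT u:{-1..1}|lborel. nu_const a * (1 - u\<^sup>2) powr (a - 1) * p_uv k a b p u v z))"
    using intertwiner_eq_double_integral[OF k assms(2,3,6,4,5), of z] by (simp only: nu_density_def)
  fix u v :: real assume "u \<in> {-1..1}" "v \<in> {-1..1}"
  hence uv: "\<bar>u\<bar> \<le> 1" "\<bar>v\<bar> \<le> 1" by auto
  show "\<exists>c :: nat \<times> nat \<Rightarrow> real. \<forall>w.
      ((\<lambda>(i,j). c (i,j) * Re w ^ i * Im w ^ j) has_sum J_uv k a b u v z w) UNIV"
    by (rule J_uv_everywhere_convergent[OF k ab uv])
  have "p (- x) = p x" for x by (rule dihedral_invariant_imp_even[OF k assms(5)])
  thus "complex_of_real (p_uv k a b p u v z) = (1 / (2 * pi)) * integral\<^sup>L lborel (\<lambda>y.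
      fourier2 (\<lambda>x. exp (- (cmod x)\<^sup>2 / 2) * J_uv k a b u v z x) y *
      fourier2 (\<lambda>x. exp (- (cmod x)\<^sup>2 / 2) * p x) y * exp ((cmod y)\<^sup>2 / 2))"
    by (rule p_uv_eq_fourier_pairing[OF k ab uv assms(4)])
qed

end
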